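(* Let $\gamma:I\to S^n\subset\mathbb R^{n+1}$ be a smooth curve on an interval $I\subset\mathbb R$, parametrized by arc length. Then $\gamma$ is a $4$-harmonic curve if and only if $$ \begin{aligned} &\gamma^{(8)}+2\gamma^{(6)}+(2-g_{22})\gamma^{(4)}-11g_{23}\gamma^{(3)}+(-24g_{33}-25g_{24}+2-3g_{22})\gamma''\\ &+(19g_{34}+20g_{25}+9g_{16}-13g_{23})\gamma'\\ &+(5g_{44}+11g_{35}+10g_{26}+5g_{17}-40g_{33}-43g_{24}+g_{22}^2-5g_{22}+2)\gamma=0, \end{aligned} $$ where $g_{ij}=g_0(\gamma^{(i)},\gamma^{(j)})$ $(i,j=0,1,\dots)$ and $g_0$ is the standard metric on $\mathbb R^{n+1}$.
   Context: $S^n$ is the unit sphere with its standard metric of constant sectional curvature $1$, Levi-Civita connection $\nabla$ and curvature tensor $R(X,Y)=\nabla_X\nabla_Y-\nabla_Y\nabla_X-\nabla_{[X,Y]}$; $\gamma^{(i)}$ denotes the $i$-th derivative of $\gamma$ as an $\mathbb R^{n+1}$-valued function. For a unit-speed curve $\gamma$ in $S^n$ put $\tau(\gamma)=\nabla_{\gamma'}\gamma'$ and, for vector fields $V$ along $\gamma$, $\overline\Delta V=-\nabla_{\gamma'}\nabla_{\gamma'}V$. For $k\ge2$, $\gamma$ is $k$-harmonic if $\tau_k(\gamma):=\overline\Delta^{k-1}\tau(\gamma)-R\big(\overline\Delta^{k-2}\tau(\gamma),\gamma'\big)\gamma'=0$. *)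

theory Defs
  imports "HOL-Analysis.Analysis"
begin

text \<open>
  The sphere \<open>S\<^sup>n\<close> is \<^term>\<open>sphere 0 1\<close> in a Euclidean space \<open>'a\<close> of dimension \<open>n + 1\<close>; its
  standard metric is the restriction of the inner product of \<open>'a\<close> to the tangent spaces
  \<open>T\<^sub>p S\<^sup>n = {v. p \<bullet> v = 0}\<close>. Functions and vector fields on the sphere are represented by functions
  on all of \<open>'a\<close> of which only the values on the sphere matter.
\<close>

section \<open>Smooth functions and vector fields on the unit sphere\<close>

primrec Ck_on :: "nat \<Rightarrow> 'a::euclidean_space set \<Rightarrow> ('a \<Rightarrow> 'b::real_normed_vector) \<Rightarrow> bool" where
  "Ck_on 0 U f \<longleftrightarrow> continuous_on U f"
| "Ck_on (Suc k) U f \<longleftrightarrow> (\<forall>x\<in>U. f differentiable (at x)) \<and>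
     (\<forall>v. Ck_on k U (\<lambda>x. frechet_derivative f (at x) v))"

text \<open>
  The extension of a function from the unit sphere to the punctured space that is constant along
  rays. It is smooth off the origin iff the function is smooth on the sphere, and its derivative at
  a point of the sphere in a tangent direction is the differential of the function.
\<close>

definition radial_ext :: "('a::euclidean_space \<Rightarrow> 'b) \<Rightarrow> 'a \<Rightarrow> 'b" where
  "radial_ext f x = f (x /\<^sub>R norm x)"

definition smooth_on_sphere :: "('a::euclidean_space \<Rightarrow> 'b::real_normed_vector) \<Rightarrow> bool" where
  "smooth_on_sphere f \<longleftrightarrow> (\<forall>k. Ck_on k (- {0}) (radial_ext f))"

definition sphere_differential ::
    "('a::euclidean_space \<Rightarrow> 'b::real_normed_vector) \<Rightarrow> 'a \<Rightarrow> 'a \<Rightarrow> 'b" where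
  "sphere_differential f p v = frechet_derivative (radial_ext f) (at p) v"

definition vector_fields :: "('a::euclidean_space \<Rightarrow> 'a) set" where
  "vector_fields = {X. smooth_on_sphere X \<and> (\<forall>p\<in>sphere 0 1. p \<bullet> X p = 0)}"

text \<open>
  The components of \<open>[X, Y]\<close> in \<open>'a\<close> are obtained by applying \<open>[X, Y] = X Y - Y X\<close> to the coordinate
  functions.
\<close>

definition lie_bracket :: "('a::euclidean_space \<Rightarrow> 'a) \<Rightarrow> ('a \<Rightarrow> 'a) \<Rightarrow> 'a \<Rightarrow> 'a" where
  "lie_bracket X Y p = sphere_differential Y p (X p) - sphere_differential X p (Y p)"


section \<open>Levi-Civita connection and curvature\<close>

definition affine_connection ::
    "(('a::euclidean_space \<Rightarrow> 'a) \<Rightarrow> ('a \<Rightarrow> 'a) \<Rightarrow> 'a \<Rightarrow> 'a) \<Rightarrow> bool" where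
  "affine_connection nabla \<longleftrightarrow>
     (\<forall>X\<in>vector_fields. \<forall>Y\<in>vector_fields. nabla X Y \<in> vector_fields) \<and>
     (\<forall>X\<in>vector_fields. \<forall>X'\<in>vector_fields. \<forall>Y\<in>vector_fields. \<forall>p\<in>sphere 0 1.
        nabla (\<lambda>q. X q + X' q) Y p = nabla X Y p + nabla X' Y p) \<and>
     (\<forall>X\<in>vector_fields. \<forall>Y\<in>vector_fields. \<forall>f::'a \<Rightarrow> real. smooth_on_sphere f \<longrightarrow>
        (\<forall>p\<in>sphere 0 1. nabla (\<lambda>q. f q *\<^sub>R X q) Y p = f p *\<^sub>R nabla X Y p)) \<and>
     (\<forall>X\<in>vector_fields. \<forall>Y\<in>vector_fields. \<forall>Y'\<in>vector_fields. \<forall>p\<in>sphere 0 1.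
        nabla X (\<lambda>q. Y q + Y' q) p = nabla X Y p + nabla X Y' p) \<and>
     (\<forall>X\<in>vector_fields. \<forall>Y\<in>vector_fields. \<forall>f::'a \<Rightarrow> real. smooth_on_sphere f \<longrightarrow>
        (\<forall>p\<in>sphere 0 1. nabla X (\<lambda>q. f q *\<^sub>R Y q) p =
           sphere_differential f p (X p) *\<^sub>R Y p + f p *\<^sub>R nabla X Y p))"

definition metric_compatible ::
    "(('a::euclidean_space \<Rightarrow> 'a) \<Rightarrow> ('a \<Rightarrow> 'a) \<Rightarrow> 'a \<Rightarrow> 'a) \<Rightarrow> bool" where
  "metric_compatible nabla \<longleftrightarrow>
     (\<forall>X\<in>vector_fields. \<forall>Y\<in>vector_fields. \<forall>Z\<in>vector_fields. \<forall>p\<in>sphere 0 1.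
        sphere_differential (\<lambda>q. Y q \<bullet> Z q) p (X p) =
          nabla X Y p \<bullet> Z p + Y p \<bullet> nabla X Z p)"

definition torsion_free ::
    "(('a::euclidean_space \<Rightarrow> 'a) \<Rightarrow> ('a \<Rightarrow> 'a) \<Rightarrow> 'a \<Rightarrow> 'a) \<Rightarrow> bool" where
  "torsion_free nabla \<longleftrightarrow>
     (\<forall>X\<in>vector_fields. \<forall>Y\<in>vector_fields. \<forall>p\<in>sphere 0 1.
        nabla X Y p - nabla Y X p = lie_bracket X Y p)"

definition levi_civita_connection ::
    "(('a::euclidean_space \<Rightarrow> 'a) \<Rightarrow> ('a \<Rightarrow> 'a) \<Rightarrow> 'a \<Rightarrow> 'a) \<Rightarrow> bool" where
  "levi_civita_connection nabla \<longleftrightarrow>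
     affine_connection nabla \<and> metric_compatible nabla \<and> torsion_free nabla"

definition curvature_field ::
    "(('a::euclidean_space \<Rightarrow> 'a) \<Rightarrow> ('a \<Rightarrow> 'a) \<Rightarrow> 'a \<Rightarrow> 'a) \<Rightarrow>
     ('a \<Rightarrow> 'a) \<Rightarrow> ('a \<Rightarrow> 'a) \<Rightarrow> ('a \<Rightarrow> 'a) \<Rightarrow> 'a \<Rightarrow> 'a" where
  "curvature_field nabla X Y Z p =
     nabla X (nabla Y Z) p - nabla Y (nabla X Z) p - nabla (lie_bracket X Y) Z p"

text \<open>
  The value \<open>R\<^sub>p(u, v)w\<close> of the curvature tensor on tangent vectors at \<open>p\<close>: the common value at \<open>p\<close> of
  \<open>R(X, Y)Z\<close> for all vector fields extending \<open>u\<close>, \<open>v\<close>, \<open>w\<close>.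
\<close>

definition curvature ::
    "(('a::euclidean_space \<Rightarrow> 'a) \<Rightarrow> ('a \<Rightarrow> 'a) \<Rightarrow> 'a \<Rightarrow> 'a) \<Rightarrow> 'a \<Rightarrow> 'a \<Rightarrow> 'a \<Rightarrow> 'a \<Rightarrow> 'a" where
  "curvature nabla p u v w = (THE r.
     \<forall>X\<in>vector_fields. \<forall>Y\<in>vector_fields. \<forall>Z\<in>vector_fields.
       X p = u \<and> Y p = v \<and> Z p = w \<longrightarrow> curvature_field nabla X Y Z p = r)"


section \<open>Curves and vector fields along them\<close>

text \<open>Derivatives at an endpoint belonging to \<open>I\<close> are one-sided.\<close>

definition nth_deriv_on :: "real set \<Rightarrow> nat \<Rightarrow> (real \<Rightarrow> 'b::real_normed_vector) \<Rightarrow> real \<Rightarrow> 'b" where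
  "nth_deriv_on I k f = ((\<lambda>h t. vector_derivative h (at t within I)) ^^ k) f"

definition smooth_on_interval :: "real set \<Rightarrow> (real \<Rightarrow> 'b::real_normed_vector) \<Rightarrow> bool" where
  "smooth_on_interval I f \<longleftrightarrow> (\<forall>k. \<forall>t\<in>I. nth_deriv_on I k f differentiable (at t within I))"

definition vector_fields_along ::
    "real set \<Rightarrow> (real \<Rightarrow> 'a::euclidean_space) \<Rightarrow> (real \<Rightarrow> 'a) set" where
  "vector_fields_along I \<gamma> = {V. smooth_on_interval I V \<and> (\<forall>t\<in>I. \<gamma> t \<bullet> V t = 0)}"

text \<open>
  The defining properties of the covariant derivative \<open>V \<mapsto> \<nabla>\<^sub>\<gamma>\<^sub>' V\<close> along \<open>\<gamma>\<close> induced by a connection: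
  additivity, the Leibniz rule, and agreement with the connection on vector fields along \<open>\<gamma>\<close> that
  are restrictions \<open>Y \<circ> \<gamma>\<close> of vector fields on the sphere.
\<close>

definition induced_covariant_derivative ::
    "(('a::euclidean_space \<Rightarrow> 'a) \<Rightarrow> ('a \<Rightarrow> 'a) \<Rightarrow> 'a \<Rightarrow> 'a) \<Rightarrow> real set \<Rightarrow> (real \<Rightarrow> 'a) \<Rightarrow>
     ((real \<Rightarrow> 'a) \<Rightarrow> real \<Rightarrow> 'a) \<Rightarrow> bool" where
  "induced_covariant_derivative nabla I \<gamma> D \<longleftrightarrow>
     (\<forall>V\<in>vector_fields_along I \<gamma>. D V \<in> vector_fields_along I \<gamma>) \<and>
     (\<forall>V\<in>vector_fields_along I \<gamma>. \<forall>W\<in>vector_fields_along I \<gamma>. \<forall>t\<in>I.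
        D (\<lambda>s. V s + W s) t = D V t + D W t) \<and>
     (\<forall>V\<in>vector_fields_along I \<gamma>. \<forall>f::real \<Rightarrow> real. smooth_on_interval I f \<longrightarrow>
        (\<forall>t\<in>I. D (\<lambda>s. f s *\<^sub>R V s) t = nth_deriv_on I 1 f t *\<^sub>R V t + f t *\<^sub>R D V t)) \<and>
     (\<forall>X\<in>vector_fields. \<forall>Y\<in>vector_fields. \<forall>t\<in>I. X (\<gamma> t) = nth_deriv_on I 1 \<gamma> t \<longrightarrow>
        D (\<lambda>s. Y (\<gamma> s)) t = nabla X Y (\<gamma> t))"

text \<open>On \<open>I\<close> and for vector fields along \<open>\<gamma>\<close>, the operator is determined by these properties.\<close>

definition covariant_derivative ::
    "(('a::euclidean_space \<Rightarrow> 'a) \<Rightarrow> ('a \<Rightarrow> 'a) \<Rightarrow> 'a \<Rightarrow> 'a) \<Rightarrow> real set \<Rightarrow> (real \<Rightarrow> 'a) \<Rightarrow>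
     (real \<Rightarrow> 'a) \<Rightarrow> real \<Rightarrow> 'a" where
  "covariant_derivative nabla I \<gamma> = (SOME D. induced_covariant_derivative nabla I \<gamma> D)"


section \<open>Polyharmonic curves\<close>

definition tension ::
    "(('a::euclidean_space \<Rightarrow> 'a) \<Rightarrow> ('a \<Rightarrow> 'a) \<Rightarrow> 'a \<Rightarrow> 'a) \<Rightarrow> real set \<Rightarrow> (real \<Rightarrow> 'a) \<Rightarrow>
     real \<Rightarrow> 'a" where
  "tension nabla I \<gamma> = covariant_derivative nabla I \<gamma> (nth_deriv_on I 1 \<gamma>)"

definition rough_laplacian ::
    "(('a::euclidean_space \<Rightarrow> 'a) \<Rightarrow> ('a \<Rightarrow> 'a) \<Rightarrow> 'a \<Rightarrow> 'a) \<Rightarrow> real set \<Rightarrow> (real \<Rightarrow> 'a) \<Rightarrow>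
     (real \<Rightarrow> 'a) \<Rightarrow> real \<Rightarrow> 'a" where
  "rough_laplacian nabla I \<gamma> V t =
     - covariant_derivative nabla I \<gamma> (covariant_derivative nabla I \<gamma> V) t"

definition k_tension ::
    "(('a::euclidean_space \<Rightarrow> 'a) \<Rightarrow> ('a \<Rightarrow> 'a) \<Rightarrow> 'a \<Rightarrow> 'a) \<Rightarrow> real set \<Rightarrow> (real \<Rightarrow> 'a) \<Rightarrow>
     nat \<Rightarrow> real \<Rightarrow> 'a" where
  "k_tension nabla I \<gamma> k t =
     (rough_laplacian nabla I \<gamma> ^^ (k - 1)) (tension nabla I \<gamma>) t
     - curvature nabla (\<gamma> t)
         ((rough_laplacian nabla I \<gamma> ^^ (k - 2)) (tension nabla I \<gamma>) t)
         (nth_deriv_on I 1 \<gamma> t) (nth_deriv_on I 1 \<gamma> t)"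

text \<open>Only meaningful for \<open>k \<ge> 2\<close>.\<close>

definition k_harmonic ::
    "(('a::euclidean_space \<Rightarrow> 'a) \<Rightarrow> ('a \<Rightarrow> 'a) \<Rightarrow> 'a \<Rightarrow> 'a) \<Rightarrow> real set \<Rightarrow> (real \<Rightarrow> 'a) \<Rightarrow>
     nat \<Rightarrow> bool" where
  "k_harmonic nabla I \<gamma> k \<longleftrightarrow> (\<forall>t\<in>I. k_tension nabla I \<gamma> k t = 0)"

end

theory Submission
  imports Defs
begin

text \<open>
  Write \<open>T\<^sub>k\<close> for the \<open>k\<close>-th covariant derivative of the unit tangent \<open>T\<^sub>0\<close>. On the unit sphere the curve is
  4-harmonic iff \<open>T\<^sub>7 + T\<^sub>5 = (T\<^sub>5 \<bullet> T\<^sub>0) T\<^sub>0\<close>. Expanding the left hand side minus the right hand side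
  in the derivatives of \<open>\<gamma>\<close> gives the stated expression up to the term \<open>2 g\<^sub>2\<^sub>3 \<gamma>'\<close> (the expansion has
  \<open>- 15 g\<^sub>2\<^sub>3\<close> where the statement has \<open>- 13 g\<^sub>2\<^sub>3\<close>), and \<open>2 g\<^sub>2\<^sub>3\<close> is the derivative of the squared geodesic
  curvature \<open>T\<^sub>1 \<bullet> T\<^sub>1\<close>. So the equivalence holds because each of the two equations forces the geodesic
  curvature to be constant.

  Both equations have the form \<open>T\<^sub>7 + T\<^sub>5 = \<psi> T\<^sub>0\<close> with \<open>\<psi> = T\<^sub>5 \<bullet> T\<^sub>0 + \<kappa> (T\<^sub>3 \<bullet> T\<^sub>0)\<close>, where \<open>\<kappa> = 0\<close> for
  4-harmonicity and \<open>\<kappa> = 2/3\<close> for the stated equation (as \<open>T\<^sub>3 \<bullet> T\<^sub>0 = - 3 g\<^sub>2\<^sub>3\<close>). In a parallel frame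
  \<open>T\<^sub>0\<close> becomes a curve \<open>S\<close> on a sphere of a fixed vector space, which is analytic, and the identity
  \<open>S \<bullet> S = 1\<close> persists under continuation. Since \<open>|S\<^sub>7| \<le> 2 |S\<^sub>5| + |S\<^sub>3|\<close>, solutions cannot blow up and
  extend to the whole line. There
  \<open>|S\<^sub>6 + S\<^sub>4|\<^sup>2 + (1 - \<kappa>) |S\<^sub>5 + S\<^sub>3|\<^sup>2 + \<psi>\<^sup>2\<close> is a total derivative, and cut-off energy estimates show that
  it vanishes. Hence \<open>S\<^sub>5 = - S\<^sub>3\<close> and \<open>\<psi> = 0\<close>, so that \<open>S\<^sub>3 \<bullet> S\<^sub>0 = 0\<close>.
\<close>

section \<open>Jets of solutions and the Leibniz rule\<close>

text \<open>No parallel frame is constructed. Its effect is obtained from a single point: the values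
  \<open>T k t\<close> at a fixed \<open>t\<close> lie in one vector space, and because their inner
  products differentiate by the plain product rule, they satisfy all formal derivatives of the
  unit-length condition and of the equation (\<open>jet\<close>). They are the Taylor coefficients
  of the unrolled curve \<open>S\<close>, and a power series recovers it. Passing to the whole line
  is what makes the energy argument possible: on a given, possibly short or compact, interval the
  boundary terms of a total derivative are out of control, while a cutoff on [-L, L] trades them for
  terms with a factor 1/L. Those terms still have to be bounded, and the exponential growth bound is
  useless against a polynomial cutoff. The missing input is a first integral hidden in the seventh
  derivative of |S|^2 = 1: together with |S| = 1 it makes the weighted integrals of |S'|^2, |S''|^2
  and |S'''|^2 grow at most linearly in L, and the total derivative then loses by a factor 1/L. The
  conclusion is drawn at the base point 0 only, once for the jet of each parameter of the original
  curve.\<close>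

definition leibniz_sum :: "(nat \<Rightarrow> nat \<Rightarrow> 'b::real_vector) \<Rightarrow> nat \<Rightarrow> 'b" where
  "leibniz_sum x k = (\<Sum>i\<le>k. real (k choose i) *\<^sub>R x i (k - i))"

lemma leibniz_sum_0 [simp]: "leibniz_sum x 0 = x 0 0"
  by (simp add: leibniz_sum_def)

text \<open>Pascal's rule. Applying the product rule to the entries raises the order by one, so
  derivatives of products can be handled at the level of jets, without functions to
  differentiate.\<close>

lemma leibniz_sum_Suc:
  "leibniz_sum x (Suc k) = leibniz_sum (\<lambda>i j. x (Suc i) j + x i (Suc j)) k"
proof -
  have "leibniz_sum x (Suc k) = x 0 (Suc k) + (\<Sum>i\<le>k. real (Suc k choose Suc i) *\<^sub>R x (Suc i) (k - i))"
    by (simp add: leibniz_sum_def sum.atMost_Suc_shift del: sum.atMost_Suc binomial_Suc_Suc)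
  also have "(\<Sum>i\<le>k. real (Suc k choose Suc i) *\<^sub>R x (Suc i) (k - i)) =
      (\<Sum>i\<le>k. real (k choose i) *\<^sub>R x (Suc i) (k - i)) + (\<Sum>i\<le>k. real (k choose Suc i) *\<^sub>R x (Suc i) (k - i))"
    by (simp add: scaleR_add_left sum.distrib)
  also have "(\<Sum>i\<le>k. real (k choose Suc i) *\<^sub>R x (Suc i) (k - i)) =
      (\<Sum>i\<in>{..<k}. real (k choose Suc i) *\<^sub>R x (Suc i) (k - i))"
    by (rule sum.mono_neutral_right) auto
  also have "x 0 (Suc k) + (A + (\<Sum>i\<in>{..<k}. real (k choose Suc i) *\<^sub>R x (Suc i) (k - i)))
      = A + (\<Sum>i\<le>k. real (k choose i) *\<^sub>R x i (Suc (k - i)))" for A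
  proof -
    have "(\<Sum>i\<le>k. real (k choose i) *\<^sub>R x i (Suc (k - i))) =
       x 0 (Suc k) + (\<Sum>i<k. real (k choose Suc i) *\<^sub>R x (Suc i) (Suc (k - Suc i)))"
      by (cases k) (simp_all add: sum.atMost_Suc_shift lessThan_Suc_atMost del: sum.atMost_Suc binomial_Suc_Suc)
    also have "(\<Sum>i<k. real (k choose Suc i) *\<^sub>R x (Suc i) (Suc (k - Suc i))) =
       (\<Sum>i\<in>{..<k}. real (k choose Suc i) *\<^sub>R x (Suc i) (k - i))"
      by (rule sum.cong) (auto simp: Suc_diff_Suc)
    finally show ?thesis by simp
  qed
  finally show ?thesis
    by (simp add: leibniz_sum_def scaleR_add_right sum.distrib)
qed

lemma leibniz_sum_has_vector_derivative:
  fixes x :: "nat \<Rightarrow> nat \<Rightarrow> real \<Rightarrow> 'b::real_normed_vector"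
  assumes "\<And>i j. (x i j has_vector_derivative x (Suc i) j t + x i (Suc j) t) (at t within J)"
  shows "((\<lambda>s. leibniz_sum (\<lambda>i j. x i j s) k) has_vector_derivative
    leibniz_sum (\<lambda>i j. x i j t) (Suc k)) (at t within J)"
  unfolding leibniz_sum_Suc unfolding leibniz_sum_def
  by (rule has_vector_derivative_sum)
    (rule bounded_linear.has_vector_derivative[OF bounded_linear_scaleR_right assms])

lemma inner_leibniz_sum_left: "leibniz_sum x k \<bullet> v = leibniz_sum (\<lambda>i j. x i j \<bullet> v) k"
  by (simp add: leibniz_sum_def inner_sum_left)

text \<open>Read \<open>d i\<close> as the i-th derivative of a curve:
  \<open>psi \<kappa> d k\<close> is then the k-th derivative of the scalar \<psi>, and
  \<open>ode_rhs \<kappa> d k\<close> below is the k-th derivative of \<psi> times the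
  curve.\<close>

definition psi :: "real \<Rightarrow> (nat \<Rightarrow> 'a::euclidean_space) \<Rightarrow> nat \<Rightarrow> real" where
  "psi \<kappa> d = leibniz_sum (\<lambda>i j. d (i + 5) \<bullet> d j + \<kappa> * (d (i + 3) \<bullet> d j))"

definition ode_rhs :: "real \<Rightarrow> (nat \<Rightarrow> 'a::euclidean_space) \<Rightarrow> nat \<Rightarrow> 'a" where
  "ode_rhs \<kappa> d = leibniz_sum (\<lambda>i j. psi \<kappa> d i *\<^sub>R d j)"

text \<open>The constraints that a solution imposes on its derivatives at a single point: every
  formal derivative of the unit-length condition and of the equation.\<close>

definition jet :: "real \<Rightarrow> (nat \<Rightarrow> 'a::euclidean_space) \<Rightarrow> bool" where
  "jet \<kappa> d \<longleftrightarrow>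
     (\<forall>k. leibniz_sum (\<lambda>i j. d i \<bullet> d j) k = (if k = 0 then 1 else 0)) \<and>
     (\<forall>k. d (k + 7) + d (k + 5) = ode_rhs \<kappa> d k)"

text \<open>
  \<open>T (Suc k)\<close> is the covariant derivative of \<open>T k\<close>, where \<open>N\<close> is the position vector on the sphere;
  \<open>N = 0\<close> describes the iterated derivatives of a curve in a vector space.
\<close>

context
  fixes T :: "nat \<Rightarrow> real \<Rightarrow> 'a::euclidean_space" and N t J
  assumes T: "\<And>k. (T k has_vector_derivative T (Suc k) t - (T k t \<bullet> T 0 t) *\<^sub>R N) (at t within J)"
    and N: "\<And>k. N \<bullet> T k t = 0"
begin

text \<open>The correction along \<open>N\<close> is orthogonal to all \<open>T k t\<close>, so
  inner products obey the plain product rule, as they would in a parallel frame.\<close>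

lemma covariant_inner_deriv:
  "((\<lambda>s. T i s \<bullet> T j s) has_vector_derivative
      T (Suc i) t \<bullet> T j t + T i t \<bullet> T (Suc j) t) (at t within J)"
proof -
  have NT: "T k t \<bullet> N = 0" for k
    using N by (simp add: inner_commute)
  have "((\<lambda>s. T i s \<bullet> T j s) has_vector_derivative
    T i t \<bullet> (T (Suc j) t - (T j t \<bullet> T 0 t) *\<^sub>R N) + (T (Suc i) t - (T i t \<bullet> T 0 t) *\<^sub>R N) \<bullet> T j t)
    (at t within J)"
    by (rule bounded_bilinear.has_vector_derivative[OF bounded_bilinear_inner T T])
  then show ?thesis
    by (simp add: inner_diff_left inner_diff_right N NT add.commute)
qed

lemma covariant_psi_deriv:
  "((\<lambda>s. psi \<kappa> (\<lambda>k. T k s) k) has_vector_derivative psi \<kappa> (\<lambda>k. T k t) (Suc k)) (at t within J)"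
  unfolding psi_def
  by (rule leibniz_sum_has_vector_derivative)
     (rule derivative_eq_intros covariant_inner_deriv has_vector_derivative_mult_right refl
       | simp add: algebra_simps)+

lemma covariant_ode_rhs_deriv:
  "((\<lambda>s. ode_rhs \<kappa> (\<lambda>k. T k s) k) has_vector_derivative
    ode_rhs \<kappa> (\<lambda>k. T k t) (Suc k) - (ode_rhs \<kappa> (\<lambda>k. T k t) k \<bullet> T 0 t) *\<^sub>R N) (at t within J)"
proof -
  let ?p = "\<lambda>i s. psi \<kappa> (\<lambda>k. T k s) i"
  have "((\<lambda>s. ode_rhs \<kappa> (\<lambda>k. T k s) k) has_vector_derivative (\<Sum>i\<le>k. real (k choose i) *\<^sub>R
      (?p i t *\<^sub>R (T (Suc (k - i)) t - (T (k - i) t \<bullet> T 0 t) *\<^sub>R N) + ?p (Suc i) t *\<^sub>R T (k - i) t)))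
      (at t within J)"
    unfolding ode_rhs_def leibniz_sum_def
    by (rule has_vector_derivative_sum)
       (rule bounded_linear.has_vector_derivative[OF bounded_linear_scaleR_right]
         bounded_bilinear.has_vector_derivative[OF bounded_bilinear_scaleR] covariant_psi_deriv T)+
  also have "(\<Sum>i\<le>k. real (k choose i) *\<^sub>R
      (?p i t *\<^sub>R (T (Suc (k - i)) t - (T (k - i) t \<bullet> T 0 t) *\<^sub>R N) + ?p (Suc i) t *\<^sub>R T (k - i) t))
    = ode_rhs \<kappa> (\<lambda>k. T k t) (Suc k) - (ode_rhs \<kappa> (\<lambda>k. T k t) k \<bullet> T 0 t) *\<^sub>R N"
    unfolding ode_rhs_def leibniz_sum_Suc inner_leibniz_sum_left
    by (simp add: leibniz_sum_def scaleR_sum_left sum_subtractf[symmetric] algebra_simps)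
  finally show ?thesis .
qed

text \<open>The covariant derivative of the k-th defect of the equation is the next defect, so
  vanishing on \<open>J\<close> passes from each order to the following one.\<close>

lemma covariant_ode_deriv:
  "((\<lambda>s. T (k + 7) s + T (k + 5) s - ode_rhs \<kappa> (\<lambda>k. T k s) k) has_vector_derivative
    (T (Suc k + 7) t + T (Suc k + 5) t - ode_rhs \<kappa> (\<lambda>k. T k t) (Suc k)) -
    ((T (k + 7) t + T (k + 5) t - ode_rhs \<kappa> (\<lambda>k. T k t) k) \<bullet> T 0 t) *\<^sub>R N) (at t within J)"
proof -
  have "((\<lambda>s. T (k + 7) s + T (k + 5) s - ode_rhs \<kappa> (\<lambda>k. T k s) k) has_vector_derivative
     (T (Suc (k + 7)) t - (T (k + 7) t \<bullet> T 0 t) *\<^sub>R N) +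
     (T (Suc (k + 5)) t - (T (k + 5) t \<bullet> T 0 t) *\<^sub>R N) -
     (ode_rhs \<kappa> (\<lambda>k. T k t) (Suc k) - (ode_rhs \<kappa> (\<lambda>k. T k t) k \<bullet> T 0 t) *\<^sub>R N)) (at t within J)"
    by (intro has_vector_derivative_add has_vector_derivative_diff T covariant_ode_rhs_deriv)
  then show ?thesis by (simp add: algebra_simps)
qed

lemma covariant_norm_deriv:
  "((\<lambda>s. leibniz_sum (\<lambda>i j. T i s \<bullet> T j s) k - (if k = 0 then 1 else 0)) has_vector_derivative
    leibniz_sum (\<lambda>i j. T i t \<bullet> T j t) (Suc k) - (if Suc k = 0 then 1 else 0)) (at t within J)"
proof -
  have "((\<lambda>s. leibniz_sum (\<lambda>i j. T i s \<bullet> T j s) k - (if k = 0 then 1 else 0))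
     has_vector_derivative leibniz_sum (\<lambda>i j. T i t \<bullet> T j t) (Suc k) - 0) (at t within J)"
    by (intro has_vector_derivative_diff leibniz_sum_has_vector_derivative covariant_inner_deriv
        has_vector_derivative_const)
  then show ?thesis by simp
qed

end

text \<open>An identity valid on all of \<open>J\<close> may be differentiated there; induction on
  the order yields every condition of \<open>jet\<close>. This is the transfer from a curve on the
  sphere to data in one vector space.\<close>

lemma jet_covariant_family:
  fixes T :: "nat \<Rightarrow> real \<Rightarrow> 'a::euclidean_space"
  assumes J: "\<And>t. t \<in> J \<Longrightarrow> at t within J \<noteq> bot"
    and T: "\<And>k t. t \<in> J \<Longrightarrow>
      (T k has_vector_derivative T (Suc k) t - (T k t \<bullet> T 0 t) *\<^sub>R N t) (at t within J)"
    and N: "\<And>k t. t \<in> J \<Longrightarrow> N t \<bullet> T k t = 0"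
    and unit: "\<And>t. t \<in> J \<Longrightarrow> T 0 t \<bullet> T 0 t = 1"
    and ode: "\<And>t. t \<in> J \<Longrightarrow>
      T 7 t + T 5 t = (T 5 t \<bullet> T 0 t + \<kappa> * (T 3 t \<bullet> T 0 t)) *\<^sub>R T 0 t"
    and t: "t \<in> J"
  shows "jet \<kappa> (\<lambda>k. T k t)"
proof -
  \<comment> \<open>Derivatives within \<open>J\<close> are unique because \<open>J\<close> has no
    isolated points.\<close>
  have zero: "D = 0" if "(f has_vector_derivative D) (at t within J)" "t \<in> J"
      "\<And>s. s \<in> J \<Longrightarrow> f s = 0" for f :: "real \<Rightarrow> 'c::real_normed_vector" and D t
  proof -
    have "(f has_vector_derivative 0) (at t within J)"
      by (rule has_vector_derivative_transform[of t J _ "\<lambda>_. 0"]) (use that in auto)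
    then show ?thesis
      using vector_derivative_unique_within[OF J that(1)] that(2) by blast
  qed
  have W: "T (k + 7) t + T (k + 5) t - ode_rhs \<kappa> (\<lambda>k. T k t) k = 0" if "t \<in> J" for k t
    using that
  proof (induction k arbitrary: t)
    case 0
    then show ?case using ode[of t] by (simp add: ode_rhs_def psi_def)
  next
    case (Suc k)
    from zero[OF covariant_ode_deriv[of T, OF T N] Suc.prems Suc.IH] Suc.prems
    have "T (Suc k + 7) t + T (Suc k + 5) t - ode_rhs \<kappa> (\<lambda>k. T k t) (Suc k) =
       ((T (k + 7) t + T (k + 5) t - ode_rhs \<kappa> (\<lambda>k. T k t) k) \<bullet> T 0 t) *\<^sub>R N t"
      by simp
    then show ?case using Suc.IH[OF Suc.prems] by simp
  qed
  have H: "leibniz_sum (\<lambda>i j. T i t \<bullet> T j t) k - (if k = 0 then 1 else 0) = 0" if "t \<in> J" for k t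
    using that
  proof (induction k arbitrary: t)
    case 0
    then show ?case using unit by simp
  next
    case (Suc k)
    from zero[OF covariant_norm_deriv[of T, OF T N] Suc.prems Suc.IH] Suc.prems show ?case by simp
  qed
  show ?thesis
    unfolding jet_def using W[OF t] H[OF t] by auto
qed

section \<open>Analyticity and global extension\<close>

text \<open>The binomial coefficients cancel against the factorials, leaving k + 1 equal bounds A
  k!.\<close>

lemma norm_leibniz_sum_le:
  fixes x :: "nat \<Rightarrow> nat \<Rightarrow> 'b::real_normed_vector"
  assumes "\<And>i j. i + j = k \<Longrightarrow> norm (x i j) \<le> A * (fact i * fact j)"
  shows "norm (leibniz_sum x k) \<le> A * fact (Suc k)"
proof -
  have "norm (real (k choose i) *\<^sub>R x i (k - i)) \<le> A * fact k" if "i \<le> k" for i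
  proof -
    have "norm (real (k choose i) *\<^sub>R x i (k - i)) \<le> real (k choose i) * (A * (fact i * fact (k - i)))"
      using assms[of i "k - i"] that by (simp add: mult_left_mono)
    also have "\<dots> = A * fact k"
      using binomial_fact_lemma[OF that] by (metis (no_types, lifting) mult.assoc mult.commute of_nat_fact of_nat_mult)
    finally show ?thesis .
  qed
  then have "norm (leibniz_sum x k) \<le> (\<Sum>i\<le>k. A * fact k)"
    unfolding leibniz_sum_def by (intro sum_norm_le) auto
  then show ?thesis by (simp add: algebra_simps)
qed

lemma fact_shift_le:
  assumes "i \<le> n"
  shows "fact (i + m) \<le> (fact i * (fact (n + m) / fact n) :: real)"
proof -
  have "fact (i + m) * fact n \<le> (fact i * fact (n + m) :: real)"
  proof (induction m)
    case (Suc m)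
    have "real (i + m + 1) * (fact (i + m) * fact n) \<le> real (n + m + 1) * (fact i * fact (n + m))"
      using assms by (intro mult_mono Suc) auto
    then show ?case by (simp add: algebra_simps)
  qed simp
  then show ?thesis by (simp add: field_simps)
qed

text \<open>Strong induction through the equation, which expresses \<open>d (n + 7)\<close> by
  \<open>d (n + 5)\<close> and a triple product with at most n + 5 derivatives in all. The two
  nested Leibniz sums cost (n + 1)^2, which (n + 7)!/(n + 5)! absorbs; the two spare powers of
  \<open>C\<close> are spent through \<open>1 + 2 * M\<^sup>2 \<le> C\<^sup>2\<close>.\<close>

lemma jet_growth:
  fixes d :: "nat \<Rightarrow> 'a::euclidean_space"
  assumes d: "jet \<kappa> d" and \<kappa>: "\<bar>\<kappa>\<bar> \<le> 1"
    and M: "M \<ge> 0" "\<And>k. k < 7 \<Longrightarrow> norm (d k) \<le> M"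
    and C: "C \<ge> 1" "1 + 2 * M\<^sup>2 \<le> C\<^sup>2"
  shows "norm (d k) \<le> M * C ^ k * fact k"
proof (induction k rule: less_induct)
  case (less k)
  show ?case
  proof (cases "k < 7")
    case True
    have "M * 1 * 1 \<le> M * C ^ k * fact k"
      using M C by (intro mult_mono) (auto simp: one_le_power)
    then show ?thesis using M(2)[OF True] by simp
  next
    case False
    then obtain n where k: "k = n + 7" by (metis add.commute le_iff_add not_less)
    have IH: "norm (d j) \<le> M * C ^ j * fact j" if "j < n + 7" for j
      using less.IH that k by auto
    have t: "\<bar>d (i + l) \<bullet> d j\<bar> \<le> M\<^sup>2 * C ^ (i + j + 5) * (fact (i + l) * fact j)"
      if "i + j \<le> n" "l \<le> 5" for i j l
    proof -
      have "\<bar>d (i + l) \<bullet> d j\<bar> \<le> norm (d (i + l)) * norm (d j)" by (rule Cauchy_Schwarz_ineq2)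
      also have "\<dots> \<le> (M * C ^ (i + l) * fact (i + l)) * (M * C ^ j * fact j)"
        using that M C by (intro mult_mono IH) auto
      also have "\<dots> = M\<^sup>2 * C ^ (i + l + j) * (fact (i + l) * fact j)"
        by (simp add: power_add power2_eq_square)
      also have "\<dots> \<le> M\<^sup>2 * C ^ (i + j + 5) * (fact (i + l) * fact j)"
        using that C by (intro mult_right_mono mult_left_mono power_increasing) auto
      finally show ?thesis .
    qed
    \<comment> \<open>The shift of the factorial by 5 is estimated by the ratio at the largest index
      \<open>n\<close>, so that the bound keeps the shape \<open>fact a * fact b\<close> required by
      \<open>norm_leibniz_sum_le\<close>.\<close>
    have psi: "\<bar>psi \<kappa> d i\<bar> \<le> 2 * M\<^sup>2 * C ^ (i + 5) * (fact (n + 5) / fact n) * fact (Suc i)"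
      if "i \<le> n" for i
    proof -
      have "norm (psi \<kappa> d i) \<le> 2 * M\<^sup>2 * C ^ (i + 5) * (fact (n + 5) / fact n) * fact (Suc i)"
        unfolding psi_def
      proof (rule norm_leibniz_sum_le)
        fix a b assume ab: "a + b = i"
        have "\<bar>\<kappa>\<bar> * \<bar>d (a + 3) \<bullet> d b\<bar> \<le> 1 * (M\<^sup>2 * C ^ (i + 5) * (fact (a + 3) * fact b))"
          using t[of a b 3] \<kappa> ab that by (intro mult_mono) auto
        also have "\<dots> \<le> M\<^sup>2 * C ^ (i + 5) * (fact (a + 5) * fact b)"
          using C unfolding mult_1 by (intro mult_left_mono mult_right_mono fact_mono) auto
        finally have "norm (d (a + 5) \<bullet> d b + \<kappa> * (d (a + 3) \<bullet> d b)) \<le>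
            2 * (M\<^sup>2 * C ^ (i + 5) * (fact (a + 5) * fact b))"
          using t[of a b 5] ab that abs_triangle_ineq[of "d (a + 5) \<bullet> d b" "\<kappa> * (d (a + 3) \<bullet> d b)"]
          by (simp add: abs_mult)
        also have "\<dots> \<le> 2 * (M\<^sup>2 * C ^ (i + 5) * ((fact a * (fact (n + 5) / fact n)) * fact b))"
          using C ab that by (intro mult_left_mono mult_right_mono fact_shift_le) auto
        finally show "norm (d (a + 5) \<bullet> d b + \<kappa> * (d (a + 3) \<bullet> d b)) \<le>
            2 * M\<^sup>2 * C ^ (i + 5) * (fact (n + 5) / fact n) * (fact a * fact b)"
          by (simp add: algebra_simps)
      qed
      then show ?thesis by simp
    qed
    have "norm (ode_rhs \<kappa> d n)
      \<le> (2 * M ^ 3 * C ^ (n + 5) * (fact (n + 5) / fact n) * (n + 1)) * fact (Suc n)"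
      unfolding ode_rhs_def
    proof (rule norm_leibniz_sum_le)
      fix i j assume ij: "i + j = n"
      have "norm (psi \<kappa> d i *\<^sub>R d j) \<le>
         (2 * M\<^sup>2 * C ^ (i + 5) * (fact (n + 5) / fact n) * fact (Suc i)) * (M * C ^ j * fact j)"
        unfolding norm_scaleR using ij M C by (intro mult_mono psi IH) (auto simp del: fact_Suc)
      also have "\<dots> = 2 * M ^ 3 * C ^ (n + 5) * (fact (n + 5) / fact n) * real (i + 1) * (fact i * fact j)"
        by (simp add: ij[symmetric] power_add power3_eq_cube power2_eq_square algebra_simps)
      also have "\<dots> \<le> 2 * M ^ 3 * C ^ (n + 5) * (fact (n + 5) / fact n) * (n + 1) * (fact i * fact j)"
        using ij M C by (intro mult_right_mono mult_left_mono) auto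
      finally show "norm (psi \<kappa> d i *\<^sub>R d j) \<le>
         2 * M ^ 3 * C ^ (n + 5) * (fact (n + 5) / fact n) * (n + 1) * (fact i * fact j)" .
    qed
    also have "\<dots> = 2 * M ^ 3 * C ^ (n + 5) * (fact (n + 5) * (real (n + 1))\<^sup>2)"
      by (simp add: power2_eq_square field_simps)
    also have "\<dots> \<le> 2 * M ^ 3 * C ^ (n + 5) * fact (n + 7)"
    proof (intro mult_left_mono)
      have "(real (n + 1))\<^sup>2 \<le> real (n + 7) * real (n + 6)"
        unfolding power2_eq_square by (intro mult_mono) auto
      moreover have "(fact (n + 7) :: real) = real (n + 7) * real (n + 6) * fact (n + 5)"
        by (simp add: eval_nat_numeral algebra_simps)
      ultimately show "fact (n + 5) * (real (n + 1))\<^sup>2 \<le> (fact (n + 7) :: real)"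
        by (simp add: mult.commute mult_right_mono)
    qed (use M C in auto)
    finally have A: "norm (ode_rhs \<kappa> d n) \<le> 2 * M ^ 3 * C ^ (n + 5) * fact (n + 7)" .
    have B: "norm (d (n + 5)) \<le> M * C ^ (n + 5) * fact (n + 7)"
    proof -
      have "norm (d (n + 5)) \<le> M * C ^ (n + 5) * fact (n + 5)" by (rule IH) simp
      also have "\<dots> \<le> M * C ^ (n + 5) * fact (n + 7)"
        using M C by (intro mult_left_mono fact_mono) auto
      finally show ?thesis .
    qed
    have "d (n + 7) = ode_rhs \<kappa> d n - d (n + 5)"
      using d unfolding jet_def by (metis add_diff_cancel_right')
    then have "norm (d (n + 7)) \<le> 2 * M ^ 3 * C ^ (n + 5) * fact (n + 7) + M * C ^ (n + 5) * fact (n + 7)"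
      using norm_triangle_ineq4[of "ode_rhs \<kappa> d n" "d (n + 5)"] A B by simp
    also have "\<dots> = M * C ^ (n + 5) * fact (n + 7) * (1 + 2 * M\<^sup>2)"
      by (simp add: power2_eq_square power3_eq_cube algebra_simps)
    also have "\<dots> \<le> M * C ^ (n + 5) * fact (n + 7) * C\<^sup>2"
      using M C by (intro mult_left_mono) auto
    also have "\<dots> = M * C ^ (n + 7) * fact (n + 7)"
      by (simp add: power_add eval_nat_numeral)
    finally show ?thesis using k by simp
  qed
qed

definition taylor_sum :: "(nat \<Rightarrow> 'a::euclidean_space) \<Rightarrow> nat \<Rightarrow> real \<Rightarrow> 'a" where
  "taylor_sum d k t = (\<Sum>i. (t ^ i / fact i) *\<^sub>R d (i + k))"

lemma taylor_sum_0 [simp]: "taylor_sum d k 0 = d k"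
proof -
  have "taylor_sum d k 0 = (\<Sum>i. if i = 0 then d k else 0)"
    unfolding taylor_sum_def by (rule suminf_cong) (auto simp: power_0_left)
  then show ?thesis using suminf_finite[of "{0}" "\<lambda>i. if i = 0 then d k else 0"] by simp
qed

lemma fact_add_le: "fact (i + k) \<le> (2 ^ (i + k) * (fact i * fact k) :: real)"
proof -
  have "fact (i + k) = real (i + k choose i) * (fact i * fact k)"
    using binomial_fact_lemma[of i "i + k"] by (metis add_diff_cancel_left' le_add1 mult.commute of_nat_fact of_nat_mult)
  also have "real (i + k choose i) \<le> 2 ^ (i + k)"
    using binomial_le_pow2 by (metis of_nat_le_iff of_nat_numeral of_nat_power)
  finally show ?thesis by (simp add: mult_right_mono)
qed

context
  fixes d :: "nat \<Rightarrow> 'a::euclidean_space" and M C :: real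
  assumes d: "\<And>k. norm (d k) \<le> M * C ^ k * fact k" and M: "M \<ge> 0" and C: "C > 0"
begin

text \<open>At this radius (C |t|)^i is at most (1/4)^i; after the loss of 2^i in
  \<open>fact_add_le\<close> a geometric series with ratio 1/2 remains, whatever the shift
  \<open>k\<close>.\<close>

lemma taylor_term_le:
  assumes "\<bar>t\<bar> \<le> 1 / (4 * C)"
  shows "norm ((t ^ i / fact i) *\<^sub>R d (i + k)) \<le> (M * (2 * C) ^ k * fact k) * (1/2) ^ i"
proof -
  have "norm ((t ^ i / fact i) *\<^sub>R d (i + k)) = (\<bar>t\<bar> ^ i / fact i) * norm (d (i + k))"
    by (simp add: power_abs)
  also have "\<dots> \<le> ((1 / (4 * C)) ^ i / fact i) * (M * C ^ (i + k) * (2 ^ (i + k) * (fact i * fact k)))"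
  proof (rule mult_mono)
    show "\<bar>t\<bar> ^ i / fact i \<le> (1 / (4 * C)) ^ i / fact i"
      by (intro divide_right_mono power_mono assms) auto
    have "M * C ^ (i + k) * fact (i + k) \<le> M * C ^ (i + k) * (2 ^ (i + k) * (fact i * fact k))"
      by (rule mult_left_mono[OF fact_add_le]) (use M C in auto)
    then show "norm (d (i + k)) \<le> M * C ^ (i + k) * (2 ^ (i + k) * (fact i * fact k))"
      using d[of "i + k"] by linarith
  qed (use C in auto)
  also have "\<dots> = (M * (2 * C) ^ k * fact k) * (1/2) ^ i"
  proof -
    have "(1 / (4 * C)) ^ i * (C ^ i * 2 ^ i) = (1 / (4 * C) * (C * 2)) ^ i"
      by (simp only: power_mult_distrib)
    also have "1 / (4 * C) * (C * 2) = 1 / 2" using C by simp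
    finally have "(M * C ^ k * 2 ^ k * fact k) * ((1 / (4 * C)) ^ i * (C ^ i * 2 ^ i)) * (fact i / fact i) =
        (M * C ^ k * 2 ^ k * fact k) * (1/2) ^ i"
      by simp
    then show ?thesis
      by (simp only: power_add power_mult_distrib[of 2 C] power_mult_distrib[of C 2] times_divide_eq_left times_divide_eq_right mult_ac)
  qed
  finally show ?thesis .
qed

lemma taylor_summable:
  assumes "\<bar>t\<bar> \<le> 1 / (4 * C)"
  shows "summable (\<lambda>i. (t ^ i / fact i) *\<^sub>R d (i + k))"
  by (rule summable_comparison_test'[where N = 0, OF summable_mult taylor_term_le[OF assms]])
     (simp add: summable_geometric)

lemma norm_taylor_sum_le:
  assumes "\<bar>t\<bar> \<le> 1 / (4 * C)"
  shows "norm (taylor_sum d k t) \<le> (2 * M) * (2 * C) ^ k * fact k"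
proof -
  have "norm (taylor_sum d k t) \<le> (\<Sum>i. (M * (2 * C) ^ k * fact k) * (1/2) ^ i)"
    unfolding taylor_sum_def
    by (rule norm_suminf_le[OF taylor_term_le[OF assms] summable_mult]) (simp add: summable_geometric)
  also have "\<dots> = (2 * M) * (2 * C) ^ k * fact k"
    by (subst suminf_mult) (auto simp: summable_geometric suminf_geometric)
  finally show ?thesis .
qed

text \<open>Componentwise this is termwise differentiation of a real power series;
  \<open>diffs\<close> produces exactly the index shift in \<open>d\<close>.\<close>

lemma taylor_sum_has_vector_derivative:
  assumes "\<bar>t\<bar> < 1 / (4 * C)"
  shows "(taylor_sum d k has_vector_derivative taylor_sum d (Suc k) t) (at t)"
proof -
  let ?R = "1 / (4 * C)"
  have inn: "taylor_sum d k s \<bullet> b = (\<Sum>i. ((d (i + k) \<bullet> b) / fact i) * s ^ i)" if "\<bar>s\<bar> \<le> ?R" for b s k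
    unfolding taylor_sum_def
    by (subst bounded_linear.suminf[OF bounded_linear_inner_left taylor_summable[OF that]])
       (simp add: field_simps)
  have "((\<lambda>s. taylor_sum d k s \<bullet> b) has_derivative (\<lambda>h. (h *\<^sub>R taylor_sum d (Suc k) t) \<bullet> b)) (at t)" for b
  proof -
    let ?c = "\<lambda>i. (d (i + k) \<bullet> b) / fact i"
    have "DERIV (\<lambda>z. \<Sum>i. ?c i * z ^ i) t :> (\<Sum>i. diffs ?c i * t ^ i)"
    proof (rule termdiffs_strong')
      fix z :: real assume "norm z < ?R"
      then have "summable (\<lambda>i. ((z ^ i / fact i) *\<^sub>R d (i + k)) \<bullet> b)"
        by (intro bounded_linear.summable[OF bounded_linear_inner_left] taylor_summable) simp
      then show "summable (\<lambda>i. ?c i * z ^ i)" by (simp add: field_simps)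
    qed (use assms in simp)
    also have "diffs ?c = (\<lambda>i. (d (i + Suc k) \<bullet> b) / fact i)"
      by (rule ext) (simp add: diffs_def field_simps del: of_nat_Suc)
    also have "(\<Sum>i. (d (i + Suc k) \<bullet> b) / fact i * t ^ i) = taylor_sum d (Suc k) t \<bullet> b"
      using assms by (subst inn) auto
    finally have "((\<lambda>z. \<Sum>i. ?c i * z ^ i) has_derivative (\<lambda>h. h * (taylor_sum d (Suc k) t \<bullet> b))) (at t)"
      by (simp add: has_field_derivative_def mult_commute_abs)
    then have "((\<lambda>z. \<Sum>i. ?c i * z ^ i) has_derivative (\<lambda>h. (h *\<^sub>R taylor_sum d (Suc k) t) \<bullet> b)) (at t)"
      by simp
    then show ?thesis
    proof (rule has_derivative_transform_within_open[where s = "ball 0 ?R"])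
      show "(\<Sum>i. ?c i * s ^ i) = taylor_sum d k s \<bullet> b" if "s \<in> ball 0 ?R" for s
        using that by (subst inn) (auto simp: dist_norm)
    qed (use assms in \<open>auto simp: dist_norm\<close>)
  qed
  then show ?thesis
    unfolding has_vector_derivative_def by (subst has_derivative_componentwise_within) auto
qed

end

text \<open>All Taylor coefficients at 0 vanish, so only the Maclaurin remainder of order n is left;
  it is at most M (C |t|)^n, which tends to 0 because C |t| < 1.\<close>

lemma analytic_family_eq_0:
  fixes H :: "nat \<Rightarrow> real \<Rightarrow> 'b::euclidean_space"
  assumes der: "\<And>k t. \<bar>t\<bar> < R \<Longrightarrow> (H k has_vector_derivative H (Suc k) t) (at t)"
    and bound: "\<And>k t. \<bar>t\<bar> < R \<Longrightarrow> norm (H k t) \<le> M * C ^ k * fact k"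
    and C: "C \<ge> 0" "C * R \<le> 1" and H0: "\<And>k. H k 0 = 0" and t: "\<bar>t\<bar> < R"
  shows "H 0 t = 0"
proof (rule euclidean_eqI)
  fix b :: 'b assume b: "b \<in> Basis"
  have M: "M \<ge> 0"
  proof -
    have "R > 0" using t by linarith
    then have "norm (H 0 0) \<le> M" using bound[of 0 0] by simp
    then show ?thesis using norm_ge_zero[of "H 0 0"] by linarith
  qed
  have le: "\<bar>H 0 t \<bullet> b\<bar> \<le> M * (C * \<bar>t\<bar>) ^ n" for n
  proof -
    have "\<exists>s. \<bar>s\<bar> \<le> \<bar>t\<bar> \<and> H 0 t \<bullet> b =
      (\<Sum>m<n. (H m 0 \<bullet> b) / fact m * t ^ m) + (H n s \<bullet> b) / fact n * t ^ n"
    proof (rule Maclaurin_bi_le[where diff = "\<lambda>m s. H m s \<bullet> b"])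
      show "\<forall>m s. m < n \<and> \<bar>s\<bar> \<le> \<bar>t\<bar> \<longrightarrow> DERIV (\<lambda>s. H m s \<bullet> b) s :> H (Suc m) s \<bullet> b"
        unfolding has_real_derivative_iff_has_vector_derivative
        by (intro allI impI bounded_linear.has_vector_derivative[OF bounded_linear_inner_left] der)
           (use t in auto)
    qed simp
    then obtain s where s: "\<bar>s\<bar> \<le> \<bar>t\<bar>" "H 0 t \<bullet> b = (H n s \<bullet> b) / fact n * t ^ n"
      by (auto simp: H0)
    have "\<bar>H n s \<bullet> b\<bar> \<le> norm (H n s)"
      using Basis_le_norm[OF b] by blast
    also have "\<dots> \<le> M * C ^ n * fact n" using bound s t by auto
    finally have "\<bar>H n s \<bullet> b\<bar> / fact n * \<bar>t\<bar> ^ n \<le> M * C ^ n * \<bar>t\<bar> ^ n"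
      by (intro mult_right_mono) (auto simp: field_simps)
    then show ?thesis by (simp add: s(2) abs_mult power_abs power_mult_distrib)
  qed
  have "C * \<bar>t\<bar> < 1"
  proof (cases "C = 0")
    case False
    then have "C * \<bar>t\<bar> < C * R" using t C by (intro mult_strict_left_mono) auto
    then show ?thesis using C by simp
  qed simp
  then have "(\<lambda>n. M * (C * \<bar>t\<bar>) ^ n) \<longlonglongrightarrow> M * 0"
    using C by (intro tendsto_mult tendsto_const LIMSEQ_power_zero) auto
  then have "\<bar>H 0 t \<bullet> b\<bar> \<le> M * 0"
    by (rule LIMSEQ_le_const) (use le in auto)
  then show "H 0 t \<bullet> b = 0 \<bullet> b" by simp
qed

text \<open>Uniform Cauchy-type estimates, that is, analyticity with a quantitative rate
  \<open>K\<close>. The class is stable under sums, and under index shifts and formal products at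
  the cost of a factor 2 in \<open>K\<close>; it supplies the bound needed in
  \<open>analytic_family_eq_0\<close>.\<close>

definition growth :: "real \<Rightarrow> real \<Rightarrow> (nat \<Rightarrow> real \<Rightarrow> 'b::real_normed_vector) \<Rightarrow> bool" where
  "growth K R X \<longleftrightarrow> (\<exists>A\<ge>0. \<forall>k t. \<bar>t\<bar> < R \<longrightarrow> norm (X k t) \<le> A * K ^ k * fact k)"

lemma growth_mono:
  assumes "growth K R X" "0 \<le> K" "K \<le> K'"
  shows "growth K' R X"
proof -
  obtain A where A: "A \<ge> 0" "\<And>k t. \<bar>t\<bar> < R \<Longrightarrow> norm (X k t) \<le> A * K ^ k * fact k"
    using assms(1) by (auto simp: growth_def)
  have "A * K ^ k * fact k \<le> A * K' ^ k * fact k" for k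
    using assms A by (intro mult_right_mono mult_left_mono power_mono) auto
  then show ?thesis
    using A unfolding growth_def by (meson order_trans)
qed

lemma growth_add:
  assumes "growth K R X" "growth K R Y"
  shows "growth K R (\<lambda>k t. X k t + Y k t)"
proof -
  obtain A where A: "A \<ge> 0" "\<And>k t. \<bar>t\<bar> < R \<Longrightarrow> norm (X k t) \<le> A * K ^ k * fact k"
    using assms(1) by (auto simp: growth_def)
  obtain B where B: "B \<ge> 0" "\<And>k t. \<bar>t\<bar> < R \<Longrightarrow> norm (Y k t) \<le> B * K ^ k * fact k"
    using assms(2) by (auto simp: growth_def)
  have "norm (X k t + Y k t) \<le> (A + B) * K ^ k * fact k" if "\<bar>t\<bar> < R" for k t
    using norm_triangle_le[of "X k t" "Y k t"] A(2)[OF that, of k] B(2)[OF that, of k]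
    by (simp add: algebra_simps)
  then show ?thesis
    using A(1) B(1) unfolding growth_def by (intro exI[of _ "A + B"]) auto
qed

lemma growth_minus: "growth K R X \<Longrightarrow> growth K R (\<lambda>k t. - X k t)"
  by (simp add: growth_def)

lemma growth_diff:
  assumes "growth K R X" "growth K R Y"
  shows "growth K R (\<lambda>k t. X k t - Y k t)"
  using growth_add[OF assms(1) growth_minus[OF assms(2)]] by simp

lemma growth_cmult:
  fixes X :: "nat \<Rightarrow> real \<Rightarrow> real"
  assumes "growth K R X"
  shows "growth K R (\<lambda>k t. c * X k t)"
proof -
  obtain A where A: "A \<ge> 0" "\<And>k t. \<bar>t\<bar> < R \<Longrightarrow> norm (X k t) \<le> A * K ^ k * fact k"
    using assms(1) by (auto simp: growth_def)
  have "norm (c * X k t) \<le> (\<bar>c\<bar> * A) * K ^ k * fact k" if "\<bar>t\<bar> < R" for k t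
    using mult_left_mono[OF A(2)[OF that, of k], of "\<bar>c\<bar>"] by (simp add: abs_mult mult_ac)
  then show ?thesis
    using A(1) unfolding growth_def by (intro exI[of _ "\<bar>c\<bar> * A"]) auto
qed

lemma growth_shift:
  assumes "growth K R X" "K > 0"
  shows "growth (2 * K) R (\<lambda>k. X (k + l))"
proof -
  obtain A where A: "A \<ge> 0" "\<And>k t. \<bar>t\<bar> < R \<Longrightarrow> norm (X k t) \<le> A * K ^ k * fact k"
    using assms(1) by (auto simp: growth_def)
  have "norm (X (k + l) t) \<le> (A * (2 * K) ^ l * fact l) * (2 * K) ^ k * fact k" if "\<bar>t\<bar> < R" for k t
  proof -
    have "norm (X (k + l) t) \<le> A * K ^ (k + l) * fact (k + l)" by (rule A(2)[OF that])
    also have "\<dots> \<le> A * K ^ (k + l) * (2 ^ (k + l) * (fact k * fact l))"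
      by (rule mult_left_mono[OF fact_add_le]) (use A assms in auto)
    also have "\<dots> = (A * (2 * K) ^ l * fact l) * (2 * K) ^ k * fact k"
      by (simp only: power_add power_mult_distrib mult_ac)
    finally show ?thesis .
  qed
  then show ?thesis
    using A(1) assms(2) unfolding growth_def by (intro exI[of _ "A * (2 * K) ^ l * fact l"]) auto
qed

text \<open>The factor k + 1 from \<open>norm_leibniz_sum_le\<close> is absorbed by 2^k. Leaving
  \<open>p\<close> abstract covers inner products and scalar multiplication at once.\<close>

lemma growth_leibniz_sum:
  assumes "growth K R X" "growth K R Y" "K \<ge> 0" and p: "\<And>a b. norm (p a b) \<le> norm a * norm b"
  shows "growth (2 * K) R (\<lambda>k t. leibniz_sum (\<lambda>i j. p (X i t) (Y j t)) k)"
proof -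
  obtain A where A: "A \<ge> 0" "\<And>k t. \<bar>t\<bar> < R \<Longrightarrow> norm (X k t) \<le> A * K ^ k * fact k"
    using assms(1) by (auto simp: growth_def)
  obtain B where B: "B \<ge> 0" "\<And>k t. \<bar>t\<bar> < R \<Longrightarrow> norm (Y k t) \<le> B * K ^ k * fact k"
    using assms(2) by (auto simp: growth_def)
  have "norm (leibniz_sum (\<lambda>i j. p (X i t) (Y j t)) k) \<le> (A * B) * (2 * K) ^ k * fact k"
    if t: "\<bar>t\<bar> < R" for k t
  proof -
    have "norm (leibniz_sum (\<lambda>i j. p (X i t) (Y j t)) k) \<le> (A * B * K ^ k) * fact (Suc k)"
    proof (rule norm_leibniz_sum_le)
      fix i j assume ij: "i + j = k"
      have "norm (X i t) * norm (Y j t) \<le> (A * K ^ i * fact i) * (B * K ^ j * fact j)"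
        using A B t assms(3) by (intro mult_mono) auto
      also have "\<dots> = A * B * K ^ k * (fact i * fact j)"
        by (simp only: ij[symmetric] power_add mult_ac)
      finally show "norm (p (X i t) (Y j t)) \<le> A * B * K ^ k * (fact i * fact j)"
        using p order_trans by blast
    qed
    also have "\<dots> \<le> (A * B * K ^ k) * (2 ^ k * fact k)"
    proof (rule mult_left_mono)
      have "real (Suc k) \<le> 2 ^ k"
        using less_exp[of k] by (metis Suc_leI of_nat_le_iff of_nat_numeral of_nat_power)
      then show "fact (Suc k) \<le> (2 ^ k * fact k :: real)"
        by (simp add: mult_right_mono del: of_nat_Suc)
    qed (use A B assms in auto)
    also have "\<dots> = (A * B) * (2 * K) ^ k * fact k"
      by (simp only: power_mult_distrib mult_ac)
    finally show ?thesis .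
  qed
  then show ?thesis
    using A(1) B(1) unfolding growth_def by (intro exI[of _ "A * B"]) auto
qed

text \<open>A curve is carried as the family of all its derivatives, so that two solutions can be
  matched to all orders at a common point.\<close>

definition curve_sol :: "real \<Rightarrow> real set \<Rightarrow> (nat \<Rightarrow> real \<Rightarrow> 'a::euclidean_space) \<Rightarrow> bool" where
  "curve_sol \<kappa> J S \<longleftrightarrow> (\<forall>t\<in>J. (\<forall>k. (S k has_vector_derivative S (Suc k) t) (at t within J)) \<and>
     S 0 t \<bullet> S 0 t = 1 \<and>
     S 7 t + S 5 t = (S 5 t \<bullet> S 0 t + \<kappa> * (S 3 t \<bullet> S 0 t)) *\<^sub>R S 0 t)"

text \<open>The defects of the unit-length condition and of the equation along the Taylor series
  have vanishing derivatives of all orders at 0 by \<open>jet\<close>, so the growth estimates force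
  them to vanish nearby. The radius depends on \<open>M\<close> alone, which is what allows
  continuation by uniform steps.\<close>

lemma curve_sol_of_jet:
  fixes d :: "nat \<Rightarrow> 'a::euclidean_space"
  assumes d: "jet \<kappa> d" and \<kappa>: "\<bar>\<kappa>\<bar> \<le> 1"
    and M: "M \<ge> 0" "\<And>k. k < 7 \<Longrightarrow> norm (d k) \<le> M"
    and r: "r = 1 / (32 * (1 + 2 * M))"
  shows "curve_sol \<kappa> {-r..r} (taylor_sum d)"
proof -
  \<comment> \<open>C^2 = 1 + 4 M + 4 M^2 dominates 1 + 2 M^2, as \<open>jet_growth\<close>
    requires.\<close>
  define C where "C = 1 + 2 * M"
  have C: "C \<ge> 1" "C > 0" using M by (auto simp: C_def)
  have d': "norm (d k) \<le> M * C ^ k * fact k" for k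
    by (rule jet_growth[OF d \<kappa> M C(1)]) (use M in \<open>auto simp: C_def power2_eq_square algebra_simps\<close>)
  \<comment> \<open>The rates double along the construction: 2C for the series, 4C after an index
    shift, 8C for inner products and \<psi>, 16C for \<open>ode_rhs\<close>. The radius 1/(16C)
    makes rate times radius equal to 1, and r = R/2 leaves a closed interval strictly
    inside.\<close>
  define R where "R = 1 / (16 * C)"
  have RC: "R \<le> 1 / (4 * C)" using C by (simp add: R_def field_simps)
  let ?P = "taylor_sum d"
  have der: "(?P k has_vector_derivative ?P (Suc k) t) (at t)" if "\<bar>t\<bar> < R" for k t
    by (rule taylor_sum_has_vector_derivative[OF d' M(1) C(2)]) (use that RC in auto)
  have der': "(?P k has_vector_derivative ?P (Suc k) t - (?P k t \<bullet> ?P 0 t) *\<^sub>R 0) (at t)" if "\<bar>t\<bar> < R" for k t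
    using der[OF that] by simp
  have g1: "growth (2 * C) R ?P"
    unfolding growth_def using M
    by (intro exI[of _ "2 * M"] conjI allI impI norm_taylor_sum_le[OF d' M(1) C(2)]) (use RC in auto)
  have g2: "growth (4 * C) R (\<lambda>k. ?P (k + l))" for l
    using growth_shift[OF g1, of l] C by simp
  have g3: "growth (8 * C) R (\<lambda>k t. leibniz_sum (\<lambda>i j. ?P (i + l) t \<bullet> ?P j t) k)" for l
    using growth_leibniz_sum[OF g2[of l] g2[of 0], of inner] C by (simp add: Cauchy_Schwarz_ineq2)
  have "growth (8 * C) R (\<lambda>k t. psi \<kappa> (\<lambda>k. ?P k t) k)"
  proof -
    have "psi \<kappa> (\<lambda>k. ?P k t) k = leibniz_sum (\<lambda>i j. ?P (i + 5) t \<bullet> ?P j t) k +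
        \<kappa> * leibniz_sum (\<lambda>i j. ?P (i + 3) t \<bullet> ?P j t) k" for k t
      unfolding psi_def leibniz_sum_def by (simp add: algebra_simps sum.distrib sum_distrib_left)
    then show ?thesis
      using growth_add[OF g3[of 5] growth_cmult[OF g3[of 3], of \<kappa>]] by simp
  qed
  moreover have "growth (8 * C) R ?P" using growth_mono[OF g1, of "8 * C"] C by simp
  ultimately have "growth (16 * C) R (\<lambda>k t. ode_rhs \<kappa> (\<lambda>k. ?P k t) k)"
    unfolding ode_rhs_def using growth_leibniz_sum[of "8 * C" R _ ?P scaleR] C by simp
  moreover have "growth (16 * C) R (\<lambda>k. ?P (k + l))" for l
    using growth_mono[OF g2[of l], of "16 * C"] C by simp
  ultimately have gW: "growth (16 * C) R (\<lambda>k t. ?P (k + 7) t + ?P (k + 5) t - ode_rhs \<kappa> (\<lambda>k. ?P k t) k)"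
    by (intro growth_diff growth_add) auto
  have gH: "growth (16 * C) R (\<lambda>k t. leibniz_sum (\<lambda>i j. ?P i t \<bullet> ?P j t) k - (if k = 0 then 1 else 0))"
  proof -
    have "growth (16 * C) R (\<lambda>k t. if k = 0 then 1 else 0 :: real)"
      unfolding growth_def using C by (intro exI[of _ 1]) auto
    moreover have "growth (16 * C) R (\<lambda>k t. leibniz_sum (\<lambda>i j. ?P i t \<bullet> ?P j t) k)"
      using growth_mono[OF g3[of 0], of "16 * C"] C by simp
    ultimately show ?thesis by (intro growth_diff)
  qed
  have C16: "16 * C \<ge> 0" "16 * C * R \<le> 1" using C by (auto simp: R_def)
  define W where "W k t = ?P (k + 7) t + ?P (k + 5) t - ode_rhs \<kappa> (\<lambda>k. ?P k t) k" for k t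
  define H where "H k t = leibniz_sum (\<lambda>i j. ?P i t \<bullet> ?P j t) k - (if k = 0 then 1 else 0)" for k :: nat and t
  have W: "W 0 t = 0" if t: "\<bar>t\<bar> < R" for t
  proof -
    obtain A where A: "\<And>k t. \<bar>t\<bar> < R \<Longrightarrow> norm (W k t) \<le> A * (16 * C) ^ k * fact k"
      using gW unfolding growth_def W_def by blast
    have dW: "(W k has_vector_derivative W (Suc k) t) (at t)" if "\<bar>t\<bar> < R" for k t
      using covariant_ode_deriv[OF der'[OF that] inner_zero_left, of k \<kappa>]
      unfolding W_def[abs_def] scaleR_zero_right diff_zero by simp
    have W0: "W k 0 = 0" for k
      using d unfolding jet_def W_def taylor_sum_0 by (simp only: right_minus_eq)
    show ?thesis
      by (rule analytic_family_eq_0[where H = W]) (fact dW A C16 W0 t)+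
  qed
  have H: "H 0 t = 0" if t: "\<bar>t\<bar> < R" for t
  proof -
    obtain A where A: "\<And>k t. \<bar>t\<bar> < R \<Longrightarrow> norm (H k t) \<le> A * (16 * C) ^ k * fact k"
      using gH unfolding growth_def H_def by blast
    have dH: "(H k has_vector_derivative H (Suc k) t) (at t)" if "\<bar>t\<bar> < R" for k t
      using covariant_norm_deriv[OF der'[OF that] inner_zero_left, of k]
      unfolding H_def[abs_def] .
    have H0: "H k 0 = 0" for k
      using d unfolding jet_def H_def taylor_sum_0 by (simp only: right_minus_eq)
    show ?thesis
      by (rule analytic_family_eq_0[where H = H]) (fact dH A C16 H0 t)+
  qed
  have "\<bar>t\<bar> < R" if "t \<in> {-r..r}" for t
  proof -
    have "r < R" using C unfolding r R_def C_def[symmetric] by (simp add: field_simps)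
    then show ?thesis using that by auto
  qed
  note tR = this
  show ?thesis
    unfolding curve_sol_def
  proof (intro ballI conjI allI)
    fix t assume t: "t \<in> {-r..r}"
    show "(?P k has_vector_derivative ?P (Suc k) t) (at t within {-r..r})" for k
      by (rule has_vector_derivative_at_within[OF der[OF tR[OF t]]])
    show "?P 0 t \<bullet> ?P 0 t = 1"
      using H[OF tR[OF t]] by (simp add: H_def)
    show "?P 7 t + ?P 5 t = (?P 5 t \<bullet> ?P 0 t + \<kappa> * (?P 3 t \<bullet> ?P 0 t)) *\<^sub>R ?P 0 t"
      using W[OF tR[OF t]] unfolding W_def ode_rhs_def psi_def leibniz_sum_0 add_0 by simp
  qed
qed

section \<open>Gluing, a priori bounds and continuation to the whole line\<close>

lemma curve_sol_subset:
  assumes "curve_sol \<kappa> J S" "J' \<subseteq> J"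
  shows "curve_sol \<kappa> J' S"
  using assms unfolding curve_sol_def by (meson has_vector_derivative_within_subset subsetD)

lemma curve_sol_shift:
  assumes "curve_sol \<kappa> {a..b} S"
  shows "curve_sol \<kappa> {a + c..b + c} (\<lambda>k t. S k (t - c))"
proof -
  have "((\<lambda>t. S k (t - c)) has_vector_derivative S (Suc k) (t - c)) (at t within {a + c..b + c})"
    if "t \<in> {a + c..b + c}" for k t
  proof -
    have "(S k has_vector_derivative S (Suc k) (t - c)) (at (t - c) within (\<lambda>t. t - c) ` {a + c..b + c})"
      using assms that unfolding curve_sol_def by (simp add: image_diff_atLeastAtMost[of _ _ "c"] minus_diff_eq)
    then have "((S k \<circ> (\<lambda>t. t - c)) has_vector_derivative 1 *\<^sub>R S (Suc k) (t - c)) (at t within {a + c..b + c})"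
      by (intro vector_diff_chain_within) (auto intro!: derivative_eq_intros)
    then show ?thesis by (simp add: o_def)
  qed
  then show ?thesis
    using assms unfolding curve_sol_def by auto
qed

lemma curve_sol_glue:
  assumes f: "curve_sol \<kappa> {a..c} f" and g: "curve_sol \<kappa> {c..b} g"
    and eq: "\<And>k. f k c = g k c" and ac: "a \<le> c" "c \<le> b"
  shows "curve_sol \<kappa> {a..b} (\<lambda>k t. if t \<in> {a..c} then f k t else g k t)"
proof -
  have "((\<lambda>t. if t \<in> {a..c} then f k t else g k t) has_vector_derivative
      (if t \<in> {a..c} then f (Suc k) t else g (Suc k) t)) (at t within {a..b})" if t: "t \<in> {a..b}" for k t
  proof (rule has_vector_derivative_If_within_closures[where T = "{c..b}"])
    have *: "{a..c} \<inter> {c..b} = {c}" using ac by auto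
    show "{a..b} = {a..c} \<union> {c..b}" using ac by auto
    show "t \<in> {a..c} \<union> {c..b}" using t by auto
    have cl: "closure {a..c} \<inter> closure {c..b} = {c}" "{a..c} \<union> {c} = {a..c}" "{c..b} \<union> {c} = {c..b}"
      using ac by (auto simp: *)
    show "t \<in> {a..c} \<union> closure {a..c} \<inter> closure {c..b} \<Longrightarrow>
       (f k has_vector_derivative f (Suc k) t) (at t within {a..c} \<union> closure {a..c} \<inter> closure {c..b})"
      "t \<in> {c..b} \<union> closure {a..c} \<inter> closure {c..b} \<Longrightarrow>
       (g k has_vector_derivative g (Suc k) t) (at t within {c..b} \<union> closure {a..c} \<inter> closure {c..b})"
      unfolding cl using f g by (simp_all add: curve_sol_def)
    show "f k t = g k t" if "t \<in> closure {a..c}" "t \<in> closure {c..b}"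
      using that eq ac by (auto simp: antisym)
    show "f (Suc k) t = g (Suc k) t" if "t \<in> closure {a..c}" "t \<in> closure {c..b}"
      using that eq ac by (auto simp: antisym)
  qed
  then show ?thesis
    using f g unfolding curve_sol_def by auto
qed

lemma curve_sol_jet:
  assumes S: "curve_sol \<kappa> {a..b} S" and ab: "a < b" and t: "t \<in> {a..b}"
  shows "jet \<kappa> (\<lambda>k. S k t)"
proof (rule jet_covariant_family[where N = "\<lambda>_. 0", OF _ _ _ _ _ t])
  show "at t within {a..b} \<noteq> bot" if "t \<in> {a..b}" for t
    using ab that by (simp add: trivial_limit_within islimpt_Icc)
qed (use S in \<open>auto simp: curve_sol_def\<close>)

text \<open>
  Since \<open>|S| = 1\<close>, the equation gives \<open>|S\<^sup>(\<^sup>7\<^sup>)| \<le> 2 |S\<^sup>(\<^sup>5\<^sup>)| + |S\<^sup>(\<^sup>3\<^sup>)|\<close>: solutions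
  grow at most exponentially and cannot blow up.
\<close>

lemma curve_sol_norm_7_le:
  assumes S: "curve_sol \<kappa> J S" and \<kappa>: "\<bar>\<kappa>\<bar> \<le> 1" and t: "t \<in> J"
  shows "norm (S 7 t) \<le> 2 * norm (S 5 t) + norm (S 3 t)"
proof -
  have 1: "norm (S 0 t) = 1" using S t by (simp add: curve_sol_def norm_eq_1)
  have "S 7 t = (S 5 t \<bullet> S 0 t + \<kappa> * (S 3 t \<bullet> S 0 t)) *\<^sub>R S 0 t - S 5 t"
    using S t by (simp add: curve_sol_def eq_diff_eq)
  then have "norm (S 7 t) \<le> norm ((S 5 t \<bullet> S 0 t + \<kappa> * (S 3 t \<bullet> S 0 t)) *\<^sub>R S 0 t) + norm (S 5 t)"
    using norm_triangle_ineq4 by metis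
  also have "norm ((S 5 t \<bullet> S 0 t + \<kappa> * (S 3 t \<bullet> S 0 t)) *\<^sub>R S 0 t) \<le> \<bar>S 5 t \<bullet> S 0 t\<bar> + \<bar>\<kappa>\<bar> * \<bar>S 3 t \<bullet> S 0 t\<bar>"
    using 1 by (metis abs_mult abs_triangle_ineq mult.right_neutral norm_scaleR)
  also have "\<bar>\<kappa>\<bar> * \<bar>S 3 t \<bullet> S 0 t\<bar> \<le> 1 * norm (S 3 t)"
    using \<kappa> Cauchy_Schwarz_ineq2[of "S 3 t" "S 0 t"] 1 by (intro mult_mono) auto
  finally show ?thesis
    using Cauchy_Schwarz_ineq2[of "S 5 t" "S 0 t"] 1 by simp
qed

definition jet_energy :: "(nat \<Rightarrow> 'a::euclidean_space) \<Rightarrow> real" where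
  "jet_energy d = (\<Sum>k<7. d k \<bullet> d k)"

lemma norm_le_jet_energy: "k < 7 \<Longrightarrow> norm (d k) \<le> sqrt (jet_energy d)"
proof -
  assume "k < 7"
  then have "(norm (d k))\<^sup>2 \<le> jet_energy d"
    unfolding jet_energy_def power2_norm_eq_inner by (intro member_le_sum) auto
  then show ?thesis by (simp add: real_le_rsqrt)
qed

lemma sum_less_7: "(\<Sum>k<7. f k) = f 0 + f 1 + f 2 + f 3 + f 4 + f 5 + f (6::nat)" for f :: "nat \<Rightarrow> real"
  by (simp add: eval_nat_numeral)

text \<open>Each cross term is at most the sum of two neighbouring squares, and (2a + b)^2 \<le> 8
  a^2 + 2 b^2 eliminates order 7. The largest coefficient that results is 10, at order 5; the
  constant 13 covers it.\<close>

lemma jet_energy_deriv_le: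
  assumes "norm (d 7) \<le> 2 * norm (d 5) + norm (d 3)"
  shows "\<bar>\<Sum>k<7. 2 * (d k \<bullet> d (Suc k))\<bar> \<le> 13 * jet_energy d"
proof -
  have ab: "\<bar>2 * (x \<bullet> y)\<bar> \<le> x \<bullet> x + y \<bullet> y" for x y :: 'a
    using Cauchy_Schwarz_ineq2[of x y] sum_squares_bound[of "norm x" "norm y"]
    by (simp add: power2_norm_eq_inner abs_mult)
  have "d 7 \<bullet> d 7 \<le> (2 * norm (d 5) + norm (d 3))\<^sup>2"
    unfolding power2_norm_eq_inner[symmetric] by (rule power_mono[OF assms]) simp
  also have "\<dots> \<le> 8 * (d 5 \<bullet> d 5) + 2 * (d 3 \<bullet> d 3)"
    using sum_squares_bound[of "2 * norm (d 5)" "norm (d 3)"]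
    by (simp add: power2_norm_eq_inner[symmetric] power2_eq_square algebra_simps)
  finally have 7: "d 7 \<bullet> d 7 \<le> 8 * (d 5 \<bullet> d 5) + 2 * (d 3 \<bullet> d 3)" .
  have "\<bar>\<Sum>k<7. 2 * (d k \<bullet> d (Suc k))\<bar> \<le> (\<Sum>k<7. d k \<bullet> d k + d (Suc k) \<bullet> d (Suc k))"
    by (rule order_trans[OF sum_abs sum_mono]) (rule ab)
  also have "\<dots> \<le> 13 * jet_energy d"
    unfolding jet_energy_def sum_less_7 Suc_numeral
    using 7 inner_ge_zero[of "d 0"] inner_ge_zero[of "d 1"] inner_ge_zero[of "d 2"] inner_ge_zero[of "d 3"]
      inner_ge_zero[of "d 4"] inner_ge_zero[of "d 5"] inner_ge_zero[of "d 6"]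
    by (simp add: numeral_2_eq_2 del: inner_ge_zero)
  finally show ?thesis .
qed

lemma curve_sol_gronwall:
  assumes S: "curve_sol \<kappa> {a..b} S" and \<kappa>: "\<bar>\<kappa>\<bar> \<le> 1" and st: "s \<in> {a..b}" "t \<in> {a..b}"
  shows "jet_energy (\<lambda>k. S k t) \<le> jet_energy (\<lambda>k. S k s) * exp (13 * \<bar>t - s\<bar>)"
proof -
  define E where "E t = jet_energy (\<lambda>k. S k t)" for t
  define E' where "E' t = (\<Sum>k<7. 2 * (S k t \<bullet> S (Suc k) t))" for t
  have E: "(E has_real_derivative E' t) (at t within {a..b})" if "t \<in> {a..b}" for t
  proof -
    have "((\<lambda>t. S k t \<bullet> S k t) has_vector_derivative 2 * (S k t \<bullet> S (Suc k) t)) (at t within {a..b})" for k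
    proof -
      have "(S k has_vector_derivative S (Suc k) t) (at t within {a..b})"
        using S that by (simp add: curve_sol_def)
      from bounded_bilinear.has_vector_derivative[OF bounded_bilinear_inner this this]
      show ?thesis by (simp add: inner_commute)
    qed
    then show ?thesis
      unfolding E_def[abs_def] E'_def jet_energy_def has_real_derivative_iff_has_vector_derivative
      by (intro has_vector_derivative_sum)
  qed
  have E': "\<bar>E' t\<bar> \<le> 13 * E t" if "t \<in> {a..b}" for t
    unfolding E_def E'_def by (rule jet_energy_deriv_le[OF curve_sol_norm_7_le[OF S \<kappa> that]])
  \<comment> \<open>Since |E'| \<le> 13 E, the function E exp(13 t) is nondecreasing and E exp(-13
    t) nonincreasing; the sign \<sigma> treats both directions of time in one mean value
    argument.\<close>
  have mono: "E y * exp (\<sigma> * 13 * y) \<le> E x * exp (\<sigma> * 13 * x)"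
    if "\<sigma> = 1 \<and> y \<le> x \<or> \<sigma> = -1 \<and> x \<le> y" "x \<in> {a..b}" "y \<in> {a..b}" for x y \<sigma> :: real
  proof -
    let ?F = "\<lambda>t. E t * exp (\<sigma> * 13 * t)" and ?F' = "\<lambda>t. (E' t + \<sigma> * 13 * E t) * exp (\<sigma> * 13 * t)"
    have F: "(?F has_derivative (*) (?F' t)) (at t within {min x y..max x y})" if "t \<in> {min x y..max x y}" for t
    proof -
      have "{min x y..max x y} \<subseteq> {a..b}" using \<open>x \<in> _\<close> \<open>y \<in> _\<close> by auto
      then have "(E has_real_derivative E' t) (at t within {min x y..max x y})"
        using E that DERIV_subset by blast
      then show ?thesis
        unfolding has_field_derivative_def[symmetric]
        by (auto intro!: derivative_eq_intros simp: algebra_simps)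
    qed
    have "\<exists>z\<in>{min x y..max x y}. ?F (max x y) - ?F (min x y) = ?F' z * (max x y - min x y)"
      by (rule mvt_very_simple[of _ _ ?F "\<lambda>t. (*) (?F' t)"]) (use F in auto)
    then obtain z where z: "z \<in> {min x y..max x y}"
      "?F (max x y) - ?F (min x y) = ?F' z * (max x y - min x y)" by blast
    have "z \<in> {a..b}" using z that by auto
    then have "\<bar>E' z\<bar> \<le> 13 * E z" by (rule E')
    then have "\<sigma> * ?F' z \<ge> 0"
      using that(1) by (auto simp: mult_nonneg_nonneg mult_nonpos_nonneg)
    then have "0 \<le> (\<sigma> * ?F' z) * (max x y - min x y)"
      by (rule mult_nonneg_nonneg) simp
    then have "0 \<le> \<sigma> * (?F (max x y) - ?F (min x y))"
      unfolding z(2) by (simp only: mult.assoc)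
    then show ?thesis
      using that(1) by (auto simp: max_def min_def split: if_splits)
  qed
  show ?thesis
  proof (cases "s \<le> t")
    case True
    have "E t * exp (- 13 * t) \<le> E s * exp (- 13 * s)" using mono[of "-1" t s] True st by simp
    then have "E t * exp (- 13 * t) * exp (13 * t) \<le> E s * exp (- 13 * s) * exp (13 * t)"
      by (rule mult_right_mono) simp
    then show ?thesis
      using True by (simp add: E_def mult.assoc flip: exp_add)
  next
    case False
    have "E t * exp (13 * t) \<le> E s * exp (13 * s)" using mono[of 1 t s] False st by simp
    then have "E t * exp (13 * t) * exp (- 13 * t) \<le> E s * exp (13 * s) * exp (- 13 * t)"
      by (rule mult_right_mono) simp
    then show ?thesis
      using False by (simp add: E_def mult.assoc flip: exp_add)
  qed
qed

text \<open>The Taylor series at the two endpoints take over the whole jet of \<open>S\<close>, so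
  the three pieces fit together to all orders. Bounds at the endpoints alone determine the step
  \<open>r\<close>.\<close>

lemma curve_sol_extend_step:
  fixes S :: "nat \<Rightarrow> real \<Rightarrow> 'a::euclidean_space"
  assumes S: "curve_sol \<kappa> {-c..c} S" and \<kappa>: "\<bar>\<kappa>\<bar> \<le> 1" and c: "0 < c"
    and M: "M \<ge> 0" "\<And>k. k < 7 \<Longrightarrow> norm (S k c) \<le> M" "\<And>k. k < 7 \<Longrightarrow> norm (S k (- c)) \<le> M"
    and r: "r = 1 / (32 * (1 + 2 * M))"
  shows "\<exists>S'. curve_sol \<kappa> {-(c + r)..c + r} S' \<and> (\<forall>k. \<forall>t\<in>{-c..c}. S' k t = S k t)"
proof -
  have r0: "r > 0" using M by (simp add: r)
  define P where "P = (\<lambda>k t. taylor_sum (\<lambda>k. S k c) k (t - c))"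
  define N where "N = (\<lambda>k t. taylor_sum (\<lambda>k. S k (- c)) k (t + c))"
  have "curve_sol \<kappa> {-r + c..r + c} P"
    unfolding P_def using c
    by (intro curve_sol_shift curve_sol_of_jet[OF curve_sol_jet[OF S] \<kappa> M(1,2) r]) auto
  then have P: "curve_sol \<kappa> {c..c + r} P"
    by (rule curve_sol_subset) (use r0 in auto)
  have "curve_sol \<kappa> {-r + - c..r + - c} (\<lambda>k t. taylor_sum (\<lambda>k. S k (- c)) k (t - - c))"
    using c by (intro curve_sol_shift curve_sol_of_jet[OF curve_sol_jet[OF S] \<kappa> M(1,3) r]) auto
  then have "curve_sol \<kappa> {-r + - c..r + - c} N"
    by (simp add: N_def)
  then have N: "curve_sol \<kappa> {-(c + r)..- c} N"
    by (rule curve_sol_subset) (use r0 in auto)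
  define F where "F k t = (if t \<in> {-(c + r)..- c} then N k t else S k t)" for k t
  have F: "curve_sol \<kappa> {-(c + r)..c} F"
    unfolding F_def[abs_def] by (rule curve_sol_glue[OF N S]) (use c r0 in \<open>auto simp: N_def\<close>)
  have FS: "F k t = S k t" if "t \<in> {-c..c}" for k t
    using that c by (auto simp: F_def N_def)
  have "curve_sol \<kappa> {-(c + r)..c + r} (\<lambda>k t. if t \<in> {-(c + r)..c} then F k t else P k t)"
    by (rule curve_sol_glue[OF F P]) (use c r0 FS in \<open>auto simp: P_def\<close>)
  then show ?thesis
    using FS r0 by (intro exI[of _ "\<lambda>k t. if t \<in> {-(c + r)..c} then F k t else P k t"]) auto
qed

lemma curve_sol_extend:
  fixes S :: "nat \<Rightarrow> real \<Rightarrow> 'a::euclidean_space"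
  assumes S: "curve_sol \<kappa> {-c..c} S" and \<kappa>: "\<bar>\<kappa>\<bar> \<le> 1" and c: "0 < c" "c \<le> b"
  shows "\<exists>S'. curve_sol \<kappa> {-b..b} S' \<and> (\<forall>k. \<forall>t\<in>{-c..c}. S' k t = S k t)"
proof -
  \<comment> \<open>By \<open>curve_sol_gronwall\<close> this \<open>M\<close> bounds the
    derivatives of orders 0 to 6 at every stage of the continuation inside [-b, b]. The step
    \<open>r\<close> is therefore the same each time, and finitely many steps reach
    \<open>b\<close>.\<close>
  define M where "M = sqrt (jet_energy (\<lambda>k. S k 0) * exp (13 * b))"
  define r where "r = 1 / (32 * (1 + 2 * M))"
  have E0: "jet_energy (\<lambda>k. S k 0) \<ge> 0"
    unfolding jet_energy_def by (intro sum_nonneg) auto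
  then have M: "M \<ge> 0" by (simp add: M_def)
  then have r: "r > 0" by (simp add: r_def)
  have step: "\<exists>S'. curve_sol \<kappa> {-min b (c + real n * r)..min b (c + real n * r)} S' \<and>
      (\<forall>k. \<forall>t\<in>{-c..c}. S' k t = S k t)" for n
  proof (induction n)
    case 0
    then show ?case using S c by (intro exI[of _ S]) auto
  next
    case (Suc n)
    let ?a = "min b (c + real n * r)"
    obtain S1 where S1: "curve_sol \<kappa> {-?a..?a} S1" "\<And>k t. t \<in> {-c..c} \<Longrightarrow> S1 k t = S k t"
      using Suc.IH by blast
    have a: "c \<le> ?a" "0 < ?a" using c r by (auto intro: add_pos_nonneg)
    have bd: "norm (S1 k t) \<le> M" if "k < 7" "t \<in> {-?a..?a}" for k t
    proof -
      have "jet_energy (\<lambda>k. S1 k t) \<le> jet_energy (\<lambda>k. S1 k 0) * exp (13 * \<bar>t - 0\<bar>)"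
        by (rule curve_sol_gronwall[OF S1(1) \<kappa>]) (use that a in auto)
      also have "\<dots> = jet_energy (\<lambda>k. S k 0) * exp (13 * \<bar>t - 0\<bar>)"
        using S1(2)[of 0] c by simp
      also have "\<dots> \<le> jet_energy (\<lambda>k. S k 0) * exp (13 * b)"
        using that E0 by (intro mult_left_mono) auto
      finally have "sqrt (jet_energy (\<lambda>k. S1 k t)) \<le> M" unfolding M_def by (rule real_sqrt_le_mono)
      then show ?thesis using norm_le_jet_energy[OF that(1), of "\<lambda>k. S1 k t"] by linarith
    qed
    have mem: "x \<in> {-x..x}" "- x \<in> {-x..x}" if "0 < x" for x :: real
      using that by auto
    obtain S2 where S2: "curve_sol \<kappa> {-(?a + r)..?a + r} S2" "\<And>k t. t \<in> {-?a..?a} \<Longrightarrow> S2 k t = S1 k t"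
    proof -
      have "\<exists>S2. curve_sol \<kappa> {-(?a + r)..?a + r} S2 \<and> (\<forall>k. \<forall>t\<in>{-?a..?a}. S2 k t = S1 k t)"
        by (rule curve_sol_extend_step[OF S1(1) \<kappa> a(2) M bd[OF _ mem(1)[OF a(2)]] bd[OF _ mem(2)[OF a(2)]] r_def])
      then show ?thesis using that by blast
    qed
    have "curve_sol \<kappa> {-min b (c + real (Suc n) * r)..min b (c + real (Suc n) * r)} S2"
      by (rule curve_sol_subset[OF S2(1)]) (use r in \<open>auto simp: min_def algebra_simps\<close>)
    moreover have "S2 k t = S k t" if "t \<in> {-c..c}" for k t
    proof -
      have "t \<in> {-?a..?a}" using that a by auto
      then show ?thesis using S2(2) S1(2)[OF that] by simp
    qed
    ultimately show ?case by blast
  qed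
  obtain n where "b / r < real n" using reals_Archimedean2 by blast
  then have "b < real n * r" using r by (simp add: field_simps)
  then have "min b (c + real n * r) = b" using c by auto
  then show ?thesis using step[of n] by simp
qed

lemma curve_sol_global:
  fixes d :: "nat \<Rightarrow> 'a::euclidean_space"
  assumes d: "jet \<kappa> d" and \<kappa>: "\<bar>\<kappa>\<bar> \<le> 1"
  shows "\<exists>S. curve_sol \<kappa> UNIV S \<and> (\<forall>k. S k 0 = d k)"
proof -
  define M where "M = sqrt (jet_energy d)"
  have M: "M \<ge> 0" "\<And>k. k < 7 \<Longrightarrow> norm (d k) \<le> M"
    by (auto simp: M_def norm_le_jet_energy) (auto simp: jet_energy_def intro!: sum_nonneg)
  define r where "r = 1 / (32 * (1 + 2 * M))"
  have r: "0 < r" "r \<le> 1" using M by (auto simp: r_def)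
  have S0: "curve_sol \<kappa> {-r..r} (taylor_sum d)"
    by (rule curve_sol_of_jet[OF d \<kappa> M r_def])
  define P where "P n S \<longleftrightarrow> curve_sol \<kappa> {-real (Suc n)..real (Suc n)} S \<and> (\<forall>k. S k 0 = d k)"
    for n :: nat and S :: "nat \<Rightarrow> real \<Rightarrow> 'a"
  \<comment> \<open>Dependent choice makes each stage an extension of the previous one, so the
    stages have a common limit and no uniqueness theorem for solutions is invoked. Stage n lives on
    [-(n + 1), n + 1].\<close>
  have "\<exists>f. \<forall>n. P n (f n) \<and> (\<forall>k. \<forall>t\<in>{-real (Suc n)..real (Suc n)}. f (Suc n) k t = f n k t)"
  proof (rule dependent_nat_choice)
    show "\<exists>S. P 0 S"
    proof -
      obtain S where "curve_sol \<kappa> {-1..1} S" "\<forall>k. \<forall>t\<in>{-r..r}. S k t = taylor_sum d k t"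
        using curve_sol_extend[OF S0 \<kappa> r] by blast
      then have "P 0 S" using r by (simp add: P_def)
      then show ?thesis by blast
    qed
    show "\<exists>S'. P (Suc n) S' \<and> (\<forall>k. \<forall>t\<in>{-real (Suc n)..real (Suc n)}. S' k t = S k t)" if "P n S" for S n
    proof -
      have S: "curve_sol \<kappa> {-real (Suc n)..real (Suc n)} S" "\<And>k. S k 0 = d k"
        using that by (auto simp: P_def)
      obtain S' where S': "curve_sol \<kappa> {-real (Suc (Suc n))..real (Suc (Suc n))} S'"
          "\<And>k t. t \<in> {-real (Suc n)..real (Suc n)} \<Longrightarrow> S' k t = S k t"
        using curve_sol_extend[OF S(1) \<kappa>, of "real (Suc (Suc n))"] by auto
      have "P (Suc n) S'" unfolding P_def using S' S(2) by auto
      then show ?thesis using S'(2) by blast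
    qed
  qed
  then obtain f where f: "\<And>n. P n (f n)"
    "\<And>n k t. t \<in> {-real (Suc n)..real (Suc n)} \<Longrightarrow> f (Suc n) k t = f n k t" by blast
  have f': "f (n + m) k t = f n k t" if "t \<in> {-real (Suc n)..real (Suc n)}" for n m k t
  proof (induction m)
    case (Suc m)
    have "f (Suc (n + m)) k t = f (n + m) k t" by (rule f(2)) (use that in auto)
    then show ?case using Suc by simp
  qed simp
  \<comment> \<open>By coherence every later stage gives the same value at \<open>t\<close>; this is
    used below to compute derivatives from a stage whose interval contains \<open>t\<close> in its
    interior.\<close>
  define S where "S k t = f (nat \<lceil>\<bar>t\<bar>\<rceil>) k t" for k t
  have S: "S k t = f n k t" if "\<bar>t\<bar> \<le> real n" for n k t
  proof -
    have "nat \<lceil>\<bar>t\<bar>\<rceil> \<le> n" using that by (simp add: ceiling_le_iff nat_le_iff)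
    then obtain m where "n = nat \<lceil>\<bar>t\<bar>\<rceil> + m" using le_iff_add by blast
    moreover have "t \<in> {-real (Suc (nat \<lceil>\<bar>t\<bar>\<rceil>))..real (Suc (nat \<lceil>\<bar>t\<bar>\<rceil>))}"
      using real_nat_ceiling_ge[of "\<bar>t\<bar>"] by (simp only: atLeastAtMost_iff of_nat_Suc) linarith
    ultimately show ?thesis using f' unfolding S_def by simp
  qed
  have "curve_sol \<kappa> UNIV S"
    unfolding curve_sol_def
  proof (intro ballI conjI allI)
    fix t :: real
    obtain n where n: "\<bar>t\<bar> < real n" using reals_Archimedean2 by blast
    have sol: "curve_sol \<kappa> {-real (Suc n)..real (Suc n)} (f n)" using f(1) by (simp add: P_def)
    have t: "t \<in> {-real (Suc n)..real (Suc n)}" "t \<in> interior {-real (Suc n)..real (Suc n)}" using n by auto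
    have eq: "S k t = f n k t" for k by (rule S) (use n in simp)
    show "S 0 t \<bullet> S 0 t = 1" "S 7 t + S 5 t = (S 5 t \<bullet> S 0 t + \<kappa> * (S 3 t \<bullet> S 0 t)) *\<^sub>R S 0 t"
      using sol t(1) unfolding curve_sol_def eq by blast+
    fix k
    have "(f n k has_vector_derivative S (Suc k) t) (at t within {-real (Suc n)..real (Suc n)})"
      using sol t(1) unfolding curve_sol_def eq by blast
    then have "(f n k has_vector_derivative S (Suc k) t) (at t)"
      by (simp only: at_within_interior[OF t(2)])
    then show "(S k has_vector_derivative S (Suc k) t) (at t)"
      by (rule has_vector_derivative_transform_within_open[of _ _ _ "{-real n<..<real n}"])
         (use n in \<open>auto intro!: S[symmetric]\<close>)
  qed
  moreover have "S k 0 = d k" for k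
    using S[of 0 0] f(1)[of 0] by (simp add: P_def)
  ultimately show ?thesis by blast
qed

section \<open>Energy estimates\<close>

text \<open>A polynomial vanishing at both ends of [-L, L], with derivative at most 2/L in absolute
  value there. Integration by parts against its powers produces no boundary terms, and costs one
  power and a factor of order 1/L.\<close>

definition cutoff :: "real \<Rightarrow> real \<Rightarrow> real" where
  "cutoff L t = 1 - (inverse L * t)\<^sup>2"

definition wint :: "real \<Rightarrow> nat \<Rightarrow> (real \<Rightarrow> real) \<Rightarrow> real" where
  "wint L j h = integral {-L..L} (\<lambda>t. cutoff L t ^ j * h t)"

lemma cutoff_bounds:
  assumes "t \<in> {-L..L}"
  shows "0 \<le> cutoff L t" "cutoff L t \<le> 1"
proof -
  have "t\<^sup>2 \<le> L\<^sup>2" using assms by (auto simp: abs_le_square_iff[symmetric])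
  then show "0 \<le> cutoff L t"
    by (cases "L = 0") (auto simp: cutoff_def power_mult_distrib power_inverse field_simps)
qed (simp add: cutoff_def)

lemma cutoff_ends [simp]: "L \<noteq> 0 \<Longrightarrow> cutoff L L = 0" "L \<noteq> 0 \<Longrightarrow> cutoff L (- L) = 0"
  by (simp_all add: cutoff_def)

lemma cutoff_deriv: "(cutoff L has_real_derivative - 2 * t / L\<^sup>2) (at t)"
  unfolding cutoff_def[abs_def]
  by (auto intro!: derivative_eq_intros simp: power2_eq_square divide_inverse)

lemma continuous_cutoff [continuous_intros]: "continuous_on A (cutoff L)"
  unfolding cutoff_def[abs_def] by (intro continuous_intros)

lemma wint_integrable:
  assumes "continuous_on {-L..L} h"
  shows "(\<lambda>t. cutoff L t ^ j * h t) integrable_on {-L..L}"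
  by (intro integrable_continuous_real continuous_intros assms)

lemma wint_le:
  assumes "continuous_on {-L..L} f" "continuous_on {-L..L} g"
    and "\<And>t. t \<in> {-L..L} \<Longrightarrow> cutoff L t ^ j * f t \<le> cutoff L t ^ k * g t"
  shows "wint L j f \<le> wint L k g"
  unfolding wint_def by (rule integral_le) (auto intro: wint_integrable assms)

lemma wint_add:
  assumes "continuous_on {-L..L} f" "continuous_on {-L..L} g"
  shows "wint L j (\<lambda>t. f t + g t) = wint L j f + wint L j g"
  unfolding wint_def distrib_left by (intro integral_add wint_integrable assms)

lemma wint_diff:
  assumes "continuous_on {-L..L} f" "continuous_on {-L..L} g"
  shows "wint L j (\<lambda>t. f t - g t) = wint L j f - wint L j g"
  unfolding wint_def right_diff_distrib by (intro integral_diff wint_integrable assms)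

lemma wint_cmult: "wint L j (\<lambda>t. c * f t) = c * wint L j f"
  unfolding wint_def by (simp add: mult.left_commute)

lemma wint_nonneg:
  assumes "continuous_on {-L..L} f" "\<And>t. t \<in> {-L..L} \<Longrightarrow> 0 \<le> f t"
  shows "0 \<le> wint L j f"
  unfolding wint_def using assms cutoff_bounds
  by (intro integral_nonneg wint_integrable) auto

lemma wint_mono:
  assumes "continuous_on {-L..L} f" "continuous_on {-L..L} g" "\<And>t. t \<in> {-L..L} \<Longrightarrow> f t \<le> g t"
  shows "wint L j f \<le> wint L j g"
  using assms cutoff_bounds by (intro wint_le mult_left_mono) auto

lemma wint_antimono:
  assumes "continuous_on {-L..L} f" "\<And>t. t \<in> {-L..L} \<Longrightarrow> 0 \<le> f t" "k \<le> j"
  shows "wint L j f \<le> wint L k f"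
  using assms cutoff_bounds by (intro wint_le mult_right_mono power_decreasing) auto

lemma wint_const:
  assumes "L > 0" "c \<ge> 0"
  shows "wint L j (\<lambda>_. c) \<le> 2 * L * c"
proof -
  have "wint L j (\<lambda>_. c) \<le> wint L 0 (\<lambda>_. c)" by (rule wint_antimono) (use assms in auto)
  then show ?thesis using assms by (simp add: wint_def)
qed

text \<open>The power \<open>Suc j\<close> removes the boundary terms; differentiating it leaves the
  power \<open>j\<close>, the factor \<open>Suc j\<close> and the slope bound 2/L.\<close>

lemma wint_by_parts:
  assumes L: "L > 0" and F: "\<And>t. (F has_real_derivative F' t) (at t)" and F': "continuous_on {-L..L} F'"
  shows "\<bar>wint L (Suc j) F'\<bar> \<le> (2 * real (Suc j) / L) * wint L j (\<lambda>t. \<bar>F t\<bar>)"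
proof -
  have Fc: "continuous_on {-L..L} F"
    using F by (intro DERIV_continuous_on[where D = F']) (auto intro: has_field_derivative_at_within)
  let ?D = "\<lambda>t. real (Suc j) * cutoff L t ^ j * (2 * t / L\<^sup>2) * F t"
  have "((\<lambda>t. cutoff L t ^ Suc j * F' t - ?D t) has_integral
      cutoff L L ^ Suc j * F L - cutoff L (- L) ^ Suc j * F (- L)) {-L..L}"
  proof (rule fundamental_theorem_of_calculus)
    fix t
    have "((\<lambda>t. cutoff L t ^ Suc j * F t) has_real_derivative cutoff L t ^ Suc j * F' t - ?D t) (at t)"
      by (rule derivative_eq_intros cutoff_deriv F refl | simp add: algebra_simps add_divide_distrib)+
    then show "((\<lambda>t. cutoff L t ^ Suc j * F t) has_vector_derivative cutoff L t ^ Suc j * F' t - ?D t)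
        (at t within {-L..L})"
      by (simp add: has_real_derivative_iff_has_vector_derivative has_vector_derivative_at_within)
  qed (use L in simp)
  then have "integral {-L..L} (\<lambda>t. cutoff L t ^ Suc j * F' t - ?D t) = 0"
    using L by (simp add: integral_unique)
  moreover have D: "?D integrable_on {-L..L}"
    using L by (intro integrable_continuous_real continuous_intros Fc) auto
  ultimately have "wint L (Suc j) F' = integral {-L..L} ?D"
    using integral_diff[OF wint_integrable[OF F', of "Suc j"] D] by (simp add: wint_def)
  moreover have "norm (integral {-L..L} ?D) \<le> integral {-L..L} (\<lambda>t. (2 * real (Suc j) / L) * (cutoff L t ^ j * \<bar>F t\<bar>))"
  proof (rule integral_norm_bound_integral[OF D])
    show "(\<lambda>t. (2 * real (Suc j) / L) * (cutoff L t ^ j * \<bar>F t\<bar>)) integrable_on {-L..L}"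
      by (intro integrable_continuous_real continuous_intros Fc)
    fix t assume t: "t \<in> {-L..L}"
    have "\<bar>2 * t / L\<^sup>2\<bar> \<le> 2 / L"
      using t L by (auto simp: field_simps power2_eq_square abs_le_iff)
    then have "(real (Suc j) * cutoff L t ^ j * \<bar>F t\<bar>) * \<bar>2 * t / L\<^sup>2\<bar>
        \<le> (real (Suc j) * cutoff L t ^ j * \<bar>F t\<bar>) * (2 / L)"
      using cutoff_bounds[OF t] by (intro mult_left_mono) auto
    then show "norm (?D t) \<le> (2 * real (Suc j) / L) * (cutoff L t ^ j * \<bar>F t\<bar>)"
      using cutoff_bounds[OF t] by (simp add: abs_mult mult_ac del: of_nat_Suc)
  qed
  ultimately show ?thesis by (simp add: wint_def)
qed

lemma wint_by_parts_twice:
  assumes L: "L > 0" and F: "\<And>t. (F has_real_derivative F' t) (at t)"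
    and F': "\<And>t. (F' has_real_derivative F'' t) (at t)" and F'': "continuous_on {-L..L} F''"
  shows "\<bar>wint L 6 F''\<bar> \<le> (132 / L\<^sup>2) * wint L 4 (\<lambda>t. \<bar>F t\<bar>)"
proof -
  have Fc: "continuous_on {-L..L} F"
    using F by (intro DERIV_continuous_on[where D = F']) (auto intro: has_field_derivative_at_within)
  \<comment> \<open>The second derivative of the sixth power of the cutoff: 30 times its fourth
    power times the squared slope, plus 6 times its fifth power times the second derivative -2/L^2.
    A slope of at most 2/L gives 30 * 4 + 12 = 132.\<close>
  let ?D = "\<lambda>t. (30 * cutoff L t ^ 4 * (2 * t / L\<^sup>2)\<^sup>2 - 12 / L\<^sup>2 * cutoff L t ^ 5) * F t"
  let ?G = "\<lambda>t. cutoff L t ^ 6 * F' t + 6 * cutoff L t ^ 5 * (2 * t / L\<^sup>2) * F t"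
  have "((\<lambda>t. cutoff L t ^ 6 * F'' t - ?D t) has_integral ?G L - ?G (- L)) {-L..L}"
  proof (rule fundamental_theorem_of_calculus)
    fix t
    have "(?G has_real_derivative cutoff L t ^ 6 * F'' t - ?D t) (at t)"
      using L by (auto intro!: derivative_eq_intros cutoff_deriv F F' simp: field_simps power2_eq_square)
    then show "(?G has_vector_derivative cutoff L t ^ 6 * F'' t - ?D t) (at t within {-L..L})"
      by (simp add: has_real_derivative_iff_has_vector_derivative has_vector_derivative_at_within)
  qed (use L in simp)
  then have "integral {-L..L} (\<lambda>t. cutoff L t ^ 6 * F'' t - ?D t) = 0"
    using L by (simp add: integral_unique)
  moreover have D: "?D integrable_on {-L..L}"
    using L by (intro integrable_continuous_real continuous_intros Fc) auto
  ultimately have "wint L 6 F'' = integral {-L..L} ?D"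
    using integral_diff[OF wint_integrable[OF F'', of 6] D] by (simp add: wint_def)
  moreover have "norm (integral {-L..L} ?D) \<le> integral {-L..L} (\<lambda>t. (132 / L\<^sup>2) * (cutoff L t ^ 4 * \<bar>F t\<bar>))"
  proof (rule integral_norm_bound_integral[OF D])
    show "(\<lambda>t. (132 / L\<^sup>2) * (cutoff L t ^ 4 * \<bar>F t\<bar>)) integrable_on {-L..L}"
      by (intro integrable_continuous_real continuous_intros Fc)
    fix t assume t: "t \<in> {-L..L}"
    note c = cutoff_bounds[OF t]
    have "\<bar>2 * t / L\<^sup>2\<bar> \<le> 2 / L"
      using t L by (auto simp: field_simps power2_eq_square abs_le_iff)
    then have "(2 * t / L\<^sup>2)\<^sup>2 \<le> 4 / L\<^sup>2"
      using power_mono[of "\<bar>2 * t / L\<^sup>2\<bar>" "2 / L" 2] by (simp add: power_divide)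
    then have "cutoff L t ^ 4 * (2 * t / L\<^sup>2)\<^sup>2 \<le> cutoff L t ^ 4 * (4 / L\<^sup>2)"
      by (rule mult_left_mono) (use c in simp)
    then have 1: "cutoff L t ^ 4 * (2 * t / L\<^sup>2)\<^sup>2 \<le> 4 * (cutoff L t ^ 4 / L\<^sup>2)"
      by (simp add: mult.commute)
    have 2: "cutoff L t ^ 5 / L\<^sup>2 \<le> cutoff L t ^ 4 / L\<^sup>2"
      using c by (intro divide_right_mono power_decreasing) auto
    have "\<bar>30 * A - 12 * B\<bar> \<le> 132 * D" if "A \<le> 4 * D" "B \<le> D" "0 \<le> A" "0 \<le> B" for A B D :: real
      using that by (simp add: abs_le_iff)
    from this[of "cutoff L t ^ 4 * (2 * t / L\<^sup>2)\<^sup>2" "cutoff L t ^ 4 / L\<^sup>2" "cutoff L t ^ 5 / L\<^sup>2"] 1 2 c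
    have "\<bar>30 * cutoff L t ^ 4 * (2 * t / L\<^sup>2)\<^sup>2 - 12 / L\<^sup>2 * cutoff L t ^ 5\<bar> \<le> 132 / L\<^sup>2 * cutoff L t ^ 4"
      by (simp add: mult.assoc)
    then have "\<bar>30 * cutoff L t ^ 4 * (2 * t / L\<^sup>2)\<^sup>2 - 12 / L\<^sup>2 * cutoff L t ^ 5\<bar> * \<bar>F t\<bar>
        \<le> 132 / L\<^sup>2 * cutoff L t ^ 4 * \<bar>F t\<bar>"
      by (rule mult_right_mono) simp
    then show "norm (?D t) \<le> (132 / L\<^sup>2) * (cutoff L t ^ 4 * \<bar>F t\<bar>)"
      by (simp add: abs_mult mult.assoc)
  qed
  ultimately show ?thesis by (simp add: wint_def)
qed

text \<open>Young's inequality with parameter \<delta>, where \<open>m\<close> powers of the cutoff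
  are assigned to \<open>X\<close>. Higher derivatives may thus carry higher weights than lower
  ones, which permits absorption despite the powers lost in integrating by parts.\<close>

lemma wint_inner_le:
  fixes X Y :: "real \<Rightarrow> 'a::real_inner"
  assumes X: "continuous_on {-L..L} X" and Y: "continuous_on {-L..L} Y" and \<delta>: "\<delta> > 0"
  shows "wint L (q + m) (\<lambda>t. \<bar>X t \<bullet> Y t\<bar>) \<le>
    \<delta> * wint L (q + 2 * m) (\<lambda>t. X t \<bullet> X t) + 1 / (4 * \<delta>) * wint L q (\<lambda>t. Y t \<bullet> Y t)"
proof -
  have "integral {-L..L} (\<lambda>t. cutoff L t ^ (q + m) * \<bar>X t \<bullet> Y t\<bar>) \<le>
     integral {-L..L} (\<lambda>t. \<delta> * (cutoff L t ^ (q + 2 * m) * (X t \<bullet> X t)) + 1 / (4 * \<delta>) * (cutoff L t ^ q * (Y t \<bullet> Y t)))"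
  proof (rule integral_le)
    fix t assume t: "t \<in> {-L..L}"
    note c = cutoff_bounds[OF t]
    define a where "a = cutoff L t ^ m * norm (X t)"
    have "0 \<le> (2 * \<delta> * a - norm (Y t))\<^sup>2 / (4 * \<delta>)" using \<delta> by simp
    also have "\<dots> = \<delta> * a\<^sup>2 + 1 / (4 * \<delta>) * (norm (Y t))\<^sup>2 - a * norm (Y t)"
      using \<delta> by (simp add: field_simps power2_eq_square)
    finally have 1: "a * norm (Y t) \<le> \<delta> * a\<^sup>2 + 1 / (4 * \<delta>) * (norm (Y t))\<^sup>2" by simp
    have "cutoff L t ^ (q + m) * \<bar>X t \<bullet> Y t\<bar> \<le> cutoff L t ^ (q + m) * (norm (X t) * norm (Y t))"
      using c by (intro mult_left_mono Cauchy_Schwarz_ineq2) auto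
    also have "\<dots> = cutoff L t ^ q * (a * norm (Y t))" by (simp add: a_def power_add)
    also have "\<dots> \<le> cutoff L t ^ q * (\<delta> * a\<^sup>2 + 1 / (4 * \<delta>) * (norm (Y t))\<^sup>2)"
      using c by (intro mult_left_mono 1) auto
    also have "\<dots> = \<delta> * (cutoff L t ^ (q + 2 * m) * (X t \<bullet> X t)) + 1 / (4 * \<delta>) * (cutoff L t ^ q * (Y t \<bullet> Y t))"
      by (simp add: a_def power_mult_distrib power2_norm_eq_inner power_add power_mult distrib_left mult_ac
          power_commutes flip: power_mult)
    finally show "cutoff L t ^ (q + m) * \<bar>X t \<bullet> Y t\<bar> \<le>
       \<delta> * (cutoff L t ^ (q + 2 * m) * (X t \<bullet> X t)) + 1 / (4 * \<delta>) * (cutoff L t ^ q * (Y t \<bullet> Y t))" .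
  qed (intro integrable_continuous_real continuous_intros X Y)+
  also have "\<dots> = \<delta> * wint L (q + 2 * m) (\<lambda>t. X t \<bullet> X t) + 1 / (4 * \<delta>) * wint L q (\<lambda>t. Y t \<bullet> Y t)"
    unfolding wint_def
    by (subst integral_add) (use \<delta> in \<open>auto intro!: integrable_continuous_real continuous_intros X Y\<close>)
  finally show ?thesis by (simp add: wint_def)
qed

lemma Suc_nums: "Suc 0 = 1" "Suc 1 = 2" "Suc 2 = 3" "Suc 3 = 4" "Suc 4 = 5" "Suc 5 = 6" "Suc 6 = 7"
  "Suc 7 = 8" "Suc 9 = 10" "Suc 11 = 12" "Suc 13 = 14"
  by simp_all

text \<open>The typical use is interpolation: for |S''|^2 take \<open>F = S 2 \<bullet> S 1\<close>
  and \<open>g = S 3 \<bullet> S 1\<close>, so that a middle derivative is estimated by its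
  neighbours.\<close>

lemma wint_le_by_parts:
  assumes L: "L > 0" and F: "\<And>t. (F has_real_derivative h t + g t) (at t)"
    and h: "continuous_on {-L..L} h" and g: "continuous_on {-L..L} g"
  shows "wint L (Suc j) h \<le> (2 * real (Suc j) / L) * wint L j (\<lambda>t. \<bar>F t\<bar>) + wint L (Suc j) (\<lambda>t. \<bar>g t\<bar>)"
proof -
  have "wint L (Suc j) h = wint L (Suc j) (\<lambda>t. (h t + g t) - g t)" by simp
  also have "\<dots> = wint L (Suc j) (\<lambda>t. h t + g t) - wint L (Suc j) g"
    by (intro wint_diff continuous_intros h g)
  finally have "wint L (Suc j) h = wint L (Suc j) (\<lambda>t. h t + g t) - wint L (Suc j) g" .
  moreover have "\<bar>wint L (Suc j) (\<lambda>t. h t + g t)\<bar> \<le> (2 * real (Suc j) / L) * wint L j (\<lambda>t. \<bar>F t\<bar>)"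
    by (rule wint_by_parts[OF L F]) (intro continuous_intros h g)
  moreover have "wint L (Suc j) (\<lambda>t. - 1 * g t) \<le> wint L (Suc j) (\<lambda>t. \<bar>g t\<bar>)"
    by (intro wint_mono continuous_intros g) auto
  ultimately show ?thesis unfolding wint_cmult by linarith
qed

section \<open>Weighted estimates for a solution on the whole line\<close>

definition sol_psi :: "real \<Rightarrow> (nat \<Rightarrow> real \<Rightarrow> 'a::euclidean_space) \<Rightarrow> real \<Rightarrow> real" where
  "sol_psi \<kappa> S t = S 5 t \<bullet> S 0 t + \<kappa> * (S 3 t \<bullet> S 0 t)"

context
  fixes \<kappa> :: real and S :: "nat \<Rightarrow> real \<Rightarrow> 'a::euclidean_space"
  assumes S: "curve_sol \<kappa> UNIV S" and \<kappa>: "0 \<le> \<kappa>" "\<kappa> \<le> 2/3"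
begin

lemma inner_sol_deriv:
  "((\<lambda>t. S i t \<bullet> S j t) has_real_derivative S (Suc i) t \<bullet> S j t + S i t \<bullet> S (Suc j) t) (at t)"
proof -
  have "(S k has_vector_derivative S (Suc k) t) (at t)" for k
    using S by (simp add: curve_sol_def)
  from bounded_bilinear.has_vector_derivative[OF bounded_bilinear_inner this[of i] this[of j]]
  show ?thesis by (simp add: has_real_derivative_iff_has_vector_derivative add.commute)
qed

lemma continuous_sol [continuous_intros]: "continuous_on A (S k)"
  by (rule continuous_on_vector_derivative[where f' = "S (Suc k)"])
     (use S in \<open>auto simp: curve_sol_def intro: has_vector_derivative_at_within\<close>)

lemma sol_norm_relations:
  "S 0 t \<bullet> S 0 t = 1" "S 0 t \<bullet> S 1 t = 0" "S 0 t \<bullet> S 2 t = - (S 1 t \<bullet> S 1 t)"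
  "S 0 t \<bullet> S 3 t = - 3 * (S 1 t \<bullet> S 2 t)"
  "S 0 t \<bullet> S 7 t + 7 * (S 1 t \<bullet> S 6 t) + 21 * (S 2 t \<bullet> S 5 t) + 35 * (S 3 t \<bullet> S 4 t) = 0"
proof -
  have "jet \<kappa> (\<lambda>k. S k t)"
    by (rule curve_sol_jet[OF curve_sol_subset[OF S], of "t - 1" "t + 1"]) auto
  then have L: "leibniz_sum (\<lambda>i j. S i t \<bullet> S j t) k = (if k = 0 then 1 else 0)" for k
    by (simp add: jet_def)
  show "S 0 t \<bullet> S 0 t = 1" "S 0 t \<bullet> S 1 t = 0" "S 0 t \<bullet> S 2 t = - (S 1 t \<bullet> S 1 t)"
    "S 0 t \<bullet> S 3 t = - 3 * (S 1 t \<bullet> S 2 t)"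
    using L[of 0] L[of 1] L[of 2] L[of 3] by (auto simp: leibniz_sum_def eval_nat_numeral inner_commute)
  show "S 0 t \<bullet> S 7 t + 7 * (S 1 t \<bullet> S 6 t) + 21 * (S 2 t \<bullet> S 5 t) + 35 * (S 3 t \<bullet> S 4 t) = 0"
    using L[of 7] by (simp add: leibniz_sum_def eval_nat_numeral inner_commute)
qed

lemma sol_7: "S 7 t = sol_psi \<kappa> S t *\<^sub>R S 0 t - S 5 t"
  using S by (simp add: curve_sol_def sol_psi_def eq_diff_eq)

lemma inner_sol_0_7: "S 0 t \<bullet> S 7 t = \<kappa> * (S 0 t \<bullet> S 3 t)"
  by (simp add: sol_7 sol_psi_def inner_diff_right sol_norm_relations(1) inner_commute)

text \<open>The seventh derivative of |S|^2 = 1 is the last of \<open>sol_norm_relations\<close>.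
  The equation turns its term S0.S7 into \<kappa> S0.S3 = -3 \<kappa> S1.S2, after which 2/7 of the
  relation is the derivative of the expression given here.\<close>

lemma first_integral:
  obtains c where "\<And>t. 3 * (S 3 t \<bullet> S 3 t) + 4 * (S 4 t \<bullet> S 2 t) + 2 * (S 5 t \<bullet> S 1 t) - 3/7 * \<kappa> * (S 1 t \<bullet> S 1 t) = c"
proof -
  let ?F = "\<lambda>t. 3 * (S 3 t \<bullet> S 3 t) + 4 * (S 4 t \<bullet> S 2 t) + 2 * (S 5 t \<bullet> S 1 t) - 3/7 * \<kappa> * (S 1 t \<bullet> S 1 t)"
  have "(?F has_real_derivative 0) (at t)" for t
  proof -
    have A: "(?F has_real_derivative 3 * (S 4 t \<bullet> S 3 t + S 3 t \<bullet> S 4 t) + 4 * (S 5 t \<bullet> S 2 t + S 4 t \<bullet> S 3 t)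
        + 2 * (S 6 t \<bullet> S 1 t + S 5 t \<bullet> S 2 t) - 3/7 * \<kappa> * (S 2 t \<bullet> S 1 t + S 1 t \<bullet> S 2 t)) (at t)"
      by (intro DERIV_add DERIV_diff DERIV_cmult inner_sol_deriv[of _ _ t, THEN DERIV_cong])
         (simp_all only: Suc_nums)
    have B: "3 * (S 4 t \<bullet> S 3 t + S 3 t \<bullet> S 4 t) + 4 * (S 5 t \<bullet> S 2 t + S 4 t \<bullet> S 3 t)
        + 2 * (S 6 t \<bullet> S 1 t + S 5 t \<bullet> S 2 t) - 3/7 * \<kappa> * (S 2 t \<bullet> S 1 t + S 1 t \<bullet> S 2 t) = 0"
      using sol_norm_relations(4,5)[of t] inner_sol_0_7[of t]
      by (simp add: inner_commute algebra_simps)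
    show ?thesis by (rule DERIV_cong[OF A B])
  qed
  then have "?F t = ?F 0" for t by (rule DERIV_isconst_all[rule_format])
  then show ?thesis using that by blast
qed

text \<open>Interpolation between \<open>S 1\<close> and \<open>S 3\<close>. For large
  \<open>L\<close> the term coming from the cutoff has a factor 8/L below 1/2 and is partly absorbed
  on the left.\<close>

lemma weighted_S2_le:
  assumes L: "L \<ge> 400"
  shows "wint L 4 (\<lambda>t. S 2 t \<bullet> S 2 t) \<le>
    2/3 * wint L 6 (\<lambda>t. S 3 t \<bullet> S 3 t) + wint L 2 (\<lambda>t. S 1 t \<bullet> S 1 t)"
proof -
  have "wint L (Suc 3) (\<lambda>t. S 2 t \<bullet> S 2 t) \<le>
     (2 * real (Suc 3) / L) * wint L 3 (\<lambda>t. \<bar>S 2 t \<bullet> S 1 t\<bar>) + wint L (Suc 3) (\<lambda>t. \<bar>S 3 t \<bullet> S 1 t\<bar>)"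
    by (rule wint_le_by_parts)
       (use L inner_sol_deriv[of 2 1, unfolded Suc_nums] in \<open>auto simp: add.commute intro!: continuous_intros\<close>)
  moreover have "wint L (2 + 1) (\<lambda>t. \<bar>S 2 t \<bullet> S 1 t\<bar>) \<le>
     1/2 * wint L (2 + 2 * 1) (\<lambda>t. S 2 t \<bullet> S 2 t) + 1 / (4 * (1/2)) * wint L 2 (\<lambda>t. S 1 t \<bullet> S 1 t)"
    by (rule wint_inner_le) (auto intro: continuous_intros)
  moreover have "wint L (2 + 2) (\<lambda>t. \<bar>S 3 t \<bullet> S 1 t\<bar>) \<le>
     1/2 * wint L (2 + 2 * 2) (\<lambda>t. S 3 t \<bullet> S 3 t) + 1 / (4 * (1/2)) * wint L 2 (\<lambda>t. S 1 t \<bullet> S 1 t)"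
    by (rule wint_inner_le) (auto intro: continuous_intros)
  moreover have "(8 / L) * wint L 3 (\<lambda>t. \<bar>S 2 t \<bullet> S 1 t\<bar>) \<le> 1/2 * wint L 3 (\<lambda>t. \<bar>S 2 t \<bullet> S 1 t\<bar>)"
    using L by (intro mult_right_mono wint_nonneg continuous_intros) (auto simp: field_simps)
  ultimately show ?thesis by simp
qed

text \<open>Because |S| = 1 gives S1.S1 = -S0.S2, the zeroth-order factor contributes no more than
  the length 2L of the interval. This is the origin of the bounds linear in
  \<open>L\<close>.\<close>

lemma weighted_S1_le:
  assumes L: "L \<ge> 400"
  shows "wint L 2 (\<lambda>t. S 1 t \<bullet> S 1 t) \<le> 1/4 * wint L 4 (\<lambda>t. S 2 t \<bullet> S 2 t) + 2 * L"
proof -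
  have "wint L 2 (\<lambda>t. S 1 t \<bullet> S 1 t) \<le> wint L (0 + 2) (\<lambda>t. \<bar>S 2 t \<bullet> S 0 t\<bar>)"
    unfolding add_0 by (simp add: inner_commute[of "S 2 t" for t] sol_norm_relations(3))
  also have "\<dots> \<le> 1/4 * wint L (0 + 2 * 2) (\<lambda>t. S 2 t \<bullet> S 2 t) + 1 / (4 * (1/4)) * wint L 0 (\<lambda>t. S 0 t \<bullet> S 0 t)"
    by (rule wint_inner_le) (auto intro: continuous_intros)
  also have "wint L 0 (\<lambda>t. S 0 t \<bullet> S 0 t) \<le> 2 * L * 1"
    unfolding sol_norm_relations by (rule wint_const) (use L in auto)
  finally show ?thesis by simp
qed

text \<open>The first integral reads |S3|^2 = c + (3/7) \<kappa> |S1|^2 - 2 (S3.S1)''. Two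
  integrations by parts give the last term a factor of order 1/L^2, and with
  \<open>weighted_S1_le\<close> and \<open>weighted_S2_le\<close> this closes a system of linear
  inequalities for the three integrals.\<close>

lemma weighted_S3_le:
  assumes L: "L \<ge> 400"
    and c: "\<And>t. 3 * (S 3 t \<bullet> S 3 t) + 4 * (S 4 t \<bullet> S 2 t) + 2 * (S 5 t \<bullet> S 1 t) - 3/7 * \<kappa> * (S 1 t \<bullet> S 1 t) = c"
  shows "wint L 6 (\<lambda>t. S 3 t \<bullet> S 3 t) \<le> 4 * (\<bar>c\<bar> + 1) * L"
    and "wint L 2 (\<lambda>t. S 1 t \<bullet> S 1 t) \<le> 4 * (\<bar>c\<bar> + 1) * L"
    and "wint L 4 (\<lambda>t. S 2 t \<bullet> S 2 t) \<le> 7 * (\<bar>c\<bar> + 1) * L"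
proof -
  let ?D2 = "\<lambda>t. S 5 t \<bullet> S 1 t + 2 * (S 4 t \<bullet> S 2 t) + S 3 t \<bullet> S 3 t"
  have "((\<lambda>t. S 4 t \<bullet> S 1 t + S 3 t \<bullet> S 2 t) has_real_derivative ?D2 t) (at t)" for t
    by (rule DERIV_cong[OF DERIV_add[OF inner_sol_deriv inner_sol_deriv]]) (simp only: Suc_nums; simp)
  then have "\<bar>wint L 6 ?D2\<bar> \<le> (132 / L\<^sup>2) * wint L 4 (\<lambda>t. \<bar>S 3 t \<bullet> S 1 t\<bar>)"
    by (intro wint_by_parts_twice[where F' = "\<lambda>t. S 4 t \<bullet> S 1 t + S 3 t \<bullet> S 2 t"] continuous_intros
        inner_sol_deriv[of 3 1, unfolded Suc_nums]) (use L in auto)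
  also have "\<dots> \<le> 1/40 * wint L 4 (\<lambda>t. \<bar>S 3 t \<bullet> S 1 t\<bar>)"
  proof (intro mult_right_mono wint_nonneg continuous_intros)
    have "400\<^sup>2 \<le> L\<^sup>2" using L by (intro power_mono) auto
    then show "132 / L\<^sup>2 \<le> 1/40" using L by (simp add: field_simps)
  qed auto
  finally have D2: "\<bar>wint L 6 ?D2\<bar> \<le> 1/40 * wint L 4 (\<lambda>t. \<bar>S 3 t \<bullet> S 1 t\<bar>)" .
  have 1: "wint L (2 + 2) (\<lambda>t. \<bar>S 3 t \<bullet> S 1 t\<bar>) \<le>
     1/2 * wint L (2 + 2 * 2) (\<lambda>t. S 3 t \<bullet> S 3 t) + 1 / (4 * (1/2)) * wint L 2 (\<lambda>t. S 1 t \<bullet> S 1 t)"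
    by (rule wint_inner_le) (auto intro: continuous_intros)
  have "wint L 6 (\<lambda>t. S 3 t \<bullet> S 3 t) = wint L 6 (\<lambda>t. (c + 3/7 * \<kappa> * (S 1 t \<bullet> S 1 t)) - 2 * ?D2 t)"
    by (rule arg_cong[where f = "wint L 6"]) (rule ext, use c in \<open>simp add: algebra_simps\<close>)
  also have "\<dots> = wint L 6 (\<lambda>_. c) + 3/7 * \<kappa> * wint L 6 (\<lambda>t. S 1 t \<bullet> S 1 t) - 2 * wint L 6 ?D2"
    unfolding wint_cmult[symmetric]
    by (subst wint_diff wint_add, (intro continuous_intros)+)+ (rule refl)
  finally have 2: "wint L 6 (\<lambda>t. S 3 t \<bullet> S 3 t) =
    wint L 6 (\<lambda>_. c) + 3/7 * \<kappa> * wint L 6 (\<lambda>t. S 1 t \<bullet> S 1 t) - 2 * wint L 6 ?D2" .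
  have "wint L 6 (\<lambda>_. c) \<le> wint L 6 (\<lambda>_. \<bar>c\<bar>)" by (rule wint_mono) auto
  also have "\<dots> \<le> 2 * L * \<bar>c\<bar>" by (rule wint_const) (use L in auto)
  finally have 3: "wint L 6 (\<lambda>_. c) \<le> 2 * L * \<bar>c\<bar>" .
  have n: "0 \<le> wint L k (\<lambda>t. S 1 t \<bullet> S 1 t)" for k by (intro wint_nonneg continuous_intros) auto
  have "3/7 * \<kappa> * wint L 6 (\<lambda>t. S 1 t \<bullet> S 1 t) \<le> 1 * wint L 2 (\<lambda>t. S 1 t \<bullet> S 1 t)"
    using \<kappa> by (intro mult_mono wint_antimono continuous_intros n) auto
  moreover have "wint L 4 (\<lambda>t. \<bar>S 3 t \<bullet> S 1 t\<bar>) \<le>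
      1/2 * wint L 6 (\<lambda>t. S 3 t \<bullet> S 3 t) + 1/2 * wint L 2 (\<lambda>t. S 1 t \<bullet> S 1 t)"
    using 1 by simp
  moreover have "0 \<le> \<bar>c\<bar> * L" using L by simp
  moreover have "4 * (\<bar>c\<bar> + 1) * L = 4 * (\<bar>c\<bar> * L) + 4 * L" "7 * (\<bar>c\<bar> + 1) * L = 7 * (\<bar>c\<bar> * L) + 7 * L"
    "2 * L * \<bar>c\<bar> = 2 * (\<bar>c\<bar> * L)"
    by (simp_all add: algebra_simps)
  ultimately show "wint L 6 (\<lambda>t. S 3 t \<bullet> S 3 t) \<le> 4 * (\<bar>c\<bar> + 1) * L"
    and "wint L 2 (\<lambda>t. S 1 t \<bullet> S 1 t) \<le> 4 * (\<bar>c\<bar> + 1) * L"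
    and "wint L 4 (\<lambda>t. S 2 t \<bullet> S 2 t) \<le> 7 * (\<bar>c\<bar> + 1) * L"
    using 2 3 D2 weighted_S1_le[OF L] weighted_S2_le[OF L] L by linarith+
qed

text \<open>Interpolation between \<open>S 3\<close> and \<open>S 5\<close>, with S5 written as (S5
  + S3) - S3 so that the top order enters through the energy density of
  \<open>total_derivative\<close>. The next lemma does the same one order higher, with S6 = (S6 +
  S4) - S4.\<close>

lemma weighted_S4_le:
  assumes L: "L \<ge> 400"
  shows "wint L 10 (\<lambda>t. S 4 t \<bullet> S 4 t) \<le>
    2 * wint L 6 (\<lambda>t. S 3 t \<bullet> S 3 t) + wint L 14 (\<lambda>t. (S 5 t + S 3 t) \<bullet> (S 5 t + S 3 t))"
proof -
  let ?w = "\<lambda>j. wint L j (\<lambda>t. S 3 t \<bullet> S 3 t)"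
  have "wint L (Suc 9) (\<lambda>t. S 4 t \<bullet> S 4 t) \<le>
     (2 * real (Suc 9) / L) * wint L 9 (\<lambda>t. \<bar>S 4 t \<bullet> S 3 t\<bar>) + wint L (Suc 9) (\<lambda>t. \<bar>S 5 t \<bullet> S 3 t\<bar>)"
    by (rule wint_le_by_parts)
       (use L inner_sol_deriv[of 4 3, unfolded Suc_nums] in \<open>auto simp: add.commute intro!: continuous_intros\<close>)
  moreover have "wint L 10 (\<lambda>t. \<bar>S 5 t \<bullet> S 3 t\<bar>) \<le>
      wint L 10 (\<lambda>t. \<bar>(S 5 t + S 3 t) \<bullet> S 3 t\<bar> + S 3 t \<bullet> S 3 t)"
  proof (intro wint_mono continuous_intros)
    fix t
    have "S 5 t \<bullet> S 3 t = (S 5 t + S 3 t) \<bullet> S 3 t - S 3 t \<bullet> S 3 t" by (simp add: inner_add_left)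
    then show "\<bar>S 5 t \<bullet> S 3 t\<bar> \<le> \<bar>(S 5 t + S 3 t) \<bullet> S 3 t\<bar> + S 3 t \<bullet> S 3 t"
      using inner_ge_zero[of "S 3 t"] by linarith
  qed
  moreover have "wint L 10 (\<lambda>t. \<bar>(S 5 t + S 3 t) \<bullet> S 3 t\<bar> + S 3 t \<bullet> S 3 t) =
      wint L 10 (\<lambda>t. \<bar>(S 5 t + S 3 t) \<bullet> S 3 t\<bar>) + ?w 10"
    by (intro wint_add continuous_intros)
  moreover have "wint L (8 + 1) (\<lambda>t. \<bar>S 4 t \<bullet> S 3 t\<bar>) \<le>
     1/2 * wint L (8 + 2 * 1) (\<lambda>t. S 4 t \<bullet> S 4 t) + 1 / (4 * (1/2)) * ?w 8"
    by (rule wint_inner_le) (auto intro: continuous_intros)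
  moreover have "wint L (6 + 4) (\<lambda>t. \<bar>(S 5 t + S 3 t) \<bullet> S 3 t\<bar>) \<le>
     1/2 * wint L (6 + 2 * 4) (\<lambda>t. (S 5 t + S 3 t) \<bullet> (S 5 t + S 3 t)) + 1 / (4 * (1/2)) * ?w 6"
    by (rule wint_inner_le) (auto intro: continuous_intros)
  moreover have "(20 / L) * wint L 9 (\<lambda>t. \<bar>S 4 t \<bullet> S 3 t\<bar>) \<le> 1/5 * wint L 9 (\<lambda>t. \<bar>S 4 t \<bullet> S 3 t\<bar>)"
    using L by (intro mult_right_mono wint_nonneg continuous_intros) (auto simp: field_simps)
  moreover have "?w 10 \<le> ?w 6" "?w 8 \<le> ?w 6" "0 \<le> ?w 6"
    by (intro wint_antimono wint_nonneg continuous_intros; simp)+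
  moreover have "0 \<le> wint L 14 (\<lambda>t. (S 5 t + S 3 t) \<bullet> (S 5 t + S 3 t))"
    by (intro wint_nonneg continuous_intros) simp
  ultimately show ?thesis by simp
qed

lemma weighted_S5_le:
  assumes L: "L \<ge> 400"
  shows "wint L 12 (\<lambda>t. S 5 t \<bullet> S 5 t) \<le>
    2 * wint L 10 (\<lambda>t. S 4 t \<bullet> S 4 t) + wint L 14 (\<lambda>t. (S 6 t + S 4 t) \<bullet> (S 6 t + S 4 t))"
proof -
  let ?w = "\<lambda>j. wint L j (\<lambda>t. S 4 t \<bullet> S 4 t)"
  have "wint L (Suc 11) (\<lambda>t. S 5 t \<bullet> S 5 t) \<le>
     (2 * real (Suc 11) / L) * wint L 11 (\<lambda>t. \<bar>S 5 t \<bullet> S 4 t\<bar>) + wint L (Suc 11) (\<lambda>t. \<bar>S 6 t \<bullet> S 4 t\<bar>)"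
    by (rule wint_le_by_parts)
       (use L inner_sol_deriv[of 5 4, unfolded Suc_nums] in \<open>auto simp: add.commute intro!: continuous_intros\<close>)
  moreover have "wint L 12 (\<lambda>t. \<bar>S 6 t \<bullet> S 4 t\<bar>) \<le>
      wint L 12 (\<lambda>t. \<bar>(S 6 t + S 4 t) \<bullet> S 4 t\<bar> + S 4 t \<bullet> S 4 t)"
  proof (intro wint_mono continuous_intros)
    fix t
    have "S 6 t \<bullet> S 4 t = (S 6 t + S 4 t) \<bullet> S 4 t - S 4 t \<bullet> S 4 t" by (simp add: inner_add_left)
    then show "\<bar>S 6 t \<bullet> S 4 t\<bar> \<le> \<bar>(S 6 t + S 4 t) \<bullet> S 4 t\<bar> + S 4 t \<bullet> S 4 t"
      using inner_ge_zero[of "S 4 t"] by linarith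
  qed
  moreover have "wint L 12 (\<lambda>t. \<bar>(S 6 t + S 4 t) \<bullet> S 4 t\<bar> + S 4 t \<bullet> S 4 t) =
      wint L 12 (\<lambda>t. \<bar>(S 6 t + S 4 t) \<bullet> S 4 t\<bar>) + ?w 12"
    by (intro wint_add continuous_intros)
  moreover have "wint L (10 + 1) (\<lambda>t. \<bar>S 5 t \<bullet> S 4 t\<bar>) \<le>
     1/2 * wint L (10 + 2 * 1) (\<lambda>t. S 5 t \<bullet> S 5 t) + 1 / (4 * (1/2)) * ?w 10"
    by (rule wint_inner_le) (auto intro: continuous_intros)
  moreover have "wint L (10 + 2) (\<lambda>t. \<bar>(S 6 t + S 4 t) \<bullet> S 4 t\<bar>) \<le>
     1/2 * wint L (10 + 2 * 2) (\<lambda>t. (S 6 t + S 4 t) \<bullet> (S 6 t + S 4 t)) + 1 / (4 * (1/2)) * ?w 10"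
    by (rule wint_inner_le) (auto intro: continuous_intros)
  moreover have "(24 / L) * wint L 11 (\<lambda>t. \<bar>S 5 t \<bullet> S 4 t\<bar>) \<le> 1/10 * wint L 11 (\<lambda>t. \<bar>S 5 t \<bullet> S 4 t\<bar>)"
    using L by (intro mult_right_mono wint_nonneg continuous_intros) (auto simp: field_simps)
  moreover have "?w 12 \<le> ?w 10" "0 \<le> ?w 10"
    by (intro wint_antimono wint_nonneg continuous_intros; simp)+
  moreover have "0 \<le> wint L 14 (\<lambda>t. (S 6 t + S 4 t) \<bullet> (S 6 t + S 4 t))"
    by (intro wint_nonneg continuous_intros) simp
  ultimately show ?thesis by simp
qed

text \<open>
  A nonnegative quadratic expression that is a total derivative. With \<open>\<psi>\<close> for \<^const>\<open>sol_psi\<close>, the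
  identity combines \<open>\<psi>\<^sup>2 = S\<^sub>7 \<bullet> S\<^sub>5 + S\<^sub>5 \<bullet> S\<^sub>5 + \<kappa> (S\<^sub>7 \<bullet> S\<^sub>3 + S\<^sub>5 \<bullet> S\<^sub>3)\<close>
  with \<open>S\<^sub>7 \<bullet> S\<^sub>1 + S\<^sub>5 \<bullet> S\<^sub>1 = 0\<close>.
\<close>

lemma total_derivative:
  "((\<lambda>t. (S 6 t + S 4 t) \<bullet> S 5 t + \<kappa> * ((S 6 t + S 4 t) \<bullet> S 3 t) - (1 - \<kappa>) * ((S 6 t + S 4 t) \<bullet> S 1 t)
      + (1 - \<kappa>) * ((S 5 t + S 3 t) \<bullet> S 4 t) + (1 - \<kappa>) * ((S 5 t + S 3 t) \<bullet> S 2 t))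
    has_real_derivative
    (S 6 t + S 4 t) \<bullet> (S 6 t + S 4 t) + (1 - \<kappa>) * ((S 5 t + S 3 t) \<bullet> (S 5 t + S 3 t)) + (sol_psi \<kappa> S t)\<^sup>2) (at t)"
proof -
  let ?\<psi> = "sol_psi \<kappa> S t"
  have e: "S 7 t \<bullet> S j t = ?\<psi> * (S 0 t \<bullet> S j t) - S 5 t \<bullet> S j t" for j
    by (simp add: sol_7 inner_diff_left)
  have \<psi>: "?\<psi>\<^sup>2 = ?\<psi> * (S 0 t \<bullet> S 5 t) + \<kappa> * (?\<psi> * (S 0 t \<bullet> S 3 t))"
    by (simp add: power2_eq_square) (simp add: sol_psi_def inner_commute algebra_simps)
  show ?thesis
    unfolding inner_add_left inner_add_right \<psi>
    by (rule DERIV_cong, (rule DERIV_add DERIV_diff DERIV_cmult inner_sol_deriv)+)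
       (simp only: Suc_nums e sol_norm_relations(2) inner_commute[of "S 6 t" "S 5 t"]
          inner_commute[of "S 6 t" "S 4 t"] inner_commute[of "S 6 t" "S 3 t"] inner_commute[of "S 6 t" "S 2 t"]
          inner_commute[of "S 5 t" "S 4 t"] inner_commute[of "S 5 t" "S 3 t"] inner_commute[of "S 5 t" "S 2 t"]
          inner_commute[of "S 4 t" "S 3 t"] inner_commute[of "S 4 t" "S 2 t"] inner_commute[of "S 3 t" "S 2 t"],
        simp add: algebra_simps)
qed

lemma continuous_sol_psi [continuous_intros]: "continuous_on A (sol_psi \<kappa> S)"
  unfolding sol_psi_def[abs_def] by (intro continuous_intros)

text \<open>\<open>total_derivative\<close> is integrated against the 14th power of the cutoff, and
  the five products in its primitive are split by Young's inequality with parameters proportional to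
  \<open>L\<close>. Part of the energy is absorbed; the rest is 1/L^2 times integrals bounded by a
  multiple of \<open>L\<close> plus multiples of \<open>A\<close> and \<open>B\<close>, and
  \<open>L \<ge> 400\<close> absorbs the latter too.\<close>

lemma weighted_Q_le:
  "\<exists>K. \<forall>L\<ge>400. wint L 14 (\<lambda>t. (S 5 t + S 3 t) \<bullet> (S 5 t + S 3 t) + (sol_psi \<kappa> S t)\<^sup>2) \<le> K / L"
proof -
  obtain c where c: "\<And>t. 3 * (S 3 t \<bullet> S 3 t) + 4 * (S 4 t \<bullet> S 2 t) + 2 * (S 5 t \<bullet> S 1 t)
      - 3/7 * \<kappa> * (S 1 t \<bullet> S 1 t) = c"
    using first_integral by blast
  \<comment> \<open>1176 * 24 + 2352 * 15 = 63504 collects the coefficients of \<open>K\<close>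
    below. The factor 10 pays for dividing by the coefficient of \<open>B\<close> that survives all
    absorptions, which exceeds 1/10.\<close>
  have "wint L 14 (\<lambda>t. (S 5 t + S 3 t) \<bullet> (S 5 t + S 3 t) + (sol_psi \<kappa> S t)\<^sup>2) \<le> 635040 * (\<bar>c\<bar> + 1) / L"
    if L: "L \<ge> 400" for L
  proof -
    let ?a = "\<lambda>t. S 6 t + S 4 t" and ?b = "\<lambda>t. S 5 t + S 3 t"
    define A where "A = wint L 14 (\<lambda>t. ?a t \<bullet> ?a t)"
    define B where "B = wint L 14 (\<lambda>t. ?b t \<bullet> ?b t)"
    define P where "P = wint L 14 (\<lambda>t. (sol_psi \<kappa> S t)\<^sup>2)"
    define N where "N j k = wint L j (\<lambda>t. S k t \<bullet> S k t)" for j k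
    define G where "G = (\<lambda>t. ?a t \<bullet> S 5 t + \<kappa> * (?a t \<bullet> S 3 t) - (1 - \<kappa>) * (?a t \<bullet> S 1 t)
      + (1 - \<kappa>) * (?b t \<bullet> S 4 t) + (1 - \<kappa>) * (?b t \<bullet> S 2 t))"
    define e where "e = 1 / L\<^sup>2"
    have e: "0 \<le> e" "e \<le> 1 / 160000"
    proof -
      have "400\<^sup>2 \<le> L\<^sup>2" using L by (intro power_mono) auto
      then show "e \<le> 1 / 160000" using L by (simp add: e_def field_simps)
    qed (simp add: e_def)
    have nn: "0 \<le> A" "0 \<le> B" "0 \<le> P" "0 \<le> N j k" for j k
      unfolding A_def B_def P_def N_def by (intro wint_nonneg continuous_intros; simp)+
    have anti: "N j k \<le> N i k" if "i \<le> j" for i j k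
      unfolding N_def by (intro wint_antimono continuous_intros that) simp
    have "A + (1 - \<kappa>) * B + P = wint L (Suc 13) (\<lambda>t. ?a t \<bullet> ?a t + (1 - \<kappa>) * (?b t \<bullet> ?b t) + (sol_psi \<kappa> S t)\<^sup>2)"
    proof -
      have "wint L 14 (\<lambda>t. ?a t \<bullet> ?a t + (1 - \<kappa>) * (?b t \<bullet> ?b t) + (sol_psi \<kappa> S t)\<^sup>2) =
          wint L 14 (\<lambda>t. ?a t \<bullet> ?a t + (1 - \<kappa>) * (?b t \<bullet> ?b t)) + P"
        unfolding P_def by (rule wint_add) (intro continuous_intros)+
      also have "wint L 14 (\<lambda>t. ?a t \<bullet> ?a t + (1 - \<kappa>) * (?b t \<bullet> ?b t)) =
          A + wint L 14 (\<lambda>t. (1 - \<kappa>) * (?b t \<bullet> ?b t))"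
        unfolding A_def by (rule wint_add) (intro continuous_intros)+
      finally show ?thesis by (simp only: Suc_nums wint_cmult B_def)
    qed
    also have "\<dots> \<le> \<bar>\<dots>\<bar>" by (rule abs_ge_self)
    also have "\<dots> \<le> (2 * real (Suc 13) / L) * wint L 13 (\<lambda>t. \<bar>G t\<bar>)"
    proof (rule wint_by_parts)
      show "0 < L" using L by simp
      show "(G has_real_derivative ?a t \<bullet> ?a t + (1 - \<kappa>) * (?b t \<bullet> ?b t) + (sol_psi \<kappa> S t)\<^sup>2) (at t)" for t
        unfolding G_def by (rule total_derivative)
    qed (intro continuous_intros)
    also have "wint L 13 (\<lambda>t. \<bar>G t\<bar>) \<le>
        wint L 13 (\<lambda>t. \<bar>?a t \<bullet> S 5 t\<bar> + \<bar>?a t \<bullet> S 3 t\<bar> + \<bar>?a t \<bullet> S 1 t\<bar> + \<bar>?b t \<bullet> S 4 t\<bar> + \<bar>?b t \<bullet> S 2 t\<bar>)"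
    proof (intro wint_mono)
      fix t
      have k: "\<bar>m * x\<bar> \<le> \<bar>x\<bar>" if "0 \<le> m" "m \<le> 1" for m x :: real
        using mult_right_mono[OF that(2), of "\<bar>x\<bar>"] that by (simp add: abs_mult)
      have add: "\<bar>p + q - r + s + u\<bar> \<le> \<bar>p\<bar> + q' + r' + s' + u'"
        if "\<bar>q\<bar> \<le> q'" "\<bar>r\<bar> \<le> r'" "\<bar>s\<bar> \<le> s'" "\<bar>u\<bar> \<le> u'" for p q r s u q' r' s' u' :: real
        using that by linarith
      show "\<bar>G t\<bar> \<le> \<bar>?a t \<bullet> S 5 t\<bar> + \<bar>?a t \<bullet> S 3 t\<bar> + \<bar>?a t \<bullet> S 1 t\<bar> + \<bar>?b t \<bullet> S 4 t\<bar> + \<bar>?b t \<bullet> S 2 t\<bar>"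
        unfolding G_def by (intro add k) (use \<kappa> in auto)
    qed (unfold G_def, (intro continuous_intros)+)
    also have "\<dots> = wint L 13 (\<lambda>t. \<bar>?a t \<bullet> S 5 t\<bar>) + wint L 13 (\<lambda>t. \<bar>?a t \<bullet> S 3 t\<bar>) + wint L 13 (\<lambda>t. \<bar>?a t \<bullet> S 1 t\<bar>)
        + wint L 13 (\<lambda>t. \<bar>?b t \<bullet> S 4 t\<bar>) + wint L 13 (\<lambda>t. \<bar>?b t \<bullet> S 2 t\<bar>)"
    proof -
      have add: "wint L 13 (\<lambda>t. \<bar>f1 t\<bar> + \<bar>f2 t\<bar> + \<bar>f3 t\<bar> + \<bar>f4 t\<bar> + \<bar>f5 t\<bar>) =
          wint L 13 (\<lambda>t. \<bar>f1 t\<bar>) + wint L 13 (\<lambda>t. \<bar>f2 t\<bar>) + wint L 13 (\<lambda>t. \<bar>f3 t\<bar>)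
          + wint L 13 (\<lambda>t. \<bar>f4 t\<bar>) + wint L 13 (\<lambda>t. \<bar>f5 t\<bar>)"
        if [continuous_intros]: "continuous_on {-L..L} f1" "continuous_on {-L..L} f2" "continuous_on {-L..L} f3"
          "continuous_on {-L..L} f4" "continuous_on {-L..L} f5" for f1 f2 f3 f4 f5
      proof -
        have "wint L 13 (\<lambda>t. \<bar>f1 t\<bar> + \<bar>f2 t\<bar> + \<bar>f3 t\<bar> + \<bar>f4 t\<bar> + \<bar>f5 t\<bar>) =
            wint L 13 (\<lambda>t. \<bar>f1 t\<bar> + \<bar>f2 t\<bar> + \<bar>f3 t\<bar> + \<bar>f4 t\<bar>) + wint L 13 (\<lambda>t. \<bar>f5 t\<bar>)"
          by (rule wint_add) (intro continuous_intros)+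
        also have "wint L 13 (\<lambda>t. \<bar>f1 t\<bar> + \<bar>f2 t\<bar> + \<bar>f3 t\<bar> + \<bar>f4 t\<bar>) =
            wint L 13 (\<lambda>t. \<bar>f1 t\<bar> + \<bar>f2 t\<bar> + \<bar>f3 t\<bar>) + wint L 13 (\<lambda>t. \<bar>f4 t\<bar>)"
          by (rule wint_add) (intro continuous_intros)+
        also have "wint L 13 (\<lambda>t. \<bar>f1 t\<bar> + \<bar>f2 t\<bar> + \<bar>f3 t\<bar>) =
            wint L 13 (\<lambda>t. \<bar>f1 t\<bar> + \<bar>f2 t\<bar>) + wint L 13 (\<lambda>t. \<bar>f3 t\<bar>)"
          by (rule wint_add) (intro continuous_intros)+
        also have "wint L 13 (\<lambda>t. \<bar>f1 t\<bar> + \<bar>f2 t\<bar>) = wint L 13 (\<lambda>t. \<bar>f1 t\<bar>) + wint L 13 (\<lambda>t. \<bar>f2 t\<bar>)"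
          by (rule wint_add) (intro continuous_intros)+
        finally show ?thesis .
      qed
      show ?thesis by (rule add) (intro continuous_intros)+
    qed
    finally have 1: "A + (1 - \<kappa>) * B + P \<le> (28 / L) * (wint L 13 (\<lambda>t. \<bar>?a t \<bullet> S 5 t\<bar>) + wint L 13 (\<lambda>t. \<bar>?a t \<bullet> S 3 t\<bar>)
        + wint L 13 (\<lambda>t. \<bar>?a t \<bullet> S 1 t\<bar>) + wint L 13 (\<lambda>t. \<bar>?b t \<bullet> S 4 t\<bar>) + wint L 13 (\<lambda>t. \<bar>?b t \<bullet> S 2 t\<bar>))"
      using L by (simp add: divide_right_mono)
    \<comment> \<open>The parameter L/168 turns the prefactor 28/L into 1/6, so the three products
      with \<open>?a\<close> use up A/2; the complementary term is (28/L) (42/L) = 1176/L^2.\<close>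
    have a: "(28 / L) * wint L 13 (\<lambda>t. \<bar>?a t \<bullet> S k t\<bar>) \<le> A / 6 + 1176 * (e * N 12 k)" for k
    proof -
      have "wint L (12 + 1) (\<lambda>t. \<bar>?a t \<bullet> S k t\<bar>) \<le> L / 168 * wint L (12 + 2 * 1) (\<lambda>t. ?a t \<bullet> ?a t)
         + 1 / (4 * (L / 168)) * wint L 12 (\<lambda>t. S k t \<bullet> S k t)"
        using L by (intro wint_inner_le continuous_intros) auto
      then have "(28 / L) * wint L 13 (\<lambda>t. \<bar>?a t \<bullet> S k t\<bar>) \<le> (28 / L) * (L / 168 * A + 1 / (4 * (L / 168)) * N 12 k)"
        using L unfolding A_def N_def by (intro mult_left_mono) auto
      also have "\<dots> = A / 6 + 1176 * (e * N 12 k)"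
        using L by (simp add: e_def field_simps power2_eq_square)
      finally show ?thesis .
    qed
    \<comment> \<open>The parameter L/336 gives 1/12: the two products with \<open>?b\<close> cost
      B/6, half of the B/3 that is available, and leave (28/L) (84/L) = 2352/L^2.\<close>
    have b: "(28 / L) * wint L 13 (\<lambda>t. \<bar>?b t \<bullet> S k t\<bar>) \<le> B / 12 + 2352 * (e * N 12 k)" for k
    proof -
      have "wint L (12 + 1) (\<lambda>t. \<bar>?b t \<bullet> S k t\<bar>) \<le> L / 336 * wint L (12 + 2 * 1) (\<lambda>t. ?b t \<bullet> ?b t)
         + 1 / (4 * (L / 336)) * wint L 12 (\<lambda>t. S k t \<bullet> S k t)"
        using L by (intro wint_inner_le continuous_intros) auto
      then have "(28 / L) * wint L 13 (\<lambda>t. \<bar>?b t \<bullet> S k t\<bar>) \<le> (28 / L) * (L / 336 * B + 1 / (4 * (L / 336)) * N 12 k)"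
        using L unfolding B_def N_def by (intro mult_left_mono) auto
      also have "\<dots> = B / 12 + 2352 * (e * N 12 k)"
        using L by (simp add: e_def field_simps power2_eq_square)
      finally show ?thesis .
    qed
    \<comment> \<open>The hypothesis \<kappa> \<le> 2/3 keeps 1 - \<kappa> at least 1/3, so that the
      energy controls \<open>B\<close>.\<close>
    have "A + 1/3 * B + P \<le> A + (1 - \<kappa>) * B + P"
      using \<kappa> nn by (intro add_mono mult_right_mono) auto
    also note 1
    finally have 2: "A + 1/3 * B + P \<le> A / 2 + B / 6 + 1176 * (e * (N 12 5 + N 12 3 + N 12 1)) + 2352 * (e * (N 12 4 + N 12 2))"
      using a[of 5] a[of 3] a[of 1] b[of 4] b[of 2] by (simp add: distrib_left)
    define K where "K = (\<bar>c\<bar> + 1) * L"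
    have W: "N 6 3 \<le> 4 * K" "N 2 1 \<le> 4 * K" "N 4 2 \<le> 7 * K"
      using weighted_S3_le[OF L c] unfolding N_def K_def by (simp_all only: mult.assoc)
    have Z: "N 10 4 \<le> 2 * N 6 3 + B" "N 12 5 \<le> 2 * N 10 4 + A"
      using weighted_S4_le[OF L] weighted_S5_le[OF L] unfolding N_def A_def B_def by simp_all
    have T1: "N 12 5 + N 12 3 + N 12 1 \<le> 24 * K + 2 * B + A"
      using W Z anti[of 6 12 3] anti[of 2 12 1] by linarith
    have T2: "N 12 4 + N 12 2 \<le> 15 * K + B"
      using W Z anti[of 10 12 4] anti[of 4 12 2] by linarith
    have "e * (N 12 5 + N 12 3 + N 12 1) \<le> e * (24 * K + 2 * B + A)" "e * (N 12 4 + N 12 2) \<le> e * (15 * K + B)"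
      using T1 T2 e by (auto intro: mult_left_mono)
    moreover have "e * A \<le> A / 160000" "e * B \<le> B / 160000"
      using mult_right_mono[OF e(2) nn(1)] mult_right_mono[OF e(2) nn(2)] by simp_all
    moreover have "e * K = (\<bar>c\<bar> + 1) / L" using L by (simp add: e_def K_def power2_eq_square)
    ultimately have "B + P \<le> 635040 * ((\<bar>c\<bar> + 1) / L)"
      using 2 nn unfolding distrib_left by linarith
    moreover have "wint L 14 (\<lambda>t. ?b t \<bullet> ?b t + (sol_psi \<kappa> S t)\<^sup>2) = B + P"
      unfolding B_def P_def by (intro wint_add continuous_intros)
    ultimately show ?thesis by simp
  qed
  then show ?thesis by blast
qed

lemma curvature_stationary: "S 1 0 \<bullet> S 2 0 = 0"
proof -
  let ?q = "\<lambda>t. (S 5 t + S 3 t) \<bullet> (S 5 t + S 3 t) + (sol_psi \<kappa> S t)\<^sup>2"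
  obtain K where K: "\<And>L. L \<ge> 400 \<Longrightarrow> wint L 14 ?q \<le> K / L" using weighted_Q_le by blast
  have qc: "continuous_on A ?q" for A by (intro continuous_intros)
  \<comment> \<open>On [-1, 1] the cutoff is at least 1/2, so removing its 14th power costs 2^14.
    The left side is independent of \<open>L\<close>, and letting \<open>L\<close> tend to infinity
    makes the integral vanish.\<close>
  have le: "integral {-1..1} ?q \<le> (2 ^ 14 * K) / L" if L: "L \<ge> 400" for L
  proof -
    have "(1/2) ^ 14 * integral {-1..1} ?q = integral {-1..1} (\<lambda>t. (1/2) ^ 14 * ?q t)" by simp
    also have "\<dots> \<le> integral {-1..1} (\<lambda>t. cutoff L t ^ 14 * ?q t)"
    proof (intro integral_le integrable_continuous_real continuous_intros mult_right_mono power_mono)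
      fix t :: real assume t: "t \<in> {-1..1}"
      have "\<bar>inverse L * t\<bar> \<le> 1/2 * 1"
        unfolding abs_mult using t L by (intro mult_mono) (auto simp: field_simps)
      then have "(inverse L * t)\<^sup>2 \<le> (1/2)\<^sup>2" unfolding abs_le_square_iff[symmetric] by simp
      then show "1/2 \<le> cutoff L t" by (simp add: cutoff_def power2_eq_square)
    qed auto
    also have "\<dots> \<le> wint L 14 ?q"
      unfolding wint_def
    proof (rule integral_subset_le)
      show "(\<lambda>t. cutoff L t ^ 14 * ?q t) integrable_on {-1..1}" "(\<lambda>t. cutoff L t ^ 14 * ?q t) integrable_on {-L..L}"
        by (intro integrable_continuous_real continuous_intros)+
      show "\<forall>t\<in>{-L..L}. 0 \<le> cutoff L t ^ 14 * ?q t"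
        using cutoff_bounds by (intro ballI mult_nonneg_nonneg) auto
    qed (use L in auto)
    also have "\<dots> \<le> K / L" by (rule K[OF L])
    finally have "2 ^ 14 * ((1/2) ^ 14 * integral {-1..1} ?q) \<le> 2 ^ 14 * (K / L)"
      by (rule mult_left_mono) simp
    moreover have "2 ^ 14 * ((1/2) ^ 14 * x) = x" for x :: real by (simp add: power_divide)
    ultimately show ?thesis by (simp only: times_divide_eq_right)
  qed
  have "((\<lambda>L. (2 ^ 14 * K) / L) \<longlongrightarrow> 0) at_top"
    by (rule real_tendsto_divide_at_top[OF tendsto_const filterlim_ident])
  then have "integral {-1..1} ?q \<le> 0"
    by (rule tendsto_lowerbound) (use le in \<open>auto intro: eventually_at_top_linorderI\<close>)
  moreover have "integral {-1..1} ?q \<ge> 0"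
    by (intro integral_nonneg integrable_continuous_real qc) auto
  ultimately have "integral {-1..1} ?q = 0" by simp
  then have "\<forall>t\<in>{-1..1}. ?q t = 0"
    by (subst (asm) integral_eq_0_iff) (auto intro: qc)
  then have "?q 0 = 0" by simp
  then have b: "S 5 0 + S 3 0 = 0" and \<psi>: "sol_psi \<kappa> S 0 = 0"
    by (simp_all add: add_nonneg_eq_0_iff)
  then have "S 5 0 = - S 3 0" by (simp add: add_eq_0_iff2)
  \<comment> \<open>Inserting S5 = -S3 into \<psi> = 0 gives (\<kappa> - 1) S3.S0 = 0, and \<kappa>
    is less than 1.\<close>
  then have "(1 - \<kappa>) * (S 3 0 \<bullet> S 0 0) = 0" using \<psi> by (simp add: sol_psi_def algebra_simps)
  then have "S 0 0 \<bullet> S 3 0 = 0" using \<kappa> by (simp add: inner_commute)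
  then show ?thesis using sol_norm_relations(4)[of 0] by simp
qed

end

declare continuous_sol [continuous_intros del] continuous_sol_psi [continuous_intros del]

corollary jet_curvature_stationary:
  fixes d :: "nat \<Rightarrow> 'a::euclidean_space"
  assumes "jet \<kappa> d" "0 \<le> \<kappa>" "\<kappa> \<le> 2/3"
  shows "d 1 \<bullet> d 2 = 0"
  using curve_sol_global[OF assms(1)] curvature_stationary assms by fastforce

section \<open>The Levi-Civita connection of the unit sphere\<close>

lemma Ck_on_cong:
  assumes "open U" "\<And>x. x \<in> U \<Longrightarrow> f x = g x"
  shows "Ck_on k U f \<longleftrightarrow> Ck_on k U g"
  using assms(2)
proof (induction k arbitrary: f g)
  case 0
  then show ?case by (simp cong: continuous_on_cong)
next
  case (Suc k)
  have D: "(f has_derivative D) (at x) \<longleftrightarrow> (g has_derivative D) (at x)" if "x \<in> U" for x D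
  proof
    show "(g has_derivative D) (at x)" if "(f has_derivative D) (at x)"
      by (rule has_derivative_transform_within_open[OF that assms(1) \<open>x \<in> U\<close> Suc.prems])
    show "(f has_derivative D) (at x)" if "(g has_derivative D) (at x)"
      by (rule has_derivative_transform_within_open[OF that assms(1) \<open>x \<in> U\<close> Suc.prems[symmetric]])
  qed
  have "frechet_derivative f (at x) = frechet_derivative g (at x)" if "x \<in> U" for x
    unfolding frechet_derivative_def using D[OF that] by simp
  then have "Ck_on k U (\<lambda>x. frechet_derivative f (at x) v) \<longleftrightarrow> Ck_on k U (\<lambda>x. frechet_derivative g (at x) v)" for v
    by (intro Suc.IH) auto
  moreover have "f differentiable (at x) \<longleftrightarrow> g differentiable (at x)" if "x \<in> U" for x
    using D[OF that] by (simp add: differentiable_def)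
  ultimately show ?case by simp
qed

text \<open>\<open>Ck_on\<close> looks at \<open>frechet_derivative\<close> only on the open set, so
  an explicit derivative formula valid there may replace it.\<close>

lemma Ck_on_SucI:
  assumes U: "open U" and f: "\<And>x. x \<in> U \<Longrightarrow> (f has_derivative f' x) (at x)"
    and f': "\<And>v. Ck_on k U (\<lambda>x. f' x v)"
  shows "Ck_on (Suc k) U f"
proof -
  have "frechet_derivative f (at x) = f' x" if "x \<in> U" for x
    using frechet_derivative_at[OF f[OF that]] by simp
  then have "Ck_on k U (\<lambda>x. frechet_derivative f (at x) v) \<longleftrightarrow> Ck_on k U (\<lambda>x. f' x v)" for v
    by (intro Ck_on_cong U) auto
  then show ?thesis
    using f f' by (auto simp: differentiable_def)
qed

lemma Ck_on_Suc_D: "Ck_on (Suc k) U f \<Longrightarrow> Ck_on k U f"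
proof (induction k arbitrary: f)
  case 0
  then show ?case
    by (auto simp: continuous_at_imp_continuous_on differentiable_imp_continuous_within)
next
  case (Suc k)
  have "Ck_on k U (\<lambda>x. frechet_derivative f (at x) v)" for v
    by (rule Suc.IH) (use Suc.prems in simp)
  moreover have "\<forall>x\<in>U. f differentiable (at x)"
    using Suc.prems unfolding Ck_on.simps by blast
  ultimately show ?case by simp
qed

lemma Ck_on_has_derivative:
  "Ck_on (Suc k) U f \<Longrightarrow> x \<in> U \<Longrightarrow> (f has_derivative frechet_derivative f (at x)) (at x)"
  by (simp add: frechet_derivative_works[symmetric])

lemma Ck_on_const: "open U \<Longrightarrow> Ck_on k U (\<lambda>_. c)"
  by (induction k arbitrary: c) simp_all

lemma Ck_on_add:
  assumes "open U"
  shows "Ck_on k U f \<Longrightarrow> Ck_on k U g \<Longrightarrow> Ck_on k U (\<lambda>x. f x + g x)"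
proof (induction k arbitrary: f g)
  case 0
  then show ?case by (auto intro: continuous_on_add)
next
  case (Suc k)
  show ?case
    by (rule Ck_on_SucI[OF assms has_derivative_add[OF Ck_on_has_derivative Ck_on_has_derivative]])
       (use Suc in auto)
qed

lemma Ck_on_bilinear:
  assumes "open U" and "bounded_bilinear b"
  shows "Ck_on k U f \<Longrightarrow> Ck_on k U g \<Longrightarrow> Ck_on k U (\<lambda>x. b (f x) (g x))"
proof (induction k arbitrary: f g)
  case 0
  then show ?case using bounded_bilinear.continuous_on[OF assms(2)] by auto
next
  case (Suc k)
  show ?case
  proof (rule Ck_on_SucI[OF assms(1) bounded_bilinear.FDERIV[OF assms(2)
        Ck_on_has_derivative[OF Suc.prems(1)] Ck_on_has_derivative[OF Suc.prems(2)]]])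
    have "Ck_on k U f" "Ck_on k U g" "Ck_on k U (\<lambda>x. frechet_derivative f (at x) v)"
      "Ck_on k U (\<lambda>x. frechet_derivative g (at x) v)" for v
      using Suc.prems Ck_on_Suc_D by auto
    then show "Ck_on k U (\<lambda>x. b (f x) (frechet_derivative g (at x) v) + b (frechet_derivative f (at x) v) (g x))" for v
      by (intro Ck_on_add assms(1) Suc.IH)
  qed
qed

lemma Ck_on_diff:
  assumes "open U" "Ck_on k U f" "Ck_on k U g"
  shows "Ck_on k U (\<lambda>x. f x - g x)"
  using Ck_on_add[OF assms(1,2) Ck_on_bilinear[OF assms(1) bounded_bilinear_scaleR Ck_on_const[of U k "-1 :: real"] assms(3)]]
    assms(1) by simp

section \<open>Radial extensions, tangent fields and the formula for the connection\<close>

lemma open_punctured: "open (- {0 :: 'a::real_normed_vector})"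
  by (simp add: open_Compl)

lemma normalize_has_derivative:
  fixes x :: "'a::euclidean_space"
  assumes "x \<noteq> 0"
  shows "((\<lambda>x. inverse (norm x)) has_derivative (\<lambda>v. - (inverse (norm x) * inverse (norm x) * ((x /\<^sub>R norm x) \<bullet> v)))) (at x)"
    and "((\<lambda>x. x /\<^sub>R norm x) has_derivative
      (\<lambda>v. inverse (norm x) *\<^sub>R v - (inverse (norm x) * ((x /\<^sub>R norm x) \<bullet> v)) *\<^sub>R (x /\<^sub>R norm x))) (at x)"
proof -
  show 1: "((\<lambda>x. inverse (norm x)) has_derivative (\<lambda>v. - (inverse (norm x) * inverse (norm x) * ((x /\<^sub>R norm x) \<bullet> v)))) (at x)"
    using Deriv.has_derivative_inverse[OF _ has_derivative_norm[OF assms]] assms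
    by (simp add: sgn_div_norm inner_commute mult_ac)
  have "((\<lambda>x. x /\<^sub>R norm x) has_derivative
     (\<lambda>v. inverse (norm x) *\<^sub>R v + (- (inverse (norm x) * inverse (norm x) * ((x /\<^sub>R norm x) \<bullet> v))) *\<^sub>R x)) (at x)"
    by (rule has_derivative_scaleR[OF 1 has_derivative_ident])
  then show "((\<lambda>x. x /\<^sub>R norm x) has_derivative
      (\<lambda>v. inverse (norm x) *\<^sub>R v - (inverse (norm x) * ((x /\<^sub>R norm x) \<bullet> v)) *\<^sub>R (x /\<^sub>R norm x))) (at x)"
    by (simp add: mult_ac)
qed

text \<open>Joint induction: the derivatives of the two maps are polynomial expressions in the same
  two maps and a constant vector.\<close>

lemma Ck_on_normalize:
  "Ck_on k (- {0 :: 'a::euclidean_space}) (\<lambda>x. inverse (norm x)) \<and> Ck_on k (- {0 :: 'a}) (\<lambda>x. x /\<^sub>R norm x)"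
proof (induction k)
  case 0
  show ?case by (auto intro!: continuous_intros)
next
  case (Suc k)
  have inv: "Ck_on k (- {0 :: 'a}) (\<lambda>x. inverse (norm x))" and nrm: "Ck_on k (- {0 :: 'a}) (\<lambda>x. x /\<^sub>R norm x)"
    using Suc by auto
  have dot: "Ck_on k (- {0}) (\<lambda>x :: 'a. (x /\<^sub>R norm x) \<bullet> v)" for v
    by (intro Ck_on_bilinear[OF open_punctured bounded_bilinear_inner] Ck_on_const[OF open_punctured] nrm)
  show ?case
  proof
    have "Ck_on k (- {0}) (\<lambda>x :: 'a. 0 - inverse (norm x) * inverse (norm x) * ((x /\<^sub>R norm x) \<bullet> v))" for v
      by (intro Ck_on_diff[OF open_punctured] Ck_on_const[OF open_punctured]
          Ck_on_bilinear[OF open_punctured bounded_bilinear_mult] inv dot)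
    then show "Ck_on (Suc k) (- {0 :: 'a}) (\<lambda>x. inverse (norm x))"
      by (intro Ck_on_SucI[OF open_punctured normalize_has_derivative(1)]) auto
    have "Ck_on k (- {0}) (\<lambda>x :: 'a. inverse (norm x) *\<^sub>R v - (inverse (norm x) * ((x /\<^sub>R norm x) \<bullet> v)) *\<^sub>R (x /\<^sub>R norm x))" for v
      by (intro Ck_on_diff[OF open_punctured] Ck_on_const[OF open_punctured]
          Ck_on_bilinear[OF open_punctured bounded_bilinear_scaleR]
          Ck_on_bilinear[OF open_punctured bounded_bilinear_mult] inv dot nrm)
    then show "Ck_on (Suc k) (- {0 :: 'a}) (\<lambda>x. x /\<^sub>R norm x)"
      by (intro Ck_on_SucI[OF open_punctured normalize_has_derivative(2)]) auto
  qed
qed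

text \<open>The orthogonal projection of a constant vector to the tangent spaces. It extends a
  tangent vector at one point to a global field, and its values for the basis vectors span every
  tangent space.\<close>

definition tangent_field :: "'a::euclidean_space \<Rightarrow> 'a \<Rightarrow> 'a" where
  "tangent_field w q = w - (w \<bullet> q) *\<^sub>R q"

lemma tangent_field_in_vector_fields: "tangent_field w \<in> vector_fields"
proof -
  have "Ck_on k (- {0}) (radial_ext (tangent_field w))" for k
  proof -
    have "radial_ext (tangent_field w) = (\<lambda>x. w - (w \<bullet> (x /\<^sub>R norm x)) *\<^sub>R (x /\<^sub>R norm x))"
      by (rule ext) (simp add: radial_ext_def tangent_field_def)
    moreover have "Ck_on k (- {0}) (\<lambda>x. w - (w \<bullet> (x /\<^sub>R norm x)) *\<^sub>R (x /\<^sub>R norm x))"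
      by (intro Ck_on_diff[OF open_punctured] Ck_on_const[OF open_punctured]
          Ck_on_bilinear[OF open_punctured bounded_bilinear_scaleR]
          Ck_on_bilinear[OF open_punctured bounded_bilinear_inner] conjunct2[OF Ck_on_normalize])
    ultimately show ?thesis by simp
  qed
  then show ?thesis
    by (auto simp: vector_fields_def smooth_on_sphere_def tangent_field_def inner_diff_right
        inner_commute norm_eq_1)
qed

lemma tangent_field_eq: "p \<bullet> w = 0 \<Longrightarrow> tangent_field w p = w"
  by (simp add: tangent_field_def inner_commute)

lemma radial_ext_sphere: "p \<in> sphere 0 1 \<Longrightarrow> radial_ext f p = f p"
  by (simp add: radial_ext_def)

lemma vector_field_Ck: "X \<in> vector_fields \<Longrightarrow> Ck_on k (- {0}) (radial_ext X)"
  by (simp add: vector_fields_def smooth_on_sphere_def)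

lemma vector_field_tangent: "X \<in> vector_fields \<Longrightarrow> p \<in> sphere 0 1 \<Longrightarrow> p \<bullet> X p = 0"
  by (simp add: vector_fields_def)

lemma radial_ext_has_derivative:
  assumes "X \<in> vector_fields" "x \<noteq> 0"
  shows "(radial_ext X has_derivative frechet_derivative (radial_ext X) (at x)) (at x)"
  using Ck_on_has_derivative[OF vector_field_Ck[OF assms(1), of "Suc 0"]] assms(2) by simp

lemma sphere_nonzero: "p \<in> sphere 0 1 \<Longrightarrow> p \<noteq> 0"
  by auto

text \<open>The derivative of x/|x| at \<open>p\<close> is the identity on tangent vectors, so the
  radial extension may be traded for any \<open>h\<close> that agrees with \<open>f\<close> on the
  sphere and is differentiable at \<open>p\<close>.\<close>

lemma sphere_differential_eq:
  fixes f :: "'a::euclidean_space \<Rightarrow> 'b::real_normed_vector"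
  assumes p: "p \<in> sphere 0 1" and v: "p \<bullet> v = 0"
    and eq: "\<And>q. q \<in> sphere 0 1 \<Longrightarrow> f q = h q" and h: "(h has_derivative h') (at p)"
  shows "sphere_differential f p v = h' v"
proof -
  have p0: "p \<noteq> 0" "norm p = 1" using p by auto
  have n: "((\<lambda>x. x /\<^sub>R norm x) has_derivative (\<lambda>v. v - (p \<bullet> v) *\<^sub>R p)) (at p)"
    using normalize_has_derivative(2)[OF p0(1)] p0(2) by simp
  have "((h \<circ> (\<lambda>x. x /\<^sub>R norm x)) has_derivative (h' \<circ> (\<lambda>v. v - (p \<bullet> v) *\<^sub>R p))) (at p)"
    by (rule diff_chain_at[OF n]) (use h p0 in simp)
  then have "(radial_ext f has_derivative (h' \<circ> (\<lambda>v. v - (p \<bullet> v) *\<^sub>R p))) (at p)"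
  proof (rule has_derivative_transform_within_open[OF _ open_punctured])
    show "(h \<circ> (\<lambda>x. x /\<^sub>R norm x)) x = radial_ext f x" if "x \<in> - {0}" for x
      using eq[of "x /\<^sub>R norm x"] that by (simp add: radial_ext_def)
  qed (use p0 in simp)
  from frechet_derivative_at[OF this] show ?thesis
    using v by (simp add: sphere_differential_def fun_eq_iff o_def) (metis diff_zero scale_zero_left)
qed

lemma sphere_differential_inner:
  assumes X: "X \<in> vector_fields" and Y: "Y \<in> vector_fields" and p: "p \<in> sphere 0 1"
  shows "sphere_differential (\<lambda>q. X q \<bullet> Y q) p v =
    X p \<bullet> sphere_differential Y p v + sphere_differential X p v \<bullet> Y p"
proof -
  have "radial_ext (\<lambda>q. X q \<bullet> Y q) = (\<lambda>x. radial_ext X x \<bullet> radial_ext Y x)"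
    by (rule ext) (simp add: radial_ext_def)
  then have "(radial_ext (\<lambda>q. X q \<bullet> Y q) has_derivative
      (\<lambda>v. radial_ext X p \<bullet> frechet_derivative (radial_ext Y) (at p) v +
        frechet_derivative (radial_ext X) (at p) v \<bullet> radial_ext Y p)) (at p)"
    using bounded_bilinear.FDERIV[OF bounded_bilinear_inner
        radial_ext_has_derivative[OF X sphere_nonzero[OF p]] radial_ext_has_derivative[OF Y sphere_nonzero[OF p]]]
    by simp
  from frechet_derivative_at[OF this] show ?thesis
    by (simp add: sphere_differential_def fun_eq_iff radial_ext_sphere[OF p])
qed

lemma inner_sphere_differential:
  assumes Y: "Y \<in> vector_fields" and p: "p \<in> sphere 0 1"
  shows "p \<bullet> sphere_differential Y p v = - (v \<bullet> Y p)"
proof -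
  have "((\<lambda>x. x \<bullet> radial_ext Y x) has_derivative
      (\<lambda>v. p \<bullet> frechet_derivative (radial_ext Y) (at p) v + v \<bullet> radial_ext Y p)) (at p)"
    by (rule bounded_bilinear.FDERIV[OF bounded_bilinear_inner has_derivative_ident
        radial_ext_has_derivative[OF Y sphere_nonzero[OF p]]])
  then have "((\<lambda>_. 0 :: real) has_derivative
      (\<lambda>v. p \<bullet> frechet_derivative (radial_ext Y) (at p) v + v \<bullet> radial_ext Y p)) (at p)"
  proof (rule has_derivative_transform_within_open[OF _ open_punctured])
    fix x :: 'a assume "x \<in> - {0}"
    then have "(x /\<^sub>R norm x) \<bullet> Y (x /\<^sub>R norm x) = 0"
      by (intro vector_field_tangent[OF Y]) simp
    then show "x \<bullet> radial_ext Y x = 0"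
      using \<open>x \<in> - {0}\<close> by (simp add: radial_ext_def)
  qed (use p in auto)
  from frechet_derivative_at[OF this] have "p \<bullet> sphere_differential Y p v + v \<bullet> Y p = 0"
    by (simp add: sphere_differential_def fun_eq_iff radial_ext_sphere[OF p])
  then show ?thesis by simp
qed

text \<open>
  Koszul's argument: the difference of two torsion-free metric connections is symmetric in its
  first two and skew in its last two arguments, hence zero.
\<close>

lemma levi_civita_eq:
  assumes nabla: "levi_civita_connection nabla"
    and X: "X \<in> vector_fields" and Y: "Y \<in> vector_fields" and p: "p \<in> sphere 0 1"
  shows "nabla X Y p = sphere_differential Y p (X p) + (X p \<bullet> Y p) *\<^sub>R p"
proof -
  \<comment> \<open>The comparison term is the tangential part of the ambient derivative: the normal
    component of dY(X) is -(X.Y), which the multiple of \<open>p\<close> removes.\<close>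
  define s where "s X Y = nabla X Y p - (sphere_differential Y p (X p) + (X p \<bullet> Y p) *\<^sub>R p)" for X Y
  have closed: "nabla X Y \<in> vector_fields" if "X \<in> vector_fields" "Y \<in> vector_fields" for X Y
    using nabla that by (simp add: levi_civita_connection_def affine_connection_def)
  have sym: "s X Y = s Y X" if "X \<in> vector_fields" "Y \<in> vector_fields" for X Y
  proof -
    have "nabla X Y p - nabla Y X p = sphere_differential Y p (X p) - sphere_differential X p (Y p)"
      using nabla that p by (simp add: levi_civita_connection_def torsion_free_def lie_bracket_def)
    then show ?thesis by (simp add: s_def inner_commute algebra_simps)
  qed
  have skew: "s X Y \<bullet> Z p + Y p \<bullet> s X Z = 0"
    if "X \<in> vector_fields" "Y \<in> vector_fields" "Z \<in> vector_fields" for X Y Z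
  proof -
    have "sphere_differential (\<lambda>q. Y q \<bullet> Z q) p (X p) = nabla X Y p \<bullet> Z p + Y p \<bullet> nabla X Z p"
      using nabla that p by (simp add: levi_civita_connection_def metric_compatible_def)
    moreover have "p \<bullet> Z p = 0" "Y p \<bullet> p = 0"
      using vector_field_tangent[OF that(3) p] vector_field_tangent[OF that(2) p] by (simp_all add: inner_commute)
    ultimately show ?thesis
      unfolding sphere_differential_inner[OF that(2,3) p]
      by (simp add: s_def inner_diff_left inner_diff_right inner_add_left inner_add_right)
  qed
  \<comment> \<open>Three rounds of skewness and symmetry lead back to the same expression with the
    sign -1.\<close>
  have zero: "s X Y \<bullet> Z p = 0" if "X \<in> vector_fields" "Y \<in> vector_fields" "Z \<in> vector_fields" for X Y Z
  proof -
    have "s X Y \<bullet> Z p = - (s X Z \<bullet> Y p)" using skew[of X Y Z] that by (simp add: inner_commute)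
    also have "s X Z \<bullet> Y p = - (s Z Y \<bullet> X p)" using skew[of Z X Y] sym[of X Z] that by (simp add: inner_commute)
    also have "s Z Y \<bullet> X p = - (s X Y \<bullet> Z p)"
      using skew[of Y Z X] sym[of Y Z] sym[of X Y] that by (simp add: inner_commute)
    finally show ?thesis by simp
  qed
  have "p \<bullet> s X Y = 0"
    using vector_field_tangent[OF closed[OF X Y] p] inner_sphere_differential[OF Y p, of "X p"] p
    by (simp add: s_def inner_diff_right inner_add_right norm_eq_1)
  \<comment> \<open>Being orthogonal to \<open>p\<close>, the vector \<open>s X Y\<close> is the
    value at \<open>p\<close> of a vector field, so it can be tested against itself.\<close>
  then have "tangent_field (s X Y) p = s X Y" by (rule tangent_field_eq)
  then have "s X Y \<bullet> s X Y = 0"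
    using zero[OF X Y tangent_field_in_vector_fields[of "s X Y"]] by simp
  then show ?thesis by (simp add: s_def)
qed

text \<open>The mean value theorem twice: along \<open>v\<close> for the increment in direction
  \<open>w\<close>, then along \<open>w\<close> for the derivative in direction
  \<open>v\<close>.\<close>

lemma mixed_difference_eq:
  fixes g :: "'a::real_normed_vector \<Rightarrow> real"
  assumes h: "h > 0"
    and g: "\<And>s t. s \<in> {0..h} \<Longrightarrow> t \<in> {0..h} \<Longrightarrow> (g has_derivative g' (p + s *\<^sub>R v + t *\<^sub>R w)) (at (p + s *\<^sub>R v + t *\<^sub>R w))"
    and g': "\<And>s t. s \<in> {0..h} \<Longrightarrow> t \<in> {0..h} \<Longrightarrow>
      ((\<lambda>x. g' x v) has_derivative g'' (p + s *\<^sub>R v + t *\<^sub>R w)) (at (p + s *\<^sub>R v + t *\<^sub>R w))"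
  shows "\<exists>s\<in>{0..h}. \<exists>t\<in>{0..h}.
    g (p + h *\<^sub>R v + h *\<^sub>R w) - g (p + h *\<^sub>R v) - g (p + h *\<^sub>R w) + g p = h * (h * g'' (p + s *\<^sub>R v + t *\<^sub>R w) w)"
proof -
  have lin: "f' (c *\<^sub>R x) = c * f' x" if "(f has_derivative f') F" for f f' :: "'a \<Rightarrow> real" and c x F
    using has_derivative_linear[OF that] by (simp add: linear_cmul)
  have 1: "((\<lambda>s. g (p + s *\<^sub>R v + t *\<^sub>R w)) has_derivative (\<lambda>c. c * g' (p + s *\<^sub>R v + t *\<^sub>R w) v)) (at s within {0..h})"
    if "s \<in> {0..h}" "t \<in> {0..h}" for s t
  proof -
    have "((\<lambda>s. p + s *\<^sub>R v + t *\<^sub>R w) has_derivative (\<lambda>c. c *\<^sub>R v)) (at s within {0..h})"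
      by (auto intro!: derivative_eq_intros)
    from has_derivative_compose[OF this g[OF that]] show ?thesis by (simp add: lin[OF g[OF that]])
  qed
  let ?\<phi> = "\<lambda>s. g (p + s *\<^sub>R v + h *\<^sub>R w) - g (p + s *\<^sub>R v + 0 *\<^sub>R w)"
  let ?\<phi>' = "\<lambda>s. g' (p + s *\<^sub>R v + h *\<^sub>R w) v - g' (p + s *\<^sub>R v + 0 *\<^sub>R w) v"
  have "\<exists>s\<in>{0..h}. ?\<phi> h - ?\<phi> 0 = (h - 0) * ?\<phi>' s"
  proof (rule mvt_very_simple[of 0 h ?\<phi> "\<lambda>s c. c * ?\<phi>' s"])
    fix s :: real assume s: "0 \<le> s" "s \<le> h"
    have "(?\<phi> has_derivative (\<lambda>c. c * g' (p + s *\<^sub>R v + h *\<^sub>R w) v - c * g' (p + s *\<^sub>R v + 0 *\<^sub>R w) v)) (at s within {0..h})"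
      by (rule has_derivative_diff[OF 1 1]) (use s h in auto)
    then show "(?\<phi> has_derivative (\<lambda>c. c * ?\<phi>' s)) (at s within {0..h})"
      by (simp only: right_diff_distrib)
  qed (use h in simp)
  then obtain s where s: "s \<in> {0..h}" "?\<phi> h - ?\<phi> 0 = h * ?\<phi>' s" by auto
  have "\<exists>t\<in>{0..h}. g' (p + s *\<^sub>R v + h *\<^sub>R w) v - g' (p + s *\<^sub>R v + 0 *\<^sub>R w) v = (h - 0) * g'' (p + s *\<^sub>R v + t *\<^sub>R w) w"
  proof (rule mvt_very_simple[of 0 h "\<lambda>t. g' (p + s *\<^sub>R v + t *\<^sub>R w) v" "\<lambda>t c. c * g'' (p + s *\<^sub>R v + t *\<^sub>R w) w"])
    fix t :: real assume "0 \<le> t" "t \<le> h"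
    then have t: "t \<in> {0..h}" by simp
    have "((\<lambda>t. p + s *\<^sub>R v + t *\<^sub>R w) has_derivative (\<lambda>c. c *\<^sub>R w)) (at t within {0..h})"
      by (auto intro!: derivative_eq_intros)
    from has_derivative_compose[OF this g'[OF s(1) t]]
    show "((\<lambda>t. g' (p + s *\<^sub>R v + t *\<^sub>R w) v) has_derivative (\<lambda>c. c * g'' (p + s *\<^sub>R v + t *\<^sub>R w) w)) (at t within {0..h})"
      by (simp add: lin[OF g'[OF s(1) t]])
  qed (use h in simp)
  then obtain t where t: "t \<in> {0..h}" "?\<phi>' s = h * g'' (p + s *\<^sub>R v + t *\<^sub>R w) w" by auto
  show ?thesis
    using s t by (intro bexI[of _ s] bexI[of _ t]) (auto simp: algebra_simps)
qed

text \<open>Schwarz's theorem. The second difference over a parallelogram is symmetric in its sides,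
  while \<open>mixed_difference_eq\<close> applied in both orders expresses it by the two mixed
  derivatives at points that tend to \<open>p\<close>; continuity identifies the limits.\<close>

lemma second_derivative_symmetric:
  fixes g :: "'a::real_normed_vector \<Rightarrow> real"
  assumes U: "open U" "p \<in> U"
    and g: "\<And>x. x \<in> U \<Longrightarrow> (g has_derivative g' x) (at x)"
    and g': "\<And>x v. x \<in> U \<Longrightarrow> ((\<lambda>x. g' x v) has_derivative g'' v x) (at x)"
    and cont: "\<And>v w. continuous_on U (\<lambda>x. g'' v x w)"
  shows "g'' v p w = g'' w p v"
proof -
  obtain \<epsilon> where \<epsilon>: "\<epsilon> > 0" "ball p \<epsilon> \<subseteq> U" using U openE by blast
  \<comment> \<open>Every point of the parallelogram with sides h v and h w lies within C h of
    \<open>p\<close>, so h \<le> \<epsilon>/(2C) keeps it in the ball. The summand 1 keeps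
    \<open>C\<close> positive when both vectors vanish.\<close>
  define C where "C = norm v + norm w + 1"
  have C: "C > 0" by (simp add: C_def add_nonneg_pos)
  define h where "h n = \<epsilon> / (2 * C) / real (Suc n)" for n
  have h: "h n > 0" "h n \<le> \<epsilon> / (2 * C)" for n
  proof -
    have "0 < \<epsilon> / (2 * C)" using \<epsilon> C by simp
    moreover from this have "\<epsilon> / (2 * C) / real (Suc n) \<le> \<epsilon> / (2 * C) / 1"
      by (intro divide_left_mono) auto
    ultimately show "h n > 0" "h n \<le> \<epsilon> / (2 * C)"
      unfolding h_def div_by_1 by (auto intro: divide_pos_pos simp only: of_nat_0_less_iff zero_less_Suc)
  qed
  have h0: "h \<longlonglongrightarrow> 0"
    unfolding h_def[abs_def] by (intro tendsto_divide_0[OF tendsto_const] filterlim_at_top_imp_at_infinity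
        filterlim_compose[OF filterlim_real_sequentially filterlim_Suc])
  have near: "norm (s *\<^sub>R x + t *\<^sub>R y) \<le> C * h n"
    if "s \<in> {0..h n}" "t \<in> {0..h n}" "{x, y} = {v, w}" for s t n x y
  proof -
    have "norm (s *\<^sub>R x + t *\<^sub>R y) \<le> s * norm x + t * norm y"
      using norm_triangle_ineq[of "s *\<^sub>R x" "t *\<^sub>R y"] that by simp
    also have "\<dots> \<le> h n * norm x + h n * norm y"
      using that by (intro add_mono mult_right_mono) auto
    also have "\<dots> \<le> C * h n"
      using that(3) h(1)[of n] by (auto simp: C_def doubleton_eq_iff algebra_simps)
    finally show ?thesis .
  qed
  have inU: "p + s *\<^sub>R x + t *\<^sub>R y \<in> U" if "s \<in> {0..h n}" "t \<in> {0..h n}" "{x, y} = {v, w}" for s t n x y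
  proof -
    have "norm (s *\<^sub>R x + t *\<^sub>R y) \<le> C * h n" by (rule near[OF that])
    also have "\<dots> \<le> C * (\<epsilon> / (2 * C))" using C h by (intro mult_left_mono) auto
    also have "\<dots> < \<epsilon>" using C \<epsilon> by simp
    finally have "dist p (p + (s *\<^sub>R x + t *\<^sub>R y)) < \<epsilon>"
      by (simp only: dist_add_cancel2 dist_norm add_diff_cancel_left' norm_minus_commute[of p])
    then have "p + s *\<^sub>R x + t *\<^sub>R y \<in> ball p \<epsilon>"
      by (simp only: mem_ball add.assoc)
    then show ?thesis using \<epsilon> by blast
  qed
  have ex: "\<exists>a. (\<forall>n. a n \<in> U \<and> dist (a n) p \<le> C * h n) \<and>
     (\<forall>n. g (p + h n *\<^sub>R x + h n *\<^sub>R y) - g (p + h n *\<^sub>R x) - g (p + h n *\<^sub>R y) + g p = h n * (h n * g'' x (a n) y))"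
    if xy: "{x, y} = {v, w}" for x y
  proof -
    have md: "\<exists>s\<in>{0..h n}. \<exists>t\<in>{0..h n}.
      g (p + h n *\<^sub>R x + h n *\<^sub>R y) - g (p + h n *\<^sub>R x) - g (p + h n *\<^sub>R y) + g p =
      h n * (h n * g'' x (p + s *\<^sub>R x + t *\<^sub>R y) y)" for n
    proof (rule mixed_difference_eq[OF h(1)])
      fix s t assume "s \<in> {0..h n}" "t \<in> {0..h n}"
      then have "p + s *\<^sub>R x + t *\<^sub>R y \<in> U" by (rule inU[OF _ _ xy])
      then show "(g has_derivative g' (p + s *\<^sub>R x + t *\<^sub>R y)) (at (p + s *\<^sub>R x + t *\<^sub>R y))"
        "((\<lambda>x'. g' x' x) has_derivative g'' x (p + s *\<^sub>R x + t *\<^sub>R y)) (at (p + s *\<^sub>R x + t *\<^sub>R y))"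
        by (rule g, rule g')
    qed
    have "\<exists>z. z \<in> U \<and> dist z p \<le> C * h n \<and>
      g (p + h n *\<^sub>R x + h n *\<^sub>R y) - g (p + h n *\<^sub>R x) - g (p + h n *\<^sub>R y) + g p = h n * (h n * g'' x z y)" for n
    proof -
      obtain s t where st: "s \<in> {0..h n}" "t \<in> {0..h n}"
        "g (p + h n *\<^sub>R x + h n *\<^sub>R y) - g (p + h n *\<^sub>R x) - g (p + h n *\<^sub>R y) + g p =
          h n * (h n * g'' x (p + s *\<^sub>R x + t *\<^sub>R y) y)"
        using md[of n] by blast
      have "dist (p + s *\<^sub>R x + t *\<^sub>R y) p \<le> C * h n"
        using near[OF st(1,2) xy] by (simp only: dist_norm add.assoc add_diff_cancel_left')
      then show ?thesis using inU[OF st(1,2) xy] st(3) by blast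
    qed
    then have "\<forall>n. \<exists>z. z \<in> U \<and> dist z p \<le> C * h n \<and>
      g (p + h n *\<^sub>R x + h n *\<^sub>R y) - g (p + h n *\<^sub>R x) - g (p + h n *\<^sub>R y) + g p = h n * (h n * g'' x z y)" ..
    from choice[OF this] show ?thesis by blast
  qed
  from ex[of v w] obtain a where
    a: "\<And>n. a n \<in> U" "\<And>n. dist (a n) p \<le> C * h n"
      "\<And>n. g (p + h n *\<^sub>R v + h n *\<^sub>R w) - g (p + h n *\<^sub>R v) - g (p + h n *\<^sub>R w) + g p = h n * (h n * g'' v (a n) w)"
    by blast
  have "{w, v} = {v, w}" by auto
  from ex[OF this] obtain b where
    b: "\<And>n. b n \<in> U" "\<And>n. dist (b n) p \<le> C * h n"
      "\<And>n. g (p + h n *\<^sub>R w + h n *\<^sub>R v) - g (p + h n *\<^sub>R w) - g (p + h n *\<^sub>R v) + g p = h n * (h n * g'' w (b n) v)"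
    by blast
  have eq: "g'' v (a n) w = g'' w (b n) v" for n
  proof -
    have "h n * (h n * g'' v (a n) w) = h n * (h n * g'' w (b n) v)"
      unfolding a(3)[symmetric] b(3)[symmetric] by (simp add: add_ac)
    then show ?thesis using h(1)[of n] by simp
  qed
  have lim: "(\<lambda>n. g'' x (c n) y) \<longlonglongrightarrow> g'' x p y"
    if "\<And>n. c n \<in> U" "\<And>n. dist (c n) p \<le> C * h n" for c x y
  proof -
    have lim0: "(\<lambda>n. C * h n) \<longlonglongrightarrow> 0"
      using tendsto_mult[OF tendsto_const h0, of C] by simp
    have "(\<lambda>n. dist (c n) p) \<longlonglongrightarrow> 0"
      by (rule Lim_null_comparison[OF _ lim0]) (use that(2) in simp)
    then have "c \<longlonglongrightarrow> p" by (rule iffD2[OF tendsto_dist_iff])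
    then show ?thesis
      by (rule continuous_on_tendsto_compose[OF cont]) (use U that(1) in simp_all)
  qed
  have "(\<lambda>n. g'' w (b n) v) \<longlonglongrightarrow> g'' v p w"
    using lim[OF a(1,2), of v w] unfolding eq .
  from LIMSEQ_unique[OF this lim[OF b(1,2)]] show ?thesis .
qed

section \<open>Curvature of the unit sphere\<close>

lemma vector_fields_diff:
  assumes X: "X \<in> vector_fields" and Y: "Y \<in> vector_fields"
    and eq: "\<And>p. p \<in> sphere 0 1 \<Longrightarrow> Z p = X p - Y p"
  shows "Z \<in> vector_fields"
proof -
  have "Ck_on k (- {0}) (radial_ext Z) \<longleftrightarrow> Ck_on k (- {0}) (\<lambda>x. radial_ext X x - radial_ext Y x)" for k
    by (rule Ck_on_cong[OF open_punctured]) (simp add: radial_ext_def eq)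
  then have "Ck_on k (- {0}) (radial_ext Z)" for k
    using Ck_on_diff[OF open_punctured vector_field_Ck[OF X] vector_field_Ck[OF Y]] by blast
  moreover have "p \<bullet> Z p = 0" if "p \<in> sphere 0 1" for p
    using that vector_field_tangent[OF X that] vector_field_tangent[OF Y that] by (simp add: eq inner_diff_right)
  ultimately show ?thesis by (simp add: vector_fields_def smooth_on_sphere_def)
qed

context
  fixes nabla :: "('a::euclidean_space \<Rightarrow> 'a) \<Rightarrow> ('a \<Rightarrow> 'a) \<Rightarrow> 'a \<Rightarrow> 'a"
  assumes nabla: "levi_civita_connection nabla"
begin

lemma nabla_vector_fields: "X \<in> vector_fields \<Longrightarrow> Y \<in> vector_fields \<Longrightarrow> nabla X Y \<in> vector_fields"
  using nabla by (simp add: levi_civita_connection_def affine_connection_def)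

lemma lie_bracket_vector_fields:
  fixes X Y :: "'a \<Rightarrow> 'a"
  assumes "X \<in> vector_fields" "Y \<in> vector_fields"
  shows "lie_bracket X Y \<in> vector_fields"
proof (rule vector_fields_diff[OF nabla_vector_fields[OF assms] nabla_vector_fields[OF assms(2,1)]])
  show "lie_bracket X Y p = nabla X Y p - nabla Y X p" if "p \<in> sphere 0 1" for p
    using nabla assms that by (simp add: levi_civita_connection_def torsion_free_def)
qed

text \<open>The second derivative of \<open>Z\<close> in the directions \<open>X p\<close> and
  \<open>Y p\<close> is isolated as a term of its own, so that its symmetry can cancel it in the
  curvature.\<close>

lemma nabla_nabla_eq:
  fixes X Y Z :: "'a \<Rightarrow> 'a"
  assumes X: "X \<in> vector_fields" and Y: "Y \<in> vector_fields" and Z: "Z \<in> vector_fields"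
    and p: "p \<in> sphere 0 1"
  defines "D \<equiv> \<lambda>w x. frechet_derivative (radial_ext Z) (at x) w"
  shows "nabla X (nabla Y Z) p =
    frechet_derivative (D (Y p)) (at p) (X p) + sphere_differential Z p (sphere_differential Y p (X p)) +
    (Y p \<bullet> Z p) *\<^sub>R X p + (sphere_differential (\<lambda>q. Y q \<bullet> Z q) p (X p) + X p \<bullet> sphere_differential Z p (Y p)) *\<^sub>R p"
proof -
  let ?dY = "frechet_derivative (radial_ext Y) (at p)" and ?DD = "\<lambda>w. frechet_derivative (D w) (at p)"
  have p0: "p \<noteq> 0" using p by auto
  have pX: "p \<bullet> X p = 0" by (rule vector_field_tangent[OF X p])
  have Dlin: "linear (\<lambda>w. D w x)" if "x \<noteq> 0" for x
    unfolding D_def using has_derivative_linear[OF radial_ext_has_derivative[OF Z that]] .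
  \<comment> \<open>The direction \<open>radial_ext Y x\<close> in which \<open>Z\<close> is
    differentiated varies with \<open>x\<close>. Expanding it in the basis leaves fixed directions
    with varying coefficients, to which the product rule applies.\<close>
  have Dsum: "D w x = (\<Sum>b\<in>Basis. (w \<bullet> b) *\<^sub>R D b x)" if "x \<noteq> 0" for w x
    using linear_sum[OF Dlin[OF that], of "\<lambda>b. (w \<bullet> b) *\<^sub>R b" Basis]
    by (simp add: linear_cmul[OF Dlin[OF that]] euclidean_representation)
  have DD: "(D w has_derivative ?DD w) (at p)" for w
  proof -
    have "Ck_on (Suc 0) (- {0}) (D w)"
      using vector_field_Ck[OF Z, of "Suc (Suc 0)"] by (simp add: D_def)
    then show ?thesis by (rule Ck_on_has_derivative) (use p0 in simp)
  qed
  have DDsum: "?DD w v = (\<Sum>b\<in>Basis. (w \<bullet> b) *\<^sub>R ?DD b v)" for w v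
  proof -
    have "((\<lambda>x. \<Sum>b\<in>Basis. (w \<bullet> b) *\<^sub>R D b x) has_derivative (\<lambda>v. \<Sum>b\<in>Basis. (w \<bullet> b) *\<^sub>R ?DD b v)) (at p)"
      by (intro has_derivative_sum has_derivative_scaleR_right DD)
    then have "(D w has_derivative (\<lambda>v. \<Sum>b\<in>Basis. (w \<bullet> b) *\<^sub>R ?DD b v)) (at p)"
      by (rule has_derivative_transform_within_open[OF _ open_punctured]) (use p0 Dsum in auto)
    from frechet_derivative_at[OF this] show ?thesis by (simp add: fun_eq_iff)
  qed
  have dY: "(radial_ext Y has_derivative ?dY) (at p)" and dZ: "(radial_ext Z has_derivative (\<lambda>w. D w p)) (at p)"
    using radial_ext_has_derivative[OF Y p0] radial_ext_has_derivative[OF Z p0] by (simp_all add: D_def)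
  \<comment> \<open>\<open>h\<close> agrees with \<open>nabla Y Z\<close> on the sphere and is
    differentiable at \<open>p\<close>, as \<open>sphere_differential_eq\<close> demands.\<close>
  define h where "h x = D (radial_ext Y x) x + (radial_ext Y x \<bullet> radial_ext Z x) *\<^sub>R x" for x
  have "((\<lambda>x. \<Sum>b\<in>Basis. (radial_ext Y x \<bullet> b) *\<^sub>R D b x) has_derivative
      (\<lambda>v. \<Sum>b\<in>Basis. (radial_ext Y p \<bullet> b) *\<^sub>R ?DD b v + (?dY v \<bullet> b) *\<^sub>R D b p)) (at p)"
    by (intro has_derivative_sum has_derivative_scaleR has_derivative_inner_left dY DD)
  also have "(\<lambda>v. \<Sum>b\<in>Basis. (radial_ext Y p \<bullet> b) *\<^sub>R ?DD b v + (?dY v \<bullet> b) *\<^sub>R D b p) =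
      (\<lambda>v. ?DD (Y p) v + D (?dY v) p)"
    by (rule ext) (simp add: sum.distrib DDsum[of "Y p"] Dsum[OF p0, of "?dY v" for v] radial_ext_sphere[OF p])
  finally have "((\<lambda>x. D (radial_ext Y x) x) has_derivative (\<lambda>v. ?DD (Y p) v + D (?dY v) p)) (at p)"
    by (rule has_derivative_transform_within_open[OF _ open_punctured]) (use p0 Dsum in auto)
  moreover have "((\<lambda>x. (radial_ext Y x \<bullet> radial_ext Z x) *\<^sub>R x) has_derivative
      (\<lambda>v. (radial_ext Y p \<bullet> radial_ext Z p) *\<^sub>R v + (radial_ext Y p \<bullet> D v p + ?dY v \<bullet> radial_ext Z p) *\<^sub>R p)) (at p)"
    by (intro has_derivative_scaleR bounded_bilinear.FDERIV[OF bounded_bilinear_inner] dY dZ has_derivative_ident)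
  ultimately have h: "(h has_derivative (\<lambda>v. (?DD (Y p) v + D (?dY v) p) +
      ((radial_ext Y p \<bullet> radial_ext Z p) *\<^sub>R v + (radial_ext Y p \<bullet> D v p + ?dY v \<bullet> radial_ext Z p) *\<^sub>R p))) (at p)"
    unfolding h_def[abs_def] by (rule has_derivative_add)
  have "sphere_differential (nabla Y Z) p (X p) = (?DD (Y p) (X p) + D (?dY (X p)) p) +
      ((radial_ext Y p \<bullet> radial_ext Z p) *\<^sub>R X p + (radial_ext Y p \<bullet> D (X p) p + ?dY (X p) \<bullet> radial_ext Z p) *\<^sub>R p)"
  proof (rule sphere_differential_eq[OF p pX _ h])
    show "nabla Y Z q = h q" if "q \<in> sphere 0 1" for q
      using levi_civita_eq[OF nabla Y Z that]
      by (simp add: h_def D_def sphere_differential_def radial_ext_sphere[OF that])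
  qed
  moreover have "X p \<bullet> nabla Y Z p = X p \<bullet> D (Y p) p"
    using levi_civita_eq[OF nabla Y Z p] pX
    by (simp add: inner_add_right inner_commute D_def sphere_differential_def)
  ultimately show ?thesis
    unfolding levi_civita_eq[OF nabla X nabla_vector_fields[OF Y Z] p] sphere_differential_inner[OF Y Z p]
    by (simp add: radial_ext_sphere[OF p] sphere_differential_def D_def algebra_simps)
qed

text \<open>In the commutator the second derivatives of \<open>Z\<close> cancel by symmetry; the
  term with the Lie bracket removes the first derivatives of \<open>Z\<close> along derivatives of
  \<open>X\<close> and \<open>Y\<close>, together with the remaining normal part. What is left is
  algebraic: constant curvature 1.\<close>

lemma curvature_field_eq:
  fixes X Y Z :: "'a \<Rightarrow> 'a"
  assumes X: "X \<in> vector_fields" and Y: "Y \<in> vector_fields" and Z: "Z \<in> vector_fields"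
    and p: "p \<in> sphere 0 1"
  shows "curvature_field nabla X Y Z p = (Y p \<bullet> Z p) *\<^sub>R X p - (X p \<bullet> Z p) *\<^sub>R Y p"
proof -
  define D where "D = (\<lambda>w x. frechet_derivative (radial_ext Z) (at x) w)"
  let ?dX = "sphere_differential X p" and ?dY = "sphere_differential Y p" and ?dZ = "sphere_differential Z p"
  have p0: "p \<noteq> 0" using p by auto
  have Ck: "Ck_on (Suc 0) (- {0}) (D w)" for w
    using vector_field_Ck[OF Z, of "Suc (Suc 0)"] by (simp add: D_def)
  have sym: "frechet_derivative (D v) (at p) w = frechet_derivative (D w) (at p) v" for v w
  proof (rule euclidean_eqI)
    fix b :: 'a
    show "frechet_derivative (D v) (at p) w \<bullet> b = frechet_derivative (D w) (at p) v \<bullet> b"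
    proof (rule second_derivative_symmetric[of "- {0}" p "\<lambda>x. radial_ext Z x \<bullet> b" "\<lambda>x v. D v x \<bullet> b"
          "\<lambda>v x w. frechet_derivative (D v) (at x) w \<bullet> b"])
      fix x v w :: 'a
      show "continuous_on (- {0}) (\<lambda>x. frechet_derivative (D v) (at x) w \<bullet> b)"
        using Ck[of v] by (intro continuous_intros) simp
      assume x: "x \<in> - {0}"
      show "((\<lambda>x. radial_ext Z x \<bullet> b) has_derivative (\<lambda>v. D v x \<bullet> b)) (at x)"
        using radial_ext_has_derivative[OF Z, of x] x by (intro has_derivative_inner_left) (simp add: D_def)
      show "((\<lambda>x. D v x \<bullet> b) has_derivative (\<lambda>w. frechet_derivative (D v) (at x) w \<bullet> b)) (at x)"
        by (rule has_derivative_inner_left[OF Ck_on_has_derivative[OF Ck x]])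
    qed (use p0 in \<open>auto simp: open_punctured\<close>)
  qed
  have lin: "linear ?dZ"
    unfolding sphere_differential_def using has_derivative_linear[OF radial_ext_has_derivative[OF Z p0]] .
  have bracket: "nabla (lie_bracket X Y) Z p =
      ?dZ (?dY (X p)) - ?dZ (?dX (Y p)) + ((?dY (X p) - ?dX (Y p)) \<bullet> Z p) *\<^sub>R p"
    unfolding levi_civita_eq[OF nabla lie_bracket_vector_fields[OF X Y] Z p]
    by (simp add: lie_bracket_def linear_diff[OF lin])
  show ?thesis
    unfolding curvature_field_def bracket nabla_nabla_eq[OF X Y Z p] nabla_nabla_eq[OF Y X Z p]
      sphere_differential_inner[OF Y Z p] sphere_differential_inner[OF X Z p]
    using sym[of "Y p" "X p"] unfolding D_def
    by (simp add: algebra_simps inner_commute)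
qed

text \<open>The fields \<open>tangent_field u\<close>, \<open>tangent_field v\<close>,
  \<open>tangent_field w\<close> have the prescribed values at \<open>p\<close>, so the condition
  under \<open>THE\<close> is not vacuous and determines \<open>r\<close>.\<close>

lemma curvature_eq:
  fixes p u v w :: 'a
  assumes p: "p \<in> sphere 0 1" and tan: "p \<bullet> u = 0" "p \<bullet> v = 0" "p \<bullet> w = 0"
  shows "curvature nabla p u v w = (v \<bullet> w) *\<^sub>R u - (u \<bullet> w) *\<^sub>R v"
  unfolding curvature_def
proof (rule the_equality)
  show "\<forall>X\<in>vector_fields. \<forall>Y\<in>vector_fields. \<forall>Z\<in>vector_fields. X p = u \<and> Y p = v \<and> Z p = w \<longrightarrow>
      curvature_field nabla X Y Z p = (v \<bullet> w) *\<^sub>R u - (u \<bullet> w) *\<^sub>R v"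
    using curvature_field_eq[OF _ _ _ p] by blast
  fix r
  assume "\<forall>X\<in>vector_fields. \<forall>Y\<in>vector_fields. \<forall>Z\<in>vector_fields. X p = u \<and> Y p = v \<and> Z p = w \<longrightarrow>
      curvature_field nabla X Y Z p = r"
  then have "curvature_field nabla (tangent_field u) (tangent_field v) (tangent_field w) p = r"
    using tangent_field_in_vector_fields tangent_field_eq tan by blast
  then show "r = (v \<bullet> w) *\<^sub>R u - (u \<bullet> w) *\<^sub>R v"
    using curvature_field_eq[OF tangent_field_in_vector_fields tangent_field_in_vector_fields
        tangent_field_in_vector_fields p, of u v w] tan by (simp add: tangent_field_eq)
qed

end

section \<open>Covariant derivatives along curves\<close>

lemma nth_deriv_on_0 [simp]: "nth_deriv_on I 0 f = f"
  by (simp add: nth_deriv_on_def)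

lemma nth_deriv_on_Suc: "nth_deriv_on I (Suc k) f t = vector_derivative (nth_deriv_on I k f) (at t within I)"
  by (simp add: nth_deriv_on_def)

lemma nth_deriv_on_has_vector_derivative:
  assumes "smooth_on_interval I f" "t \<in> I"
  shows "(nth_deriv_on I k f has_vector_derivative nth_deriv_on I (Suc k) f t) (at t within I)"
  using assms vector_derivative_works unfolding nth_deriv_on_Suc smooth_on_interval_def by blast

context
  fixes I :: "real set"
  assumes I: "\<And>t. t \<in> I \<Longrightarrow> at t within I \<noteq> bot"
begin

lemma nth_deriv_on_eq:
  assumes F: "\<And>k t. t \<in> I \<Longrightarrow> (F k has_vector_derivative F (Suc k) t) (at t within I)"
    and f: "\<And>t. t \<in> I \<Longrightarrow> f t = F 0 t" and t: "t \<in> I"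
  shows "nth_deriv_on I k f t = F k t"
  using t
proof (induction k arbitrary: t)
  case 0
  then show ?case by (simp add: f)
next
  case (Suc k)
  have "(nth_deriv_on I k f has_vector_derivative F (Suc k) t) (at t within I)"
    by (rule has_vector_derivative_transform[OF Suc.prems _ F[OF Suc.prems]]) (use Suc.IH in auto)
  then show ?case
    unfolding nth_deriv_on_Suc using vector_derivative_within[OF I[OF Suc.prems]] by blast
qed

lemma smooth_on_intervalI:
  assumes F: "\<And>k t. t \<in> I \<Longrightarrow> (F k has_vector_derivative F (Suc k) t) (at t within I)"
    and f: "\<And>t. t \<in> I \<Longrightarrow> f t = F 0 t"
  shows "smooth_on_interval I f"
  unfolding smooth_on_interval_def
proof (intro allI ballI)
  fix k t assume t: "t \<in> I"
  have "(nth_deriv_on I k f has_vector_derivative F (Suc k) t) (at t within I)"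
    by (rule has_vector_derivative_transform[OF t _ F[OF t]]) (use nth_deriv_on_eq[OF F f] in auto)
  then show "nth_deriv_on I k f differentiable at t within I"
    by (rule differentiableI_vector)
qed

lemma smooth_on_interval_const: "smooth_on_interval I (\<lambda>_. c)"
  by (rule smooth_on_intervalI[of "\<lambda>k _. if k = 0 then c else 0"]) auto

lemma smooth_on_interval_add:
  assumes "smooth_on_interval I f" "smooth_on_interval I g"
  shows "smooth_on_interval I (\<lambda>t. f t + g t)"
  by (rule smooth_on_intervalI[of "\<lambda>k t. nth_deriv_on I k f t + nth_deriv_on I k g t"])
     (auto intro!: has_vector_derivative_add nth_deriv_on_has_vector_derivative assms)

lemma smooth_on_interval_bilinear:
  assumes b: "bounded_bilinear b" and "smooth_on_interval I f" "smooth_on_interval I g"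
  shows "smooth_on_interval I (\<lambda>t. b (f t) (g t))"
proof (rule smooth_on_intervalI[of "\<lambda>k t. leibniz_sum (\<lambda>i j. b (nth_deriv_on I i f t) (nth_deriv_on I j g t)) k"])
  fix k t assume t: "t \<in> I"
  show "((\<lambda>t. leibniz_sum (\<lambda>i j. b (nth_deriv_on I i f t) (nth_deriv_on I j g t)) k) has_vector_derivative
      leibniz_sum (\<lambda>i j. b (nth_deriv_on I i f t) (nth_deriv_on I j g t)) (Suc k)) (at t within I)"
  proof (rule leibniz_sum_has_vector_derivative)
    fix i j
    show "((\<lambda>t. b (nth_deriv_on I i f t) (nth_deriv_on I j g t)) has_vector_derivative
       b (nth_deriv_on I (Suc i) f t) (nth_deriv_on I j g t) + b (nth_deriv_on I i f t) (nth_deriv_on I (Suc j) g t))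
       (at t within I)"
      using bounded_bilinear.has_vector_derivative[OF b
          nth_deriv_on_has_vector_derivative[OF assms(2) t, of i] nth_deriv_on_has_vector_derivative[OF assms(3) t, of j]]
      by (simp add: add.commute)
  qed
qed simp

lemma smooth_on_interval_deriv:
  assumes "smooth_on_interval I f"
  shows "smooth_on_interval I (nth_deriv_on I 1 f)"
  by (rule smooth_on_intervalI[of "\<lambda>k. nth_deriv_on I (Suc k) f"])
     (auto intro!: nth_deriv_on_has_vector_derivative assms)

lemma smooth_on_interval_cong:
  assumes "smooth_on_interval I f" "\<And>t. t \<in> I \<Longrightarrow> f t = g t"
  shows "smooth_on_interval I g"
  by (rule smooth_on_intervalI[of "\<lambda>k. nth_deriv_on I k f"])
     (use assms in \<open>auto intro!: nth_deriv_on_has_vector_derivative\<close>)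

lemma nth_deriv_on_1_eq:
  assumes "(f has_vector_derivative D) (at t within I)" "t \<in> I"
  shows "nth_deriv_on I 1 f t = D"
  using vector_derivative_within[OF I[OF assms(2)] assms(1)] by (simp add: nth_deriv_on_Suc)

end

text \<open>For \<open>V\<close> tangent along the curve, differentiating \<gamma>.V = 0 gives
  \<gamma>.V' = -V.\<gamma>'. The second summand therefore cancels the normal part of V', and this
  is the tangential projection of the ambient derivative.\<close>

definition covD :: "real set \<Rightarrow> (real \<Rightarrow> 'a::euclidean_space) \<Rightarrow> (real \<Rightarrow> 'a) \<Rightarrow> real \<Rightarrow> 'a" where
  "covD I \<gamma> V t = nth_deriv_on I 1 V t + (V t \<bullet> nth_deriv_on I 1 \<gamma> t) *\<^sub>R \<gamma> t"

text \<open>These are the fields \<open>T\<^sub>k\<close> of the overview; counting starts at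
  \<gamma>', so the tension field has index 1.\<close>

definition cov_deriv :: "real set \<Rightarrow> (real \<Rightarrow> 'a::euclidean_space) \<Rightarrow> nat \<Rightarrow> real \<Rightarrow> 'a" where
  "cov_deriv I \<gamma> k = (covD I \<gamma> ^^ k) (nth_deriv_on I 1 \<gamma>)"

lemma cov_deriv_0: "cov_deriv I \<gamma> 0 = nth_deriv_on I 1 \<gamma>"
  and cov_deriv_Suc: "cov_deriv I \<gamma> (Suc k) = covD I \<gamma> (cov_deriv I \<gamma> k)"
  by (simp_all add: cov_deriv_def)

section \<open>The covariant derivative along a curve and the 4-tension\<close>

context
  fixes nabla :: "('a::euclidean_space \<Rightarrow> 'a) \<Rightarrow> ('a \<Rightarrow> 'a) \<Rightarrow> 'a \<Rightarrow> 'a"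
    and I :: "real set" and \<gamma> :: "real \<Rightarrow> 'a"
  assumes nabla: "levi_civita_connection nabla"
    and I: "\<And>t. t \<in> I \<Longrightarrow> at t within I \<noteq> bot"
    and smooth: "smooth_on_interval I \<gamma>"
    and sphere: "\<And>t. t \<in> I \<Longrightarrow> \<gamma> t \<in> sphere 0 1"
begin

lemma curve_deriv:
  assumes "t \<in> I"
  shows "(\<gamma> has_vector_derivative nth_deriv_on I 1 \<gamma> t) (at t within I)"
  using nth_deriv_on_has_vector_derivative[OF smooth assms, of 0] by simp

lemma smooth_deriv:
  assumes "smooth_on_interval I V" "t \<in> I"
  shows "(V has_vector_derivative nth_deriv_on I 1 V t) (at t within I)"
  using nth_deriv_on_has_vector_derivative[OF assms, of 0] by simp

lemma deriv_const_inner: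
  fixes V W :: "real \<Rightarrow> 'a"
  assumes "smooth_on_interval I V" "smooth_on_interval I W" "\<And>t. t \<in> I \<Longrightarrow> V t \<bullet> W t = c" "t \<in> I"
  shows "V t \<bullet> nth_deriv_on I 1 W t + nth_deriv_on I 1 V t \<bullet> W t = 0"
proof -
  have "((\<lambda>t. V t \<bullet> W t) has_vector_derivative V t \<bullet> nth_deriv_on I 1 W t + nth_deriv_on I 1 V t \<bullet> W t) (at t within I)"
    by (rule bounded_bilinear.has_vector_derivative[OF bounded_bilinear_inner smooth_deriv[OF assms(1,4)] smooth_deriv[OF assms(2,4)]])
  moreover have "((\<lambda>t. V t \<bullet> W t) has_vector_derivative 0) (at t within I)"
    by (rule has_vector_derivative_transform[OF assms(4), of _ "\<lambda>_. c"]) (use assms in auto)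
  ultimately show ?thesis
    using vector_derivative_unique_within[OF I[OF assms(4)]] by blast
qed

lemma inner_curve_deriv:
  assumes "t \<in> I"
  shows "\<gamma> t \<bullet> nth_deriv_on I 1 \<gamma> t = 0"
  using deriv_const_inner[OF smooth smooth _ assms, of 1] sphere by (simp add: norm_eq_1 inner_commute)

lemma vector_fields_along_add:
  assumes "V \<in> vector_fields_along I \<gamma>" "W \<in> vector_fields_along I \<gamma>"
  shows "(\<lambda>s. V s + W s) \<in> vector_fields_along I \<gamma>"
  using assms smooth_on_interval_add[OF I, of V W]
  by (simp add: vector_fields_along_def inner_add_right)

lemma covD_field:
  assumes V: "V \<in> vector_fields_along I \<gamma>"
  shows "covD I \<gamma> V \<in> vector_fields_along I \<gamma>"
proof -
  have sV: "smooth_on_interval I V" and tV: "\<And>t. t \<in> I \<Longrightarrow> \<gamma> t \<bullet> V t = 0"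
    using V by (auto simp: vector_fields_along_def)
  have "smooth_on_interval I (covD I \<gamma> V)"
    unfolding covD_def[abs_def]
    by (intro smooth_on_interval_add[OF I] smooth_on_interval_deriv[OF I] sV smooth
        smooth_on_interval_bilinear[OF I bounded_bilinear_scaleR]
        smooth_on_interval_bilinear[OF I bounded_bilinear_inner])
  moreover have "\<gamma> t \<bullet> covD I \<gamma> V t = 0" if "t \<in> I" for t
    using deriv_const_inner[OF smooth sV tV that] sphere[OF that]
    by (simp add: covD_def inner_add_right norm_eq_1 inner_commute)
  ultimately show ?thesis by (simp add: vector_fields_along_def)
qed

lemma restriction_deriv:
  assumes Y: "Y \<in> vector_fields" and t: "t \<in> I"
  shows "nth_deriv_on I 1 (\<lambda>s. Y (\<gamma> s)) t = sphere_differential Y (\<gamma> t) (nth_deriv_on I 1 \<gamma> t)"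
proof (rule nth_deriv_on_1_eq[OF I _ t])
  have "((radial_ext Y \<circ> \<gamma>) has_derivative
      (frechet_derivative (radial_ext Y) (at (\<gamma> t)) \<circ> (\<lambda>h. h *\<^sub>R nth_deriv_on I 1 \<gamma> t))) (at t within I)"
    by (rule diff_chain_within[OF curve_deriv[OF t, unfolded has_vector_derivative_def]
        has_derivative_at_withinI[OF radial_ext_has_derivative[OF Y sphere_nonzero[OF sphere[OF t]]]]])
  moreover have "(frechet_derivative (radial_ext Y) (at (\<gamma> t)) \<circ> (\<lambda>h. h *\<^sub>R nth_deriv_on I 1 \<gamma> t)) =
      (\<lambda>h. h *\<^sub>R sphere_differential Y (\<gamma> t) (nth_deriv_on I 1 \<gamma> t))"
    using has_derivative_linear[OF radial_ext_has_derivative[OF Y sphere_nonzero[OF sphere[OF t]]]]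
    by (auto simp: sphere_differential_def linear_cmul)
  ultimately have "((radial_ext Y \<circ> \<gamma>) has_vector_derivative
      sphere_differential Y (\<gamma> t) (nth_deriv_on I 1 \<gamma> t)) (at t within I)"
    by (simp add: has_vector_derivative_def)
  then show "((\<lambda>s. Y (\<gamma> s)) has_vector_derivative
      sphere_differential Y (\<gamma> t) (nth_deriv_on I 1 \<gamma> t)) (at t within I)"
    by (rule has_vector_derivative_transform[OF t, rotated]) (simp add: radial_ext_sphere[OF sphere])
qed

lemma induced_covD: "induced_covariant_derivative nabla I \<gamma> (covD I \<gamma>)"
  unfolding induced_covariant_derivative_def
proof (intro conjI ballI allI impI)
  show "covD I \<gamma> V \<in> vector_fields_along I \<gamma>" if "V \<in> vector_fields_along I \<gamma>" for V
    by (rule covD_field[OF that])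
  show "covD I \<gamma> (\<lambda>s. V s + W s) t = covD I \<gamma> V t + covD I \<gamma> W t"
    if "V \<in> vector_fields_along I \<gamma>" "W \<in> vector_fields_along I \<gamma>" "t \<in> I" for V W t
  proof -
    have "nth_deriv_on I 1 (\<lambda>s. V s + W s) t = nth_deriv_on I 1 V t + nth_deriv_on I 1 W t"
      by (rule nth_deriv_on_1_eq[OF I has_vector_derivative_add[OF smooth_deriv smooth_deriv]])
         (use that in \<open>auto simp: vector_fields_along_def\<close>)
    then show ?thesis by (simp add: covD_def inner_add_left scaleR_add_left)
  qed
  show "covD I \<gamma> (\<lambda>s. f s *\<^sub>R V s) t = nth_deriv_on I 1 f t *\<^sub>R V t + f t *\<^sub>R covD I \<gamma> V t"
    if "V \<in> vector_fields_along I \<gamma>" "smooth_on_interval I f" "t \<in> I" for V f t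
  proof -
    have "nth_deriv_on I 1 (\<lambda>s. f s *\<^sub>R V s) t = f t *\<^sub>R nth_deriv_on I 1 V t + nth_deriv_on I 1 f t *\<^sub>R V t"
      by (rule nth_deriv_on_1_eq[OF I bounded_bilinear.has_vector_derivative[OF bounded_bilinear_scaleR smooth_deriv smooth_deriv]])
         (use that in \<open>auto simp: vector_fields_along_def\<close>)
    then show ?thesis by (simp add: covD_def scaleR_add_right)
  qed
  show "covD I \<gamma> (\<lambda>s. Y (\<gamma> s)) t = nabla X Y (\<gamma> t)"
    if "X \<in> vector_fields" "Y \<in> vector_fields" "t \<in> I" "X (\<gamma> t) = nth_deriv_on I 1 \<gamma> t" for X Y t
    unfolding levi_civita_eq[OF nabla that(1,2) sphere[OF that(3)]] covD_def
      restriction_deriv[OF that(2,3)] that(4) by (simp add: inner_commute)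
qed

text \<open>The right-hand side does not contain \<open>D\<close>, so the axioms leave no freedom on
  \<open>I\<close>. The projected basis vectors along the curve span the tangent spaces without
  being a frame; on them \<open>D\<close> is dictated by \<open>nabla\<close>, and the Leibniz rule
  does the rest.\<close>

lemma induced_covariant_derivative_eq:
  assumes D: "induced_covariant_derivative nabla I \<gamma> D"
    and V: "V \<in> vector_fields_along I \<gamma>" and t: "t \<in> I"
  shows "D V t = (\<Sum>b\<in>Basis. nth_deriv_on I 1 (\<lambda>s. V s \<bullet> b) t *\<^sub>R tangent_field b (\<gamma> t) +
    (V t \<bullet> b) *\<^sub>R nabla (tangent_field (nth_deriv_on I 1 \<gamma> t)) (tangent_field b) (\<gamma> t))"
proof -
  let ?VF = "vector_fields_along I \<gamma>"
  note D' = D[unfolded induced_covariant_derivative_def]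
  have add: "D (\<lambda>s. V s + W s) t = D V t + D W t" if "V \<in> ?VF" "W \<in> ?VF" for V W
    using D' that t by blast
  have scale: "D (\<lambda>s. f s *\<^sub>R V s) t = nth_deriv_on I 1 f t *\<^sub>R V t + f t *\<^sub>R D V t"
    if "V \<in> ?VF" "smooth_on_interval I f" for V and f :: "real \<Rightarrow> real"
    using D' that t by blast
  have sV: "smooth_on_interval I V" and tV: "\<And>t. t \<in> I \<Longrightarrow> \<gamma> t \<bullet> V t = 0"
    using V by (auto simp: vector_fields_along_def)
  define E where "E b s = tangent_field b (\<gamma> s)" for b s
  define f where "f b s = V s \<bullet> b" for b s
  have E: "E b \<in> ?VF" for b
  proof -
    have "smooth_on_interval I (\<lambda>s. b + (-1) *\<^sub>R ((b \<bullet> \<gamma> s) *\<^sub>R \<gamma> s))"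
      by (intro smooth_on_interval_add[OF I] smooth_on_interval_const[OF I] smooth
          smooth_on_interval_bilinear[OF I bounded_bilinear_scaleR]
          smooth_on_interval_bilinear[OF I bounded_bilinear_inner])
    then have "smooth_on_interval I (E b)" by (simp add: E_def[abs_def] tangent_field_def)
    then show ?thesis
      using sphere by (auto simp: vector_fields_along_def E_def tangent_field_def inner_diff_right inner_commute norm_eq_1)
  qed
  have f: "smooth_on_interval I (f b)" for b
    unfolding f_def by (intro smooth_on_interval_bilinear[OF I bounded_bilinear_inner] sV smooth_on_interval_const[OF I])
  have scaled: "(\<lambda>s. g s *\<^sub>R W s) \<in> ?VF" if "W \<in> ?VF" "smooth_on_interval I g" for W and g :: "real \<Rightarrow> real"
    using that by (auto simp: vector_fields_along_def intro!: smooth_on_interval_bilinear[OF I bounded_bilinear_scaleR])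
  have zero: "D Z t = 0" if "Z \<in> ?VF" "\<And>s. s \<in> I \<Longrightarrow> Z s = 0" for Z
  proof -
    \<comment> \<open>Locality. \<open>g\<close> is 1 off \<open>I\<close>, where smoothness asks
      nothing, and \<open>Z\<close> is 0 on \<open>I\<close>, so \<open>g\<close> times
      \<open>Z\<close> and \<open>Z\<close> are the same function; the Leibniz rule at
      \<open>t\<close>, where \<open>g\<close> and \<open>Z\<close> vanish, then gives
      \<open>D Z t = 0\<close>.\<close>
    define g :: "real \<Rightarrow> real" where "g s = (if s \<in> I then 0 else 1)" for s
    have g: "smooth_on_interval I g"
      by (rule smooth_on_interval_cong[OF I smooth_on_interval_const[OF I, of 0]]) (simp_all add: g_def)
    have "(\<lambda>s. g s *\<^sub>R Z s) = Z" using that(2) by (auto simp: g_def)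
    then show ?thesis using scale[OF that(1) g] that(2)[OF t] t by (simp add: g_def)
  qed
  have cong: "D W t = D W' t" if "W \<in> ?VF" "W' \<in> ?VF" "\<And>s. s \<in> I \<Longrightarrow> W s = W' s" for W W'
  proof -
    have m: "(\<lambda>s. (-1) *\<^sub>R W' s) \<in> ?VF" by (intro scaled that(2) smooth_on_interval_const[OF I])
    have "(\<lambda>s. W s + (-1) *\<^sub>R W' s) \<in> ?VF"
      by (rule vector_fields_along_add[OF that(1) m])
    then have "D (\<lambda>s. W s + (-1) *\<^sub>R W' s) t = 0"
      by (rule zero) (use that(3) in simp)
    moreover have "D (\<lambda>s. (-1) *\<^sub>R W' s) t = - D W' t"
      using scale[OF that(2) smooth_on_interval_const[OF I, of "-1"]]
        nth_deriv_on_1_eq[OF I has_vector_derivative_const t, of "-1 :: real"] by simp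
    ultimately show ?thesis using add[OF that(1) m] by simp
  qed
  have sum: "(\<lambda>s. \<Sum>b\<in>A. f b s *\<^sub>R E b s) \<in> ?VF \<and>
      D (\<lambda>s. \<Sum>b\<in>A. f b s *\<^sub>R E b s) t = (\<Sum>b\<in>A. D (\<lambda>s. f b s *\<^sub>R E b s) t)" if "finite A" for A
    using that
  proof (induction A)
    case empty
    have "(\<lambda>_. 0) \<in> ?VF" by (simp add: vector_fields_along_def smooth_on_interval_const[OF I])
    then show ?case using zero by simp
  next
    case (insert a A)
    have a: "(\<lambda>s. f a s *\<^sub>R E a s) \<in> ?VF" by (rule scaled[OF E f])
    have "(\<lambda>s. f a s *\<^sub>R E a s + (\<Sum>b\<in>A. f b s *\<^sub>R E b s)) \<in> ?VF"
      using a insert.IH by (intro vector_fields_along_add) auto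
    then show ?case using add[OF a conjunct1[OF insert.IH]] insert by simp
  qed
  \<comment> \<open>The sum equals V - (V.\<gamma>) \<gamma>, and tangency removes the second
    term.\<close>
  have Vsum: "V s = (\<Sum>b\<in>Basis. f b s *\<^sub>R E b s)" if "s \<in> I" for s
  proof -
    have "(\<Sum>b\<in>Basis. f b s *\<^sub>R E b s) = (\<Sum>b\<in>Basis. (V s \<bullet> b) *\<^sub>R b) - (\<Sum>b\<in>Basis. (V s \<bullet> b) * (\<gamma> s \<bullet> b)) *\<^sub>R \<gamma> s"
      by (simp add: f_def E_def tangent_field_def scaleR_diff_right sum_subtractf scaleR_sum_left inner_commute)
    then show ?thesis
      using tV[OF that] by (simp add: euclidean_representation flip: euclidean_inner) (simp add: inner_commute)
  qed
  let ?u = "nth_deriv_on I 1 \<gamma> t"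
  have u: "\<gamma> t \<bullet> ?u = 0" by (rule inner_curve_deriv[OF t])
  have DE: "D (E b) t = nabla (tangent_field ?u) (tangent_field b) (\<gamma> t)" for b
    unfolding E_def[abs_def]
    using D' tangent_field_in_vector_fields tangent_field_eq[OF u] t by blast
  have "D V t = D (\<lambda>s. \<Sum>b\<in>Basis. f b s *\<^sub>R E b s) t"
    by (rule cong[OF V conjunct1[OF sum[OF finite_Basis]] Vsum])
  also have "\<dots> = (\<Sum>b\<in>Basis. D (\<lambda>s. f b s *\<^sub>R E b s) t)"
    by (rule conjunct2[OF sum[OF finite_Basis]])
  also have "\<dots> = (\<Sum>b\<in>Basis. nth_deriv_on I 1 (f b) t *\<^sub>R E b t + f b t *\<^sub>R D (E b) t)"
    by (simp only: scale[OF E f])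
  finally show ?thesis unfolding DE by (simp add: E_def f_def[abs_def])
qed

text \<open>\<open>covD\<close> witnesses that the choice made by \<open>SOME\<close> is of an
  existing operator; the uniqueness above then identifies the two on \<open>I\<close>.\<close>

lemma induced_covariant_derivative_covariant_derivative:
  "induced_covariant_derivative nabla I \<gamma> (covariant_derivative nabla I \<gamma>)"
  unfolding covariant_derivative_def by (rule someI[of _ "covD I \<gamma>"]) (rule induced_covD)

lemma covariant_derivative_eq:
  assumes "V \<in> vector_fields_along I \<gamma>" "t \<in> I"
  shows "covariant_derivative nabla I \<gamma> V t = covD I \<gamma> V t"
  unfolding induced_covariant_derivative_eq[OF induced_covariant_derivative_covariant_derivative assms]
    induced_covariant_derivative_eq[OF induced_covD assms] ..

lemma covariant_derivative_field:
  assumes "V \<in> vector_fields_along I \<gamma>"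
  shows "covariant_derivative nabla I \<gamma> V \<in> vector_fields_along I \<gamma>"
  using induced_covariant_derivative_covariant_derivative assms
  unfolding induced_covariant_derivative_def by blast

lemma covD_cong:
  assumes "\<And>s. s \<in> I \<Longrightarrow> V s = W s" "W \<in> vector_fields_along I \<gamma>" "t \<in> I"
  shows "covD I \<gamma> V t = covD I \<gamma> W t"
proof -
  have "nth_deriv_on I 1 V t = nth_deriv_on I 1 W t"
    by (rule nth_deriv_on_1_eq[OF I has_vector_derivative_transform[OF assms(3) assms(1) smooth_deriv]])
       (use assms in \<open>auto simp: vector_fields_along_def\<close>)
  then show ?thesis by (simp add: covD_def assms)
qed

lemma covD_minus:
  assumes "W \<in> vector_fields_along I \<gamma>" "t \<in> I"
  shows "covD I \<gamma> (\<lambda>s. - W s) t = - covD I \<gamma> W t"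
proof -
  have "nth_deriv_on I 1 (\<lambda>s. - W s) t = - nth_deriv_on I 1 W t"
    by (rule nth_deriv_on_1_eq[OF I has_vector_derivative_minus[OF smooth_deriv]])
       (use assms in \<open>auto simp: vector_fields_along_def\<close>)
  then show ?thesis by (simp add: covD_def)
qed

lemma cov_deriv_field: "cov_deriv I \<gamma> k \<in> vector_fields_along I \<gamma>"
proof (induction k)
  case 0
  have "nth_deriv_on I 1 \<gamma> \<in> vector_fields_along I \<gamma>"
    using smooth_on_interval_deriv[OF I smooth] inner_curve_deriv
    by (auto simp: vector_fields_along_def)
  then show ?case by (simp add: cov_deriv_0)
next
  case (Suc k)
  then show ?case unfolding cov_deriv_Suc by (rule covD_field)
qed

lemma cov_deriv_has_vector_derivative:
  assumes t: "t \<in> I"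
  shows "(cov_deriv I \<gamma> k has_vector_derivative
    cov_deriv I \<gamma> (Suc k) t - (cov_deriv I \<gamma> k t \<bullet> cov_deriv I \<gamma> 0 t) *\<^sub>R \<gamma> t) (at t within I)"
proof -
  have "smooth_on_interval I (cov_deriv I \<gamma> k)"
    using cov_deriv_field[of k] by (simp add: vector_fields_along_def)
  from nth_deriv_on_has_vector_derivative[OF this t, of 0] show ?thesis
    unfolding cov_deriv_Suc by (simp add: covD_def cov_deriv_0)
qed

lemma tension_eq: "tension nabla I \<gamma> \<in> vector_fields_along I \<gamma>"
  "t \<in> I \<Longrightarrow> tension nabla I \<gamma> t = cov_deriv I \<gamma> 1 t"
  using covariant_derivative_field[OF cov_deriv_field[of 0]]
    covariant_derivative_eq[OF cov_deriv_field[of 0]] cov_deriv_Suc[of I \<gamma> 0]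
  by (simp_all add: tension_def cov_deriv_0)

text \<open>Off \<open>I\<close> the chosen covariant derivative is not determined, so
  \<open>V\<close> is compared with \<open>cov_deriv\<close> on \<open>I\<close> only. With
  \<open>c\<close> carrying the alternating sign, the lemma can be iterated.\<close>

lemma rough_laplacian_eq:
  assumes V: "V \<in> vector_fields_along I \<gamma>" and eq: "\<And>s. s \<in> I \<Longrightarrow> V s = c *\<^sub>R cov_deriv I \<gamma> k s"
    and c: "c = 1 \<or> c = -1"
  shows "rough_laplacian nabla I \<gamma> V \<in> vector_fields_along I \<gamma>"
    and "t \<in> I \<Longrightarrow> rough_laplacian nabla I \<gamma> V t = (- c) *\<^sub>R cov_deriv I \<gamma> (k + 2) t"
proof -
  let ?D = "covariant_derivative nabla I \<gamma>"
  note D = covariant_derivative_eq covariant_derivative_field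
  note cong = covD_cong
  have cov: "covD I \<gamma> (\<lambda>s. c *\<^sub>R cov_deriv I \<gamma> j s) t = c *\<^sub>R cov_deriv I \<gamma> (Suc j) t" if "t \<in> I" for j t
    using c covD_minus[OF cov_deriv_field[of j] that] by (auto simp: cov_deriv_Suc)
  have field: "(\<lambda>s. c *\<^sub>R cov_deriv I \<gamma> j s) \<in> vector_fields_along I \<gamma>" for j
    using cov_deriv_field[of j]
    by (auto simp: vector_fields_along_def intro!: smooth_on_interval_bilinear[OF I bounded_bilinear_scaleR] smooth_on_interval_const[OF I])
  have 1: "?D V s = c *\<^sub>R cov_deriv I \<gamma> (Suc k) s" if "s \<in> I" for s
    using D(1)[OF V that] cong[OF eq field that] cov[OF that] by simp
  have 2: "?D (?D V) s = c *\<^sub>R cov_deriv I \<gamma> (Suc (Suc k)) s" if "s \<in> I" for s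
    using D(1)[OF D(2)[OF V] that] cong[OF 1 field that] cov[OF that] by simp
  show "t \<in> I \<Longrightarrow> rough_laplacian nabla I \<gamma> V t = (- c) *\<^sub>R cov_deriv I \<gamma> (k + 2) t"
    by (simp add: rough_laplacian_def 2)
  have "smooth_on_interval I (?D (?D V))"
    using D(2)[OF D(2)[OF V]] by (auto simp: vector_fields_along_def)
  then have "smooth_on_interval I (\<lambda>t. (-1) *\<^sub>R ?D (?D V) t)"
    by (intro smooth_on_interval_bilinear[OF I bounded_bilinear_scaleR] smooth_on_interval_const[OF I])
  then show "rough_laplacian nabla I \<gamma> V \<in> vector_fields_along I \<gamma>"
    using D(2)[OF D(2)[OF V]] by (simp add: vector_fields_along_def rough_laplacian_def[abs_def])
qed

text \<open>Three Laplacians turn T1 into -T7 and two turn it into T5, while curvature 1 and |T0| =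
  1 give R(T5, T0) T0 = T5 - (T5.T0) T0.\<close>

lemma k_tension_4:
  assumes t: "t \<in> I" and unit: "norm (nth_deriv_on I 1 \<gamma> t) = 1"
  shows "k_tension nabla I \<gamma> 4 t = - (cov_deriv I \<gamma> 7 t + cov_deriv I \<gamma> 5 t
    - (cov_deriv I \<gamma> 5 t \<bullet> cov_deriv I \<gamma> 0 t) *\<^sub>R cov_deriv I \<gamma> 0 t)"
proof -
  let ?R = "rough_laplacian nabla I \<gamma>" and ?\<tau> = "tension nabla I \<gamma>"
  have e1: "?\<tau> s = 1 *\<^sub>R cov_deriv I \<gamma> 1 s" if "s \<in> I" for s
    using tension_eq(2)[OF that] by simp
  have f2: "?R ?\<tau> \<in> vector_fields_along I \<gamma>"
    by (rule rough_laplacian_eq(1)[OF tension_eq(1) e1]) simp_all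
  have e2: "?R ?\<tau> s = - 1 *\<^sub>R cov_deriv I \<gamma> (1 + 2) s" if "s \<in> I" for s
    by (rule rough_laplacian_eq(2)[OF tension_eq(1) e1 _ that]) simp_all
  have f3: "?R (?R ?\<tau>) \<in> vector_fields_along I \<gamma>"
    by (rule rough_laplacian_eq(1)[OF f2 e2]) simp_all
  have e3: "?R (?R ?\<tau>) s = - (- 1) *\<^sub>R cov_deriv I \<gamma> (1 + 2 + 2) s" if "s \<in> I" for s
    by (rule rough_laplacian_eq(2)[OF f2 e2 _ that]) simp_all
  have e4: "?R (?R (?R ?\<tau>)) t = - (- (- 1)) *\<^sub>R cov_deriv I \<gamma> (1 + 2 + 2 + 2) t"
    by (rule rough_laplacian_eq(2)[OF f3 e3 _ t]) simp_all
  have R3: "(?R ^^ (4 - 1)) ?\<tau> t = - cov_deriv I \<gamma> 7 t" and R2: "(?R ^^ (4 - 2)) ?\<tau> t = cov_deriv I \<gamma> 5 t"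
    using e4 e3[OF t] by (simp_all add: eval_nat_numeral)
  have tan: "\<gamma> t \<bullet> cov_deriv I \<gamma> k t = 0" for k
    using cov_deriv_field[of k] t by (simp add: vector_fields_along_def)
  have "cov_deriv I \<gamma> 0 t \<bullet> cov_deriv I \<gamma> 0 t = 1"
    using unit by (simp add: cov_deriv_0 norm_eq_1)
  then show ?thesis
    unfolding k_tension_def R3 R2 cov_deriv_0[symmetric] curvature_eq[OF nabla sphere[OF t] tan tan tan]
    by (simp add: algebra_simps)
qed

end

section \<open>4-harmonic curves\<close>

context
  fixes I :: "real set" and \<gamma> :: "real \<Rightarrow> 'a::euclidean_space" and d g
  assumes I: "\<And>t. t \<in> I \<Longrightarrow> at t within I \<noteq> bot"
    and smooth: "smooth_on_interval I \<gamma>"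
    and sphere: "\<And>t. t \<in> I \<Longrightarrow> \<gamma> t \<in> sphere 0 1"
    and unit: "\<And>t. t \<in> I \<Longrightarrow> norm (nth_deriv_on I 1 \<gamma> t) = 1"
  defines "d \<equiv> \<lambda>i. nth_deriv_on I i \<gamma>" and "g \<equiv> \<lambda>i j t. d i t \<bullet> d j t"
begin

lemma d_deriv: "t \<in> I \<Longrightarrow> (d i has_vector_derivative d (Suc i) t) (at t within I)"
  unfolding d_def by (rule nth_deriv_on_has_vector_derivative[OF smooth])

lemma g_commute: "g i j t = g j i t"
  by (simp add: g_def inner_commute)

lemmas g_swap = g_commute[of 1 0] g_commute[of 2 1] g_commute[of 3 1]
    g_commute[of 4 1] g_commute[of 5 1] g_commute[of 6 1] g_commute[of 7 1] g_commute[of 8 1]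
    g_commute[of 3 2] g_commute[of 4 2] g_commute[of 4 3] g_commute[of 5 2] g_commute[of 5 3]

lemma g_deriv: "t \<in> I \<Longrightarrow> (g i j has_real_derivative g (Suc i) j t + g i (Suc j) t) (at t within I)"
  using bounded_bilinear.has_vector_derivative[OF bounded_bilinear_inner d_deriv d_deriv]
  by (simp add: g_def has_real_derivative_iff_has_vector_derivative add.commute)

lemma real_deriv_eq:
  fixes f h :: "real \<Rightarrow> real"
  assumes "(f has_real_derivative D) (at t within I)" "(h has_real_derivative D') (at t within I)"
    "\<And>s. s \<in> I \<Longrightarrow> f s = h s" "t \<in> I"
  shows "D = D'"
proof -
  have "(f has_vector_derivative D') (at t within I)"
    by (rule has_vector_derivative_transform[OF assms(4,3)])
       (use assms(2) in \<open>simp_all add: has_real_derivative_iff_has_vector_derivative\<close>)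
  then show ?thesis
    using assms(1) vector_derivative_unique_within[OF I[OF assms(4)]]
    unfolding has_real_derivative_iff_has_vector_derivative by blast
qed

text \<open>Repeated differentiation of |\<gamma>|^2 = 1 and |\<gamma>'|^2 = 1. Products with
  \<gamma>' are thereby expressed by products of indices at least 2, a normal form in which
  coefficients can be compared.\<close>

lemma g_relations:
  assumes "t \<in> I"
  shows "g 0 1 t = 0" "g 1 1 t = 1" "g 0 3 t = 0" "g 1 2 t = 0" "g 1 3 t = - g 2 2 t" "g 1 4 t = - 3 * g 2 3 t"
    "g 1 5 t = - 3 * g 3 3 t - 4 * g 2 4 t" "g 1 6 t = - 10 * g 3 4 t - 5 * g 2 5 t"
    "g 1 7 t = - 10 * g 4 4 t - 15 * g 3 5 t - 6 * g 2 6 t"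
proof -
  have 00: "g 0 0 s = 1" if "s \<in> I" for s
    using sphere[OF that] by (simp add: g_def d_def norm_eq_1)
  have 01: "g 0 1 s = 0" if "s \<in> I" for s
    using real_deriv_eq[OF g_deriv[of _ 0 0, OF that] DERIV_const 00 that] g_commute[of 1 0 s] by simp
  have 11: "g 1 1 s = 1" if "s \<in> I" for s
    using unit[OF that] by (simp add: g_def d_def norm_eq_1)
  have 02: "g 0 2 s = - 1" if "s \<in> I" for s
    using real_deriv_eq[OF g_deriv[of _ 0 1, OF that, unfolded Suc_nums] DERIV_const 01 that] 11[OF that] by simp
  have 12: "g 1 2 s = 0" if "s \<in> I" for s
    using real_deriv_eq[OF g_deriv[of _ 1 1, OF that, unfolded Suc_nums] DERIV_const 11 that] g_commute[of 2 1 s] by simp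
  have 03: "g 0 3 s = 0" if "s \<in> I" for s
    using real_deriv_eq[OF g_deriv[of _ 0 2, OF that, unfolded Suc_nums] DERIV_const 02 that] 12[OF that] by simp
  have 13: "g 1 3 s = - g 2 2 s" if "s \<in> I" for s
    using real_deriv_eq[OF g_deriv[of _ 1 2, OF that, unfolded Suc_nums] DERIV_const 12 that] by simp
  have 14: "g 1 4 s = - 3 * g 2 3 s" if "s \<in> I" for s
    using real_deriv_eq[OF g_deriv[of _ 1 3, OF that, unfolded Suc_nums]
        DERIV_minus[OF g_deriv[of _ 2 2, OF that, unfolded Suc_nums]] 13 that] g_commute[of 3 2 s] by simp
  have 15: "g 1 5 s = - 3 * g 3 3 s - 4 * g 2 4 s" if "s \<in> I" for s
    using real_deriv_eq[OF g_deriv[of _ 1 4, OF that, unfolded Suc_nums]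
        DERIV_cmult[OF g_deriv[of _ 2 3, OF that, unfolded Suc_nums]] 14 that] by simp
  have 16: "g 1 6 s = - 10 * g 3 4 s - 5 * g 2 5 s" if "s \<in> I" for s
    using real_deriv_eq[OF g_deriv[of _ 1 5, OF that, unfolded Suc_nums]
        DERIV_diff[OF DERIV_cmult[OF g_deriv[of _ 3 3, OF that, unfolded Suc_nums]]
          DERIV_cmult[OF g_deriv[of _ 2 4, OF that, unfolded Suc_nums]]] 15 that] g_commute[of 4 3 s] by simp
  have 17: "g 1 7 s = - 10 * g 4 4 s - 15 * g 3 5 s - 6 * g 2 6 s" if "s \<in> I" for s
    using real_deriv_eq[OF g_deriv[of _ 1 6, OF that, unfolded Suc_nums]
        DERIV_diff[OF DERIV_cmult[OF g_deriv[of _ 3 4, OF that, unfolded Suc_nums]]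
          DERIV_cmult[OF g_deriv[of _ 2 5, OF that, unfolded Suc_nums]]] 16 that] by simp
  show "g 0 1 t = 0" "g 1 1 t = 1" "g 0 3 t = 0" "g 1 2 t = 0" "g 1 3 t = - g 2 2 t" "g 1 4 t = - 3 * g 2 3 t"
    "g 1 5 t = - 3 * g 3 3 t - 4 * g 2 4 t" "g 1 6 t = - 10 * g 3 4 t - 5 * g 2 5 t"
    "g 1 7 t = - 10 * g 4 4 t - 15 * g 3 5 t - 6 * g 2 6 t"
    using 01 11 03 12 13 14 15 16 17 assms by auto
qed

lemma inner_d: "d i t \<bullet> d j t = g i j t"
  by (simp add: g_def)

lemma cov_deriv_step:
  assumes "\<And>s. s \<in> I \<Longrightarrow> cov_deriv I \<gamma> k s = F s" "(F has_vector_derivative F') (at t within I)" "t \<in> I"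
  shows "cov_deriv I \<gamma> (Suc k) t = F' + (F t \<bullet> d 1 t) *\<^sub>R d 0 t"
proof -
  have "(cov_deriv I \<gamma> k has_vector_derivative F') (at t within I)"
    by (rule has_vector_derivative_transform[OF assms(3) _ assms(2)]) (use assms in auto)
  then show ?thesis
    unfolding cov_deriv_Suc covD_def
    using nth_deriv_on_1_eq[OF I _ assms(3)] assms(1)[OF assms(3)] by (simp add: d_def)
qed

text \<open>Each step differentiates the preceding expansion and adds its product with \<gamma>'
  times \<gamma>; \<open>g_relations\<close> then eliminates every \<open>g 1 j\<close> that
  arises.\<close>

lemma cov_deriv_expansions:
  assumes "t \<in> I"
  shows "cov_deriv I \<gamma> 0 t = d 1 t"
    "cov_deriv I \<gamma> 1 t = d 2 t + d 0 t"
    "cov_deriv I \<gamma> 2 t = d 3 t + d 1 t"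
    "cov_deriv I \<gamma> 3 t = d 4 t + d 2 t + (1 - g 2 2 t) *\<^sub>R d 0 t"
    "cov_deriv I \<gamma> 5 t = d 6 t + d 4 t + (1 - g 2 2 t) *\<^sub>R d 2 t + (- 7 * g 2 3 t) *\<^sub>R d 1 t
      + (1 - 2 * g 2 2 t - 8 * g 3 3 t - 9 * g 2 4 t) *\<^sub>R d 0 t"
    "cov_deriv I \<gamma> 7 t = d 8 t + d 6 t + (1 - g 2 2 t) *\<^sub>R d 4 t + (- 11 * g 2 3 t) *\<^sub>R d 3 t
      + (1 - 2 * g 2 2 t - 24 * g 3 3 t - 25 * g 2 4 t) *\<^sub>R d 2 t
      + (- 18 * g 2 3 t - 81 * g 3 4 t - 30 * g 2 5 t) *\<^sub>R d 1 t
      + (1 - 3 * g 2 2 t + (g 2 2 t)\<^sup>2 - 32 * g 3 3 t - 34 * g 2 4 t - 45 * g 4 4 t - 64 * g 3 5 t - 20 * g 2 6 t) *\<^sub>R d 0 t"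
proof -
  note simps = inner_add_left inner_scaleR_left inner_d g_relations g_swap
  note add = has_vector_derivative_add and scale = has_vector_derivative_scaleR
  have 0: "cov_deriv I \<gamma> 0 s = d 1 s" if "s \<in> I" for s
    by (simp add: cov_deriv_0 d_def)
  have 1: "cov_deriv I \<gamma> 1 s = d 2 s + d 0 s" if "s \<in> I" for s
    \<comment> \<open>\<open>euclidean_eqI\<close> turns the vector identity into one between real
      coordinates, where \<open>algebra_simps\<close> compares the coefficients.\<close>
    by (rule trans[OF cov_deriv_step[OF 0 d_deriv[OF that] that, unfolded Suc_nums]], assumption, rule euclidean_eqI)
       (simp add: simps that algebra_simps power2_eq_square del: One_nat_def)
  have 2: "cov_deriv I \<gamma> 2 s = d 3 s + d 1 s" if "s \<in> I" for s
    by (rule trans[OF cov_deriv_step[OF 1 add[OF d_deriv[OF that] d_deriv[OF that]] that, unfolded Suc_nums]], assumption, rule euclidean_eqI)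
       (simp add: simps that algebra_simps power2_eq_square del: One_nat_def)
  have 3: "cov_deriv I \<gamma> 3 s = d 4 s + d 2 s + (1 - g 2 2 s) *\<^sub>R d 0 s" if "s \<in> I" for s
    by (rule trans[OF cov_deriv_step[OF 2 add[OF d_deriv[OF that] d_deriv[OF that]] that, unfolded Suc_nums]], assumption, rule euclidean_eqI)
       (simp add: simps that algebra_simps power2_eq_square del: One_nat_def)
  have 4: "cov_deriv I \<gamma> 4 s = d 5 s + d 3 s + (1 - g 2 2 s) *\<^sub>R d 1 s + (- 5 * g 2 3 s) *\<^sub>R d 0 s" if "s \<in> I" for s
    by (rule trans[OF cov_deriv_step[OF 3 add[OF add[OF d_deriv[OF that] d_deriv[OF that]] scale[OF DERIV_diff[OF DERIV_const[of 1] g_deriv[OF that, of 2 2]] d_deriv[OF that]]] that, unfolded Suc_nums]], assumption, rule euclidean_eqI)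
       (simp add: simps that algebra_simps power2_eq_square del: One_nat_def)
  have 5: "cov_deriv I \<gamma> 5 s = d 6 s + d 4 s + (1 - g 2 2 s) *\<^sub>R d 2 s + (- 7 * g 2 3 s) *\<^sub>R d 1 s
      + (1 - 2 * g 2 2 s - 8 * g 3 3 s - 9 * g 2 4 s) *\<^sub>R d 0 s" if "s \<in> I" for s
    by (rule trans[OF cov_deriv_step[OF 4 add[OF add[OF add[OF d_deriv[OF that] d_deriv[OF that]] scale[OF DERIV_diff[OF DERIV_const[of 1] g_deriv[OF that, of 2 2]] d_deriv[OF that]]] scale[OF DERIV_cmult[OF g_deriv[OF that, of 2 3]] d_deriv[OF that]]] that, unfolded Suc_nums]], assumption, rule euclidean_eqI)
       (simp add: simps that algebra_simps power2_eq_square del: One_nat_def)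
  have 6: "cov_deriv I \<gamma> 6 s = d 7 s + d 5 s + (1 - g 2 2 s) *\<^sub>R d 3 s + (- 9 * g 2 3 s) *\<^sub>R d 2 s
      + (1 - 2 * g 2 2 s - 15 * g 3 3 s - 16 * g 2 4 s) *\<^sub>R d 1 s
      + (- 14 * g 2 3 s - 35 * g 3 4 s - 14 * g 2 5 s) *\<^sub>R d 0 s" if "s \<in> I" for s
    by (rule trans[OF cov_deriv_step[OF 5 add[OF add[OF add[OF add[OF d_deriv[OF that] d_deriv[OF that]] scale[OF DERIV_diff[OF DERIV_const[of 1] g_deriv[OF that, of 2 2]] d_deriv[OF that]]] scale[OF DERIV_cmult[OF g_deriv[OF that, of 2 3]] d_deriv[OF that]]] scale[OF DERIV_diff[OF DERIV_diff[OF DERIV_diff[OF DERIV_const[of 1] DERIV_cmult[OF g_deriv[OF that, of 2 2]]] DERIV_cmult[OF g_deriv[OF that, of 3 3]]] DERIV_cmult[OF g_deriv[OF that, of 2 4]]] d_deriv[OF that]]] that, unfolded Suc_nums]], assumption, rule euclidean_eqI)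
       (simp add: simps that algebra_simps power2_eq_square del: One_nat_def)
  have 7: "cov_deriv I \<gamma> 7 s = d 8 s + d 6 s + (1 - g 2 2 s) *\<^sub>R d 4 s + (- 11 * g 2 3 s) *\<^sub>R d 3 s
      + (1 - 2 * g 2 2 s - 24 * g 3 3 s - 25 * g 2 4 s) *\<^sub>R d 2 s
      + (- 18 * g 2 3 s - 81 * g 3 4 s - 30 * g 2 5 s) *\<^sub>R d 1 s
      + (1 - 3 * g 2 2 s + (g 2 2 s)\<^sup>2 - 32 * g 3 3 s - 34 * g 2 4 s - 45 * g 4 4 s - 64 * g 3 5 s - 20 * g 2 6 s) *\<^sub>R d 0 s" if "s \<in> I" for s
    by (rule trans[OF cov_deriv_step[OF 6 add[OF add[OF add[OF add[OF add[OF d_deriv[OF that] d_deriv[OF that]] scale[OF DERIV_diff[OF DERIV_const[of 1] g_deriv[OF that, of 2 2]] d_deriv[OF that]]] scale[OF DERIV_cmult[OF g_deriv[OF that, of 2 3]] d_deriv[OF that]]] scale[OF DERIV_diff[OF DERIV_diff[OF DERIV_diff[OF DERIV_const[of 1] DERIV_cmult[OF g_deriv[OF that, of 2 2]]] DERIV_cmult[OF g_deriv[OF that, of 3 3]]] DERIV_cmult[OF g_deriv[OF that, of 2 4]]] d_deriv[OF that]]] scale[OF DERIV_diff[OF DERIV_diff[OF DERIV_cmult[OF g_deriv[OF that, of 2 3]] DERIV_cmult[OF g_deriv[OF that, of 3 4]]] DERIV_cmult[OF g_deriv[OF that, of 2 5]]] d_deriv[OF that]]] that, unfolded Suc_nums]],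 assumption, rule euclidean_eqI)
       (simp add: simps that algebra_simps power2_eq_square del: One_nat_def)
  show "cov_deriv I \<gamma> 0 t = d 1 t"
    "cov_deriv I \<gamma> 1 t = d 2 t + d 0 t"
    "cov_deriv I \<gamma> 2 t = d 3 t + d 1 t"
    "cov_deriv I \<gamma> 3 t = d 4 t + d 2 t + (1 - g 2 2 t) *\<^sub>R d 0 t"
    "cov_deriv I \<gamma> 5 t = d 6 t + d 4 t + (1 - g 2 2 t) *\<^sub>R d 2 t + (- 7 * g 2 3 t) *\<^sub>R d 1 t
      + (1 - 2 * g 2 2 t - 8 * g 3 3 t - 9 * g 2 4 t) *\<^sub>R d 0 t"
    "cov_deriv I \<gamma> 7 t = d 8 t + d 6 t + (1 - g 2 2 t) *\<^sub>R d 4 t + (- 11 * g 2 3 t) *\<^sub>R d 3 t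
      + (1 - 2 * g 2 2 t - 24 * g 3 3 t - 25 * g 2 4 t) *\<^sub>R d 2 t
      + (- 18 * g 2 3 t - 81 * g 3 4 t - 30 * g 2 5 t) *\<^sub>R d 1 t
      + (1 - 3 * g 2 2 t + (g 2 2 t)\<^sup>2 - 32 * g 3 3 t - 34 * g 2 4 t - 45 * g 4 4 t - 64 * g 3 5 t - 20 * g 2 6 t) *\<^sub>R d 0 t"
    using 0 1 2 3 5 7 assms by blast+
qed

text \<open>Since T5.T0 = -10 g23 - 10 g34 - 5 g25, the sum T7 + T5 - (T5.T0) T0 has the coefficient
  -71 g34 - 25 g25 - 15 g23 at \<gamma>'. Eliminating \<open>g 1 6\<close> from the left-hand side
  gives -71 g34 - 25 g25 - 13 g23 there; the other coefficients agree.\<close>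

lemma printed_equation_eq:
  assumes "t \<in> I"
  shows "d 8 t + 2 *\<^sub>R d 6 t + (2 - g 2 2 t) *\<^sub>R d 4 t - (11 * g 2 3 t) *\<^sub>R d 3 t
         + (- 24 * g 3 3 t - 25 * g 2 4 t + 2 - 3 * g 2 2 t) *\<^sub>R d 2 t
         + (19 * g 3 4 t + 20 * g 2 5 t + 9 * g 1 6 t - 13 * g 2 3 t) *\<^sub>R d 1 t
         + (5 * g 4 4 t + 11 * g 3 5 t + 10 * g 2 6 t + 5 * g 1 7 t - 40 * g 3 3 t - 43 * g 2 4 t
            + (g 2 2 t)\<^sup>2 - 5 * g 2 2 t + 2) *\<^sub>R d 0 t
     = cov_deriv I \<gamma> 7 t + cov_deriv I \<gamma> 5 t
       - (cov_deriv I \<gamma> 5 t \<bullet> cov_deriv I \<gamma> 0 t) *\<^sub>R cov_deriv I \<gamma> 0 t + (2 * g 2 3 t) *\<^sub>R cov_deriv I \<gamma> 0 t"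
  unfolding cov_deriv_expansions[OF assms]
  by (rule euclidean_eqI)
     (simp add: inner_add_left inner_diff_left inner_d g_relations[OF assms] g_swap algebra_simps
       power2_eq_square del: One_nat_def)

lemma curvature_inner_products:
  assumes "t \<in> I"
  shows "cov_deriv I \<gamma> 1 t \<bullet> cov_deriv I \<gamma> 2 t = g 2 3 t"
    and "cov_deriv I \<gamma> 3 t \<bullet> cov_deriv I \<gamma> 0 t = - 3 * g 2 3 t"
  unfolding cov_deriv_expansions[OF assms]
  by (simp_all add: inner_add_left inner_add_right inner_d g_relations[OF assms] g_swap del: One_nat_def)

text \<open>Here \<open>jet_covariant_family\<close> is used with the position vector of the curve
  as \<open>N\<close>. The relation T1.T2 = 0 obtained for the jet at \<open>t\<close> is the claim,
  since T1.T2 = g23.\<close>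

lemma curvature_stationary_of_ode:
  fixes nabla :: "('a \<Rightarrow> 'a) \<Rightarrow> ('a \<Rightarrow> 'a) \<Rightarrow> 'a \<Rightarrow> 'a"
  assumes nabla: "levi_civita_connection nabla" and ode: "\<And>t. t \<in> I \<Longrightarrow> cov_deriv I \<gamma> 7 t + cov_deriv I \<gamma> 5 t =
      (cov_deriv I \<gamma> 5 t \<bullet> cov_deriv I \<gamma> 0 t + \<kappa> * (cov_deriv I \<gamma> 3 t \<bullet> cov_deriv I \<gamma> 0 t)) *\<^sub>R cov_deriv I \<gamma> 0 t"
    and \<kappa>: "0 \<le> \<kappa>" "\<kappa> \<le> 2/3" and t: "t \<in> I"
  shows "g 2 3 t = 0"
proof -
  have "jet \<kappa> (\<lambda>k. cov_deriv I \<gamma> k t)"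
  proof (rule jet_covariant_family[OF I _ _ _ ode t])
    show "(cov_deriv I \<gamma> k has_vector_derivative
        cov_deriv I \<gamma> (Suc k) t - (cov_deriv I \<gamma> k t \<bullet> cov_deriv I \<gamma> 0 t) *\<^sub>R \<gamma> t) (at t within I)"
      if "t \<in> I" for k t
      by (rule cov_deriv_has_vector_derivative[OF nabla I smooth sphere that])
    show "\<gamma> t \<bullet> cov_deriv I \<gamma> k t = 0" if "t \<in> I" for k t
      using cov_deriv_field[OF nabla I smooth sphere, of k] that by (simp add: vector_fields_along_def)
    show "cov_deriv I \<gamma> 0 t \<bullet> cov_deriv I \<gamma> 0 t = 1" if "t \<in> I" for t
      using unit[OF that] by (simp add: cov_deriv_0 norm_eq_1)
  qed
  from jet_curvature_stationary[OF this \<kappa>] show ?thesis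
    by (simp only: curvature_inner_products[OF t])
qed

end

theorem proposition7p3:
  fixes nabla :: "('a::euclidean_space \<Rightarrow> 'a) \<Rightarrow> ('a \<Rightarrow> 'a) \<Rightarrow> 'a \<Rightarrow> 'a"
    and I :: "real set" and \<gamma> :: "real \<Rightarrow> 'a" and n :: nat
  assumes "DIM('a) = n + 1"
    and "levi_civita_connection nabla"
    and "is_interval I" and "interior I \<noteq> {}"
    and "smooth_on_interval I \<gamma>"
    and "\<forall>t\<in>I. \<gamma> t \<in> sphere 0 1"
    and "\<forall>t\<in>I. norm (nth_deriv_on I 1 \<gamma> t) = 1"
  shows "k_harmonic nabla I \<gamma> 4 \<longleftrightarrow>
    (\<forall>t\<in>I.
      let d = (\<lambda>i. nth_deriv_on I i \<gamma> t);
          g = (\<lambda>i j. d i \<bullet> d j)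
      in d 8 + 2 *\<^sub>R d 6 + (2 - g 2 2) *\<^sub>R d 4 - (11 * g 2 3) *\<^sub>R d 3
         + (- 24 * g 3 3 - 25 * g 2 4 + 2 - 3 * g 2 2) *\<^sub>R d 2
         + (19 * g 3 4 + 20 * g 2 5 + 9 * g 1 6 - 13 * g 2 3) *\<^sub>R d 1
         + (5 * g 4 4 + 11 * g 3 5 + 10 * g 2 6 + 5 * g 1 7 - 40 * g 3 3 - 43 * g 2 4
            + (g 2 2)\<^sup>2 - 5 * g 2 2 + 2) *\<^sub>R d 0 = 0)"
proof -
  \<comment> \<open>One-sided derivatives at \<open>t\<close> are unique only if \<open>t\<close> is
    a limit point of \<open>I\<close>; an interval with interior points has no isolated
    ones.\<close>
  have perfect: "at t within I \<noteq> bot" if "t \<in> I" for t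
  proof -
    have "connected I" using assms(3) by (simp add: is_interval_connected_1)
    moreover have "I \<noteq> {x}" for x using assms(4) by auto
    ultimately show ?thesis
      using connected_imp_perfect[of I t] that by (simp add: trivial_limit_within)
  qed
  have sphere: "\<gamma> t \<in> sphere 0 1" and unit: "norm (nth_deriv_on I 1 \<gamma> t) = 1" if "t \<in> I" for t
    using assms(6,7) that by auto
  let ?T = "cov_deriv I \<gamma>" and ?g = "\<lambda>t. nth_deriv_on I 2 \<gamma> t \<bullet> nth_deriv_on I 3 \<gamma> t"
  let ?h = "\<lambda>t. ?T 7 t + ?T 5 t - (?T 5 t \<bullet> ?T 0 t) *\<^sub>R ?T 0 t"
  have inner: "?T 3 t \<bullet> ?T 0 t = - 3 * ?g t" if "t \<in> I" for t
    by (rule curvature_inner_products(2)[OF perfect assms(5) sphere unit that])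
  note stationary = curvature_stationary_of_ode[OF perfect assms(5) sphere unit assms(2)]
  have "k_harmonic nabla I \<gamma> 4 \<longleftrightarrow> (\<forall>t\<in>I. ?h t = 0)"
    unfolding k_harmonic_def
    using k_tension_4[OF assms(2) perfect assms(5) sphere _ unit] by (simp only: neg_equal_0_iff_equal cong: ball_cong)
  moreover have "(\<forall>t\<in>I. ?h t = 0) \<longleftrightarrow> (\<forall>t\<in>I. ?h t + (2 * ?g t) *\<^sub>R ?T 0 t = 0)"
  proof
    assume h: "\<forall>t\<in>I. ?h t = 0"
    have "?g t = 0" if "t \<in> I" for t
      by (rule stationary[of 0]) (use h that in \<open>auto simp: algebra_simps\<close>)
    then show "\<forall>t\<in>I. ?h t + (2 * ?g t) *\<^sub>R ?T 0 t = 0" using h by simp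
  next
    assume h: "\<forall>t\<in>I. ?h t + (2 * ?g t) *\<^sub>R ?T 0 t = 0"
    \<comment> \<open>Moved to the right-hand side, the extra term has coefficient -2 g23 = (2/3)
      (T3.T0), which is where the value 2/3 of \<kappa> comes from.\<close>
    have ode: "?T 7 t + ?T 5 t = (?T 5 t \<bullet> ?T 0 t + 2/3 * (?T 3 t \<bullet> ?T 0 t)) *\<^sub>R ?T 0 t" if "t \<in> I" for t
    proof -
      have "?T 7 t + ?T 5 t = (?T 5 t \<bullet> ?T 0 t) *\<^sub>R ?T 0 t - (2 * ?g t) *\<^sub>R ?T 0 t"
      proof -
        have "a = z - w" if "a - z + w = 0" for a z w :: 'a
        proof -
          have "a - z + w + (z - w) = z - w" by (simp only: that add_0)
          then show ?thesis by simp
        qed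
        then show ?thesis using h that by blast
      qed
      then show ?thesis unfolding inner[OF that] by (simp add: scaleR_diff_left)
    qed
    have "?g t = 0" if "t \<in> I" for t
      by (rule stationary[OF _ _ _ ode]) (use that in auto)
    then show "\<forall>t\<in>I. ?h t = 0" using h by simp
  qed
  ultimately show ?thesis
    unfolding Let_def using printed_equation_eq[OF perfect assms(5) sphere unit] by (simp cong: ball_cong)
qed

end
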